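(* Let $k\ge 0$ be an integer, $q\ge0$, $\phi_k(x)=\sum_{i=1}^k\delta_i\mathbf 1_{\{x>b_i\}}$, and $d\in\mathbb R$ with $d<b_1$. Then the function $x\mapsto w_k^{(q)}(x;d)$, $x\in\mathbb R$, is the unique solution of the equation $$w_k^{(q)}(x;d)=W^{(q)}(x-d)+\int_d^xW^{(q)}(x-y)\,\phi_k(y)\,w_k^{(q)\prime}(y;d)\,dy,\qquad x\in\mathbb R.$$
   Context: $X$ is a spectrally negative Lévy process without monotone paths, with Laplace exponent $\psi(\lambda)=\gamma\lambda+\frac12\sigma^2\lambda^2+\int_0^\infty(e^{-\lambda z}-1+\lambda z\mathbf 1_{(0,1)}(z))\,\Pi(dz)$, $\lambda\ge0$. $X$ has bounded variation paths iff $\sigma=0$ and $\int_0^1z\,\Pi(dz)<\infty$; then $c:=\gamma+\int_0^1z\,\Pi(dz)$ is its drift. Let $\delta_1,\dots,\delta_k>0$ and $-\infty<b_1<\dots<b_k<\infty$; in the bounded variation case assume $\delta_1+\dots+\delta_k<c$. (For $k=0$, $\phi_0=0$ and the condition $d<b_1$ is void.) For $0\le j\le k$ let $\psi_j(\lambda)=\psi(\lambda)-(\delta_1+\dots+\delta_j)\lambda$ and $\varphi_j(q)=\sup\{\lambda\ge0:\psi_j(\lambda)=q\}$. The scale function $W_j^{(q)}$ is the continuous function on $[0,\infty)$ with $\int_0^\infty e^{-\lambda y}W_j^{(q)}(y)\,dy=1/(\psi_j(\lambda)-q)$ for $\lambda>\varphi_j(q)$, extended by $W_j^{(q)}(x)=0$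 for $x<0$; $W^{(q)}=W_0^{(q)}$. Define recursively, $j=1,\dots,k$: $w_0^{(q)}(x;d)=W^{(q)}(x-d)$, $w_j^{(q)}(x;d)=w_{j-1}^{(q)}(x;d)+\delta_j\int_{b_j}^xW_j^{(q)}(x-y)w_{j-1}^{(q)\prime}(y;d)\,dy$. Conventions: $\int_a^b=0$ if $b<a$. Primes denote derivatives in the first variable, existing almost everywhere (the possible jump at $d$ is not counted). Solutions of the equation are understood to be functions of $x$ that are differentiable almost everywhere and for which the integrals in the equation are well defined (as Lebesgue integrals). *)

theory Defs
  imports "HOL-Probability.Probability"
begin

section \<open>Spectrally negative Levy processes\<close>

text \<open>
  Time is the half line of nonnegative reals; \<open>X t\<close> is irrelevant for \<open>t < 0\<close>.
\<close>

definition levy_process :: "'a measure \<Rightarrow> (real \<Rightarrow> 'a \<Rightarrow> real) \<Rightarrow> bool" where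
  "levy_process M X \<longleftrightarrow>
     prob_space M \<and>
     (\<forall>t\<ge>0. X t \<in> borel_measurable M) \<and>
     (AE \<omega> in M. X 0 \<omega> = 0) \<and>
     (\<forall>(n::nat) (t::nat \<Rightarrow> real). 0 \<le> t 0 \<and> mono t \<longrightarrow>
        prob_space.indep_vars M (\<lambda>_. borel)
          (\<lambda>i \<omega>. X (t (Suc i)) \<omega> - X (t i) \<omega>) {..<n}) \<and>
     (\<forall>s\<ge>0. \<forall>t\<ge>0. distr M borel (\<lambda>\<omega>. X (s + t) \<omega> - X s \<omega>) = distr M borel (X t)) \<and>
     (AE \<omega> in M. (\<forall>t\<ge>0. continuous (at_right t) (\<lambda>s. X s \<omega>)) \<and>
        (\<forall>t>0. \<exists>l. ((\<lambda>s. X s \<omega>) \<longlongrightarrow> l) (at_left t)))"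

definition spectrally_negative_levy :: "'a measure \<Rightarrow> (real \<Rightarrow> 'a \<Rightarrow> real) \<Rightarrow> bool" where
  "spectrally_negative_levy M X \<longleftrightarrow>
     levy_process M X \<and>
     (AE \<omega> in M. \<forall>t>0. \<forall>l. ((\<lambda>s. X s \<omega>) \<longlongrightarrow> l) (at_left t) \<longrightarrow> X t \<omega> \<le> l)"

definition without_monotone_paths :: "'a measure \<Rightarrow> (real \<Rightarrow> 'a \<Rightarrow> real) \<Rightarrow> bool" where
  "without_monotone_paths M X \<longleftrightarrow>
     \<not> (AE \<omega> in M. \<forall>s t. 0 \<le> s \<and> s \<le> t \<longrightarrow> X s \<omega> \<le> X t \<omega>) \<and>
     \<not> (AE \<omega> in M. \<forall>s t. 0 \<le> s \<and> s \<le> t \<longrightarrow> X t \<omega> \<le> X s \<omega>)"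

definition bounded_variation_paths :: "'a measure \<Rightarrow> (real \<Rightarrow> 'a \<Rightarrow> real) \<Rightarrow> bool" where
  "bounded_variation_paths M X \<longleftrightarrow>
     (AE \<omega> in M. \<forall>T\<ge>0. \<exists>C. \<forall>(n::nat) (t::nat \<Rightarrow> real).
        0 \<le> t 0 \<and> mono t \<and> t n \<le> T \<longrightarrow>
          (\<Sum>i<n. \<bar>X (t (Suc i)) \<omega> - X (t i) \<omega>\<bar>) \<le> C)"

text \<open>
  Jumps are recorded by their absolute value, so the jump measure lives on the positive half line.
\<close>

definition levy_measure :: "real measure \<Rightarrow> bool" where
  "levy_measure \<nu> \<longleftrightarrow>
     sets \<nu> = sets borel \<and> emeasure \<nu> {..0} = 0 \<and> integrable \<nu> (\<lambda>z. min 1 (z\<^sup>2))"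

definition laplace_psi :: "real \<Rightarrow> real \<Rightarrow> real measure \<Rightarrow> real \<Rightarrow> real" where
  "laplace_psi \<gamma> \<sigma> \<nu> \<theta> =
     \<gamma> * \<theta> + 1/2 * \<sigma>\<^sup>2 * \<theta>\<^sup>2
     + (LINT z:{0<..}|\<nu>. exp (- \<theta> * z) - 1 + \<theta> * z * indicator {0<..<1} z)"

definition has_laplace_exponent ::
  "'a measure \<Rightarrow> (real \<Rightarrow> 'a \<Rightarrow> real) \<Rightarrow> (real \<Rightarrow> real) \<Rightarrow> bool" where
  "has_laplace_exponent M X \<psi> \<longleftrightarrow>
     (\<forall>t\<ge>0. \<forall>\<theta>\<ge>0. integrable M (\<lambda>\<omega>. exp (\<theta> * X t \<omega>)) \<and>
        (LINT \<omega>|M. exp (\<theta> * X t \<omega>)) = exp (t * \<psi> \<theta>))"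

text \<open>
  Only meaningful for paths of bounded variation. The open interval is the one of the
  truncation in \<^const>\<open>laplace_psi\<close>; this matters if \<open>\<nu>\<close> has an atom at 1.
\<close>

definition drift :: "real \<Rightarrow> real measure \<Rightarrow> real" where
  "drift \<gamma> \<nu> = \<gamma> + (LINT z:{0<..<1}|\<nu>. z)"


section \<open>Scale functions\<close>

definition refracted_psi :: "(real \<Rightarrow> real) \<Rightarrow> (nat \<Rightarrow> real) \<Rightarrow> nat \<Rightarrow> real \<Rightarrow> real" where
  "refracted_psi \<psi> \<delta> j \<theta> = \<psi> \<theta> - (\<Sum>i=1..j. \<delta> i) * \<theta>"

definition right_inverse :: "(real \<Rightarrow> real) \<Rightarrow> real \<Rightarrow> real" where
  "right_inverse \<psi> q = Sup {\<theta>. 0 \<le> \<theta> \<and> \<psi> \<theta> = q}"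

text \<open>
  Continuity is only required on the closed half line: at 0 the function may jump as a
  function on the whole real line. By uniqueness of Laplace transforms at most one \<open>W\<close>
  satisfies the predicate.
\<close>

definition is_scale_function :: "(real \<Rightarrow> real) \<Rightarrow> real \<Rightarrow> (real \<Rightarrow> real) \<Rightarrow> bool" where
  "is_scale_function \<psi> q W \<longleftrightarrow>
     continuous_on {0..} W \<and>
     (\<forall>x<0. W x = 0) \<and>
     (\<forall>\<theta>>right_inverse \<psi> q.
        set_integrable lborel {0..} (\<lambda>y. exp (- \<theta> * y) * W y) \<and>
        (LINT y:{0..}|lborel. exp (- \<theta> * y) * W y) = 1 / (\<psi> \<theta> - q))"


section \<open>The functions of the recursion and the integral equation\<close>

text \<open>
  \<^const>\<open>deriv\<close> is the pointwise derivative where it exists, with an unspecified value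
  elsewhere; in particular a jump contributes nothing. Integration is with respect to
  \<^const>\<open>lebesgue\<close>, so that values of the integrand on a null set are immaterial even
  for measurability.
  For \<open>b < a\<close> the set \<open>{a..b}\<close> is empty and the integral over it is 0.
\<close>

primrec refracted_w ::
  "(nat \<Rightarrow> real \<Rightarrow> real) \<Rightarrow> (nat \<Rightarrow> real) \<Rightarrow> (nat \<Rightarrow> real) \<Rightarrow> real \<Rightarrow> nat \<Rightarrow> real \<Rightarrow> real" where
  "refracted_w W \<delta> b d 0 = (\<lambda>x. W 0 (x - d))"
| "refracted_w W \<delta> b d (Suc j) = (\<lambda>x. refracted_w W \<delta> b d j x
     + \<delta> (Suc j) * (LINT y:{b (Suc j)..x}|lebesgue.
         W (Suc j) (x - y) * deriv (refracted_w W \<delta> b d j) y))"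

definition refraction_rate :: "(nat \<Rightarrow> real) \<Rightarrow> (nat \<Rightarrow> real) \<Rightarrow> nat \<Rightarrow> real \<Rightarrow> real" where
  "refraction_rate \<delta> b k x = (\<Sum>i=1..k. \<delta> i * indicator {b i<..} x)"

definition is_solution ::
  "(real \<Rightarrow> real) \<Rightarrow> (real \<Rightarrow> real) \<Rightarrow> real \<Rightarrow> (real \<Rightarrow> real) \<Rightarrow> bool" where
  "is_solution W \<phi> d u \<longleftrightarrow>
     (AE x in lebesgue. u differentiable at x) \<and>
     (\<forall>x. set_integrable lebesgue {d..x} (\<lambda>y. W (x - y) * \<phi> y * deriv u y)) \<and>
     (\<forall>x. u x = W (x - d) + (LINT y:{d..x}|lebesgue. W (x - y) * \<phi> y * deriv u y))"

end

(*
  Write mu_j for the Stieltjes measure of W_j on the closed half line and Delta_j for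
  delta_1 + ... + delta_j. Comparing Laplace transforms gives mu_j - mu_0 = Delta_j mu_j * mu_0.
  Since the derivative of w_j differs from that of w_(j-1) by a term supported to the right of b_j,
  where phi_j is the constant Delta_j, this identity yields the equation by induction on j.
  Uniqueness is the uniqueness of locally integrable solutions of a Volterra equation for the
  derivative; the coefficient 1 - W_0(0) phi_k in front is positive because W_0(0) Delta_k < 1.

  All this needs W_j to be absolutely continuous. Approximating the Levy process by left
  skip-free random walks on a lattice turns W_j into the limit of renewal sequences with an antitone
  kernel. Such sequences are log-concave, hence so is W_j, and a continuous, nondecreasing and
  log-concave function is absolutely continuous.

  The only use of the process itself is the condition on the drift: if the Laplace exponent is at
  most c theta, then c t - X_t has nondecreasing paths, so X has paths of bounded variation.
*)
theory Submission
  imports Defs "HOL-Real_Asymp.Real_Asymp"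
begin

section \<open>Log-concavity of renewal sequences\<close>

text \<open>The antitone kernel comes from dividing the exponent by its argument. With bounded
  variation and drift c, (psi(t) - q) / t equals c minus the integral of exp(-t y) (nu(y, infinity)
  + q) dy, so the Stieltjes measure of W, multiplied by c, is a unit mass at 0 plus its own
  convolution with a tail function plus the constant q. A tail is antitone, and adding q preserves
  this. With unbounded variation there is no finite c; on a lattice the equation is available again,
  with a rate that diverges along the approximation. Log-concavity of the solution passes to limits
  without any bound on these rates.

  Absolute continuity is essential because \<open>deriv\<close> sees only the absolutely continuous
  part of a monotone function: the recursion would lose the mass of a singular part.

  The inequality W_0(0) Delta_k < 1 is obtained without computing W_0(0): monotonicity of W_0 gives
  W_0(0) (psi_0(t) - q) \<le> t for large t, while psi_k(t) > q there.\<close>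

fun renewal :: "(nat \<Rightarrow> real) \<Rightarrow> real \<Rightarrow> nat \<Rightarrow> real" where
  "renewal k a m = (if m = 0 then a else (\<Sum>j<m. k (m - j) * renewal k a j))"

declare renewal.simps [simp del]

definition renewal_sum :: "(nat \<Rightarrow> real) \<Rightarrow> real \<Rightarrow> nat \<Rightarrow> real" where
  "renewal_sum k a m = (\<Sum>j\<le>m. renewal k a j)"

lemma renewal_nonneg:
  assumes "\<And>i. 0 \<le> k i" "0 \<le> a"
  shows "0 \<le> renewal k a m"
proof (induction m rule: less_induct)
  case (less m)
  then show ?case
    using assms by (subst renewal.simps) (auto intro!: sum_nonneg mult_nonneg_nonneg)
qed

lemma renewal_sum_pos:
  assumes "\<And>i. 0 \<le> k i" "0 < a"
  shows "0 < renewal_sum k a m"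
proof -
  have "renewal k a 0 \<le> renewal_sum k a m"
    unfolding renewal_sum_def
    by (rule member_le_sum) (use renewal_nonneg[of k a] assms in auto)
  then show ?thesis
    using assms(2) by (simp add: renewal.simps)
qed

lemma renewal_sum_mono:
  assumes "\<And>i. 0 \<le> k i" "0 \<le> a" "i \<le> j"
  shows "renewal_sum k a i \<le> renewal_sum k a j"
  unfolding renewal_sum_def
  by (rule sum_mono2) (use assms renewal_nonneg[of k a] in auto)

lemma sum_by_parts:
  fixes c f :: "nat \<Rightarrow> real"
  shows "(\<Sum>j\<le>m. c j * f j) = c m * (\<Sum>j\<le>m. f j) - (\<Sum>j<m. (c (Suc j) - c j) * (\<Sum>i\<le>j. f i))"
  by (induction m) (auto simp: algebra_simps)

text \<open>Summation by parts moves the recursion from the terms to their partial sums. The new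
  coefficients \<open>k (m - j) - k (Suc m - j)\<close> are decrements of the kernel, nonnegative
  when it is antitone from index 1 on.\<close>

lemma renewal_Suc:
  "renewal k a (Suc m) = k 1 * renewal_sum k a m
     - (\<Sum>j<m. (k (m - j) - k (Suc m - j)) * renewal_sum k a j)"
proof -
  have "renewal k a (Suc m) = (\<Sum>j\<le>m. k (Suc m - j) * renewal k a j)"
    by (subst renewal.simps) (simp add: lessThan_Suc_atMost)
  also have "\<dots> = k 1 * renewal_sum k a m
     - (\<Sum>j<m. (k (m - j) - k (Suc m - j)) * renewal_sum k a j)"
    by (subst sum_by_parts) (simp add: renewal_sum_def)
  finally show ?thesis .
qed

text \<open>
  Dividing \<open>renewal_Suc\<close> by \<open>renewal_sum k a m\<close>, the subtracted terms increase with \<open>m\<close> as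
  long as the earlier ratios of consecutive sums decrease.
\<close>

lemma renewal_sum_log_concave_step:
  assumes k: "\<And>i. 0 \<le> k i" and dec: "\<And>i. 1 \<le> i \<Longrightarrow> k (Suc i) \<le> k i" and a: "0 < a"
    and "i \<le> m"
  shows "renewal_sum k a (Suc m) * renewal_sum k a i \<le> renewal_sum k a (Suc i) * renewal_sum k a m"
  using \<open>i \<le> m\<close>
proof (induction m arbitrary: i rule: less_induct)
  case (less m)
  let ?w = "renewal_sum k a" and ?d = "renewal k a"
  have w: "0 < ?w j" for j
    using renewal_sum_pos k a by blast
  have w_Suc: "?w (Suc j) = ?w j + ?d (Suc j)" for j
    by (simp add: renewal_sum_def)
  \<comment> \<open>The case \<open>i = l\<close> carries the whole argument; smaller
    \<open>i\<close> follow by chaining it with the induction hypothesis and cancelling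
    \<open>?w l\<close>.\<close>
  have one: "?w (Suc (Suc l)) * ?w l \<le> ?w (Suc l) * ?w (Suc l)" if m: "m = Suc l" for l
  proof -
    have "?d (Suc (Suc l)) * ?w l \<le> ?d (Suc l) * ?w (Suc l)"
    proof -
      let ?q = "\<lambda>j. k j - k (Suc j)"
      have eq1: "?d (Suc (Suc l)) * ?w l
          = k 1 * ?w (Suc l) * ?w l - (\<Sum>j<Suc l. ?q (Suc l - j) * ?w j * ?w l)"
        by (subst renewal_Suc) (simp add: algebra_simps sum_distrib_left Suc_diff_le)
      have eq2: "?d (Suc l) * ?w (Suc l)
          = k 1 * ?w (Suc l) * ?w l - (\<Sum>j<l. ?q (l - j) * ?w j * ?w (Suc l))"
        by (subst renewal_Suc) (simp add: algebra_simps sum_distrib_left Suc_diff_le)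
      have "(\<Sum>j<l. ?q (l - j) * ?w j * ?w (Suc l)) \<le> (\<Sum>j<l. ?q (l - j) * ?w (Suc j) * ?w l)"
      proof (rule sum_mono)
        fix j assume j: "j \<in> {..<l}"
        have "?w (Suc l) * ?w j \<le> ?w (Suc j) * ?w l"
          using less.IH[of l j] m j by simp
        moreover have "0 \<le> ?q (l - j)"
          using dec[of "l - j"] j by simp
        ultimately show "?q (l - j) * ?w j * ?w (Suc l) \<le> ?q (l - j) * ?w (Suc j) * ?w l"
          using mult_left_mono[of "?w (Suc l) * ?w j" "?w (Suc j) * ?w l" "?q (l - j)"]
          by (simp add: mult_ac)
      qed
      \<comment> \<open>After an index shift both sums agree term by term; the extra summand at
        index 0 is nonnegative.\<close>
      also have "\<dots> \<le> (\<Sum>j<Suc l. ?q (Suc l - j) * ?w j * ?w l)"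
        using dec[of "Suc l"] w[of 0] w[of l] by (subst sum.lessThan_Suc_shift) simp
      finally show ?thesis
        using eq1 eq2 by linarith
    qed
    then show ?thesis
      using w_Suc[of l] w_Suc[of "Suc l"] by (simp add: algebra_simps)
  qed
  show ?case
  proof (cases "i = m")
    case False
    then obtain l where m: "m = Suc l" and il: "i \<le> l"
      using less.prems by (metis le_Suc_eq not0_implies_Suc le_zero_eq)
    have "?w (Suc m) * ?w i * ?w l \<le> ?w m * ?w m * ?w i"
      using mult_right_mono[OF one[OF m], of "?w i"] w[of i] m by (simp add: mult_ac)
    also have "\<dots> \<le> ?w m * (?w (Suc i) * ?w l)"
      using less.IH[of l i] il m w[of m] by (simp add: mult_left_mono mult.assoc)
    finally have "?w l * (?w (Suc m) * ?w i) \<le> ?w l * (?w (Suc i) * ?w m)"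
      by (simp add: mult_ac)
    then show ?thesis
      using w[of l] by simp
  qed (simp add: mult.commute)
qed

text \<open>The growth of \<open>renewal_sum\<close> over \<open>j\<close> indices is a product of
  \<open>j\<close> consecutive ratios, each of which decreases in its index.\<close>

lemma renewal_sum_log_concave:
  assumes k: "\<And>i. 0 \<le> k i" and dec: "\<And>i. 1 \<le> i \<Longrightarrow> k (Suc i) \<le> k i" and a: "0 < a"
    and im: "i \<le> m"
  shows "renewal_sum k a (m + j) * renewal_sum k a i \<le> renewal_sum k a (i + j) * renewal_sum k a m"
proof (induction j)
  case 0
  show ?case by (simp add: mult.commute)
next
  case (Suc j)
  let ?w = "renewal_sum k a"
  have w: "0 < ?w j" for j
    using renewal_sum_pos k a by blast
  have "?w (Suc (m + j)) * ?w i * ?w (i + j) \<le> ?w (Suc (i + j)) * (?w (m + j) * ?w i)"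
    using mult_right_mono[OF renewal_sum_log_concave_step[where k = k and a = a, OF k dec a, of "i + j" "m + j"], of "?w i"]
      im w[of i] by (simp add: mult_ac)
  also have "\<dots> \<le> ?w (Suc (i + j)) * (?w (i + j) * ?w m)"
    using Suc w[of "Suc (i + j)"] by (simp add: mult_left_mono)
  finally have "?w (i + j) * (?w (Suc (m + j)) * ?w i) \<le> ?w (i + j) * (?w (Suc (i + j)) * ?w m)"
    by (simp add: mult_ac)
  then show ?case
    using w[of "i + j"] by simp
qed

text \<open>The Cauchy product gives \<open>D = a + D * K\<close> for the sum \<open>D\<close>,
  which is of use only once the series converges; nonnegativity and \<open>K < 1\<close> bound the
  partial sums beforehand.\<close>

lemma renewal_generating_function:
  assumes k: "\<And>i. 0 \<le> k i" and a: "0 \<le> a" and s: "0 \<le> s"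
    and K: "(\<lambda>i. k (Suc i) * s ^ Suc i) sums K" and K1: "K < 1"
  shows "(\<lambda>m. renewal k a m * s ^ m) sums (a / (1 - K))"
proof -
  let ?d = "renewal k a"
  \<comment> \<open>A zero at index 0 turns the strict sum \<open>j < m\<close> of the recursion
    into a full Cauchy product.\<close>
  define k' where "k' i = (if i = 0 then 0 else k i * s ^ i)" for i
  have k': "0 \<le> k' i" for i
    using k s by (simp add: k'_def)
  have sk': "k' sums K"
    using K sums_Suc_iff[of k' K] by (simp add: k'_def)
  have d: "0 \<le> ?d m * s ^ m" for m
    using renewal_nonneg[of k a m] k a s by simp
  have rec: "?d m * s ^ m = (if m = 0 then a else 0) + (\<Sum>i\<le>m. (?d i * s ^ i) * k' (m - i))" for m
  proof (cases "m = 0")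
    case True
    then show ?thesis by (simp add: renewal.simps k'_def)
  next
    case False
    have "(\<Sum>i\<le>m. (?d i * s ^ i) * k' (m - i)) = (\<Sum>i<m. (?d i * s ^ i) * k' (m - i))"
      by (simp add: lessThan_Suc_atMost[symmetric] k'_def)
    also have "\<dots> = (\<Sum>i<m. k (m - i) * ?d i * s ^ m)"
      by (rule sum.cong) (auto simp: k'_def mult_ac simp flip: power_add)
    finally show ?thesis
      using False by (subst renewal.simps) (simp add: sum_distrib_right)
  qed
  have bound: "(\<Sum>m<N. ?d m * s ^ m) \<le> a / (1 - K)" for N
  proof -
    let ?S = "\<Sum>m<N. ?d m * s ^ m"
    have "(\<Sum>m<N. \<Sum>i\<le>m. (?d i * s ^ i) * k' (m - i)) \<le> (\<Sum>i<N. \<Sum>j<N. (?d i * s ^ i) * k' j)"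
    proof -
      have "(\<Sum>m<N. \<Sum>i\<le>m. (?d i * s ^ i) * k' (m - i))
          = (\<Sum>(i, j)\<in>{(i, j). i + j < N}. (?d i * s ^ i) * k' j)"
        by (simp add: sum.triangle_reindex)
      also have "\<dots> \<le> (\<Sum>(i, j)\<in>{..<N} \<times> {..<N}. (?d i * s ^ i) * k' j)"
        by (rule sum_mono2) (use d k' in \<open>auto intro: mult_nonneg_nonneg\<close>)
      finally show ?thesis
        by (simp add: sum.cartesian_product)
    qed
    also have "\<dots> = ?S * (\<Sum>j<N. k' j)"
      by (simp add: sum_product)
    also have "\<dots> \<le> ?S * K"
      using sum_le_suminf[of k' "{..<N}"] sk' k' d
      by (intro mult_left_mono sum_nonneg) (auto simp: sums_iff)
    finally have "(\<Sum>m<N. \<Sum>i\<le>m. (?d i * s ^ i) * k' (m - i)) \<le> ?S * K" .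
    moreover have "?S = (\<Sum>m<N. if m = 0 then a else 0)
        + (\<Sum>m<N. \<Sum>i\<le>m. (?d i * s ^ i) * k' (m - i))"
      by (subst rec) (simp add: sum.distrib)
    moreover have "(\<Sum>m<N. if m = 0 then a else 0) \<le> a"
      using a by (cases N) (auto simp: sum.lessThan_Suc_shift)
    ultimately have "?S * (1 - K) \<le> a"
      by (simp add: algebra_simps)
    then show ?thesis
      using K1 by (simp add: pos_le_divide_eq)
  qed
  have sd: "summable (\<lambda>m. ?d m * s ^ m)"
    by (rule summableI_nonneg_bounded[where x = "a / (1 - K)"]) (use d bound in auto)
  let ?D = "\<Sum>m. ?d m * s ^ m"
  have "(\<lambda>m. \<Sum>i\<le>m. (?d i * s ^ i) * k' (m - i)) sums (?D * (\<Sum>j. k' j))"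
    using sd sk' d k' by (intro Cauchy_product_sums) (auto simp: sums_iff)
  then have "(\<lambda>m. \<Sum>i\<le>m. (?d i * s ^ i) * k' (m - i)) sums (?D * K)"
    using sk' by (simp add: sums_iff)
  moreover have "(\<lambda>m. if m = 0 then a else 0) sums a"
    using sums_single[of 0 "\<lambda>_. a"] by (simp add: if_distrib cong: if_cong)
  ultimately have "(\<lambda>m. (if m = 0 then a else 0) + (\<Sum>i\<le>m. (?d i * s ^ i) * k' (m - i)))
      sums (a + ?D * K)"
    by (rule sums_add[rotated])
  then have "(\<lambda>m. ?d m * s ^ m) sums (a + ?D * K)"
    by (simp only: rec[symmetric])
  then have "?D = a + ?D * K"
    by (simp add: sums_iff)
  then have "?D = a / (1 - K)"
    using K1 by (simp add: field_simps)
  then show ?thesis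
    using sd by (simp add: sums_iff)
qed

section \<open>Laplace transforms\<close>

lemma integrable_norm_bound:
  fixes f g :: "'a \<Rightarrow> real"
  assumes "integrable M g" "f \<in> borel_measurable M" "\<And>x. norm (f x) \<le> norm (g x)"
  shows "integrable M f"
  using assms by (intro Bochner_Integration.integrable_bound[of M g f]) auto

text \<open>Under \<open>t = exp (- x)\<close> the half line becomes the interval from 0 to 1 and
  \<open>g\<close> extends continuously by 0, so Weierstrass polynomials in \<open>t\<close> become
  sums of exponentials. Clamping \<open>t\<close> from below avoids \<open>ln 0\<close> and only
  affects points at which \<open>g\<close> vanishes before and after.\<close>

lemma exp_polynomial_approximation:
  fixes g :: "real \<Rightarrow> real"
  assumes g: "continuous_on UNIV g" "\<And>x. x \<ge> \<beta> \<Longrightarrow> g x = 0" and \<epsilon>: "0 < \<epsilon>"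
  shows "\<exists>a n. \<forall>x\<ge>0. \<bar>g x - (\<Sum>i\<le>n. a i * exp (- (real i * x)))\<bar> < \<epsilon>"
proof -
  let ?h = "\<lambda>t. g (- ln (max t (exp (- \<bar>\<beta>\<bar>))))"
  have "continuous_on {0..1} ?h"
  proof (rule continuous_on_compose2[OF g(1)])
    show "continuous_on {0..1} (\<lambda>t. - ln (max t (exp (- \<bar>\<beta>\<bar>))))"
      by (intro continuous_intros) (auto simp: max_def)
  qed simp
  then obtain p where p: "real_polynomial_function p" "\<And>t. t \<in> {0..1} \<Longrightarrow> \<bar>?h t - p t\<bar> < \<epsilon>"
    using Stone_Weierstrass_real_polynomial_function[of "{0..1::real}" ?h \<epsilon>] \<epsilon> by auto
  obtain a n where pa: "p = (\<lambda>t. \<Sum>i\<le>n. a i * t ^ i)"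
    using p(1) real_polynomial_function_iff_sum by blast
  have "\<bar>g x - (\<Sum>i\<le>n. a i * exp (- (real i * x)))\<bar> < \<epsilon>" if "x \<ge> 0" for x
  proof -
    have "?h (exp (- x)) = g x"
      using g(2)[of x] g(2)[of "\<bar>\<beta>\<bar>"] by (cases "x \<le> \<bar>\<beta>\<bar>") (auto simp: max_def)
    moreover have "p (exp (- x)) = (\<Sum>i\<le>n. a i * exp (- (real i * x)))"
      by (simp add: pa exp_of_nat_mult[symmetric])
    ultimately show ?thesis
      using p(2)[of "exp (- x)"] that by simp
  qed
  then show ?thesis by blast
qed

text \<open>Transforms at 0, 1, 2, ... suffice: they determine integrals against exponential
  polynomials, which approximate \<open>g\<close> uniformly on the half line, and the common bound
  \<open>B\<close> on the L1 norms controls the error.\<close>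

lemma laplace_weak_limit:
  fixes H :: "nat \<Rightarrow> real \<Rightarrow> real"
  assumes H: "\<And>n. integrable lborel (H n)" "\<And>n x. x < 0 \<Longrightarrow> H n x = 0"
    and B: "\<And>n. (LINT x|lborel. \<bar>H n x\<bar>) \<le> B"
    and K: "integrable lborel K" "\<And>x. x < 0 \<Longrightarrow> K x = 0"
    and lim: "\<And>m. (\<lambda>n. LINT x|lborel. exp (- (real m * x)) * H n x)
      \<longlonglongrightarrow> (LINT x|lborel. exp (- (real m * x)) * K x)"
    and g: "continuous_on UNIV g" "\<And>x. x \<ge> \<beta> \<Longrightarrow> g x = 0"
  shows "(\<lambda>n. LINT x|lborel. g x * H n x) \<longlonglongrightarrow> (LINT x|lborel. g x * K x)"
proof (rule LIMSEQ_I)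
  fix r :: real assume r: "0 < r"
  define C where "C = \<bar>B\<bar> + (LINT x|lborel. \<bar>K x\<bar>) + 1"
  have C: "0 < C" "(LINT x|lborel. \<bar>K x\<bar>) \<le> C" "\<And>n. (LINT x|lborel. \<bar>H n x\<bar>) \<le> C"
  proof -
    have *: "0 \<le> (LINT x|lborel. \<bar>K x\<bar>)"
      by (rule integral_nonneg_AE) simp
    show "0 < C" "(LINT x|lborel. \<bar>K x\<bar>) \<le> C" "(LINT x|lborel. \<bar>H n x\<bar>) \<le> C" for n
      using * B[of n] unfolding C_def by linarith+
  qed
  have [measurable]: "g \<in> borel_measurable borel"
    using g(1) by (rule borel_measurable_continuous_onI)
  \<comment> \<open>An error of \<open>r / 4\<close> is allotted to each of three sources: replacing
    \<open>g\<close> against \<open>H n\<close>, replacing it against \<open>K\<close>, and the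
    convergence itself.\<close>
  obtain a N where a: "\<And>x. x \<ge> 0 \<Longrightarrow> \<bar>g x - (\<Sum>i\<le>N. a i * exp (- (real i * x)))\<bar> < r / (4 * C)"
    using exp_polynomial_approximation[OF g(1), of \<beta> "r / (4 * C)", OF g(2)] r C by auto
  let ?p = "\<lambda>x. \<Sum>i\<le>N. a i * exp (- (real i * x))"
  have e_int: "integrable lborel (\<lambda>x. exp (- (real i * x)) * h x)"
    if h: "integrable lborel h" "\<And>x. x < 0 \<Longrightarrow> h x = 0" for i h
  proof (rule integrable_norm_bound[OF h(1)])
    show "norm (exp (- (real i * x)) * h x) \<le> norm (h x)" for x
      using h(2)[of x] by (cases "x < 0") (auto simp: abs_mult intro!: mult_left_le_one_le)
  qed (use h(1) in measurable)
  have p_int: "integrable lborel (\<lambda>x. ?p x * h x)"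
    "(LINT x|lborel. ?p x * h x) = (\<Sum>i\<le>N. a i * (LINT x|lborel. exp (- (real i * x)) * h x))"
    if h: "integrable lborel h" "\<And>x. x < 0 \<Longrightarrow> h x = 0" for h
    using e_int[OF h] by (simp_all add: sum_distrib_right mult.assoc)
  have close: "\<bar>(LINT x|lborel. g x * h x) - (LINT x|lborel. ?p x * h x)\<bar> \<le> r / 4"
    if h: "integrable lborel h" "\<And>x. x < 0 \<Longrightarrow> h x = 0" "(LINT x|lborel. \<bar>h x\<bar>) \<le> C" for h
  proof -
    have bd: "\<bar>(g x - ?p x) * h x\<bar> \<le> r / (4 * C) * \<bar>h x\<bar>" for x
    proof (cases "x < 0")
      case False
      then show ?thesis
        unfolding abs_mult using a[of x] by (intro mult_right_mono) auto
    qed (simp add: h(2))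
    have i1: "integrable lborel (\<lambda>x. (g x - ?p x) * h x)"
    proof (rule Bochner_Integration.integrable_bound)
      show "integrable lborel (\<lambda>x. r / (4 * C) * \<bar>h x\<bar>)"
        using h(1) by simp
      show "AE x in lborel. norm ((g x - ?p x) * h x) \<le> norm (r / (4 * C) * \<bar>h x\<bar>)"
        unfolding real_norm_def by (intro AE_I2 order_trans[OF bd abs_ge_self])
    qed (use h(1) in measurable)
    have "integrable lborel (\<lambda>x. (g x - ?p x) * h x + ?p x * h x)"
      by (rule Bochner_Integration.integrable_add[OF i1 p_int(1)[OF h(1,2)]])
    then have "integrable lborel (\<lambda>x. g x * h x)"
      by (simp add: left_diff_distrib)
    then have "(LINT x|lborel. g x * h x) - (LINT x|lborel. ?p x * h x) = (LINT x|lborel. (g x - ?p x) * h x)"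
      using p_int(1)[OF h(1,2)] by (simp add: left_diff_distrib)
    also have "\<bar>\<dots>\<bar> \<le> (LINT x|lborel. \<bar>(g x - ?p x) * h x\<bar>)"
      by (rule integral_abs_bound)
    also have "\<dots> \<le> (LINT x|lborel. r / (4 * C) * \<bar>h x\<bar>)"
      using i1 h(1) bd by (intro integral_mono) auto
    also have "\<dots> = r / (4 * C) * (LINT x|lborel. \<bar>h x\<bar>)"
      by simp
    also have "\<dots> \<le> r / (4 * C) * C"
      using h(3) r C by (intro mult_left_mono) auto
    also have "\<dots> = r / 4"
      using C by simp
    finally show ?thesis .
  qed
  have "(\<lambda>n. LINT x|lborel. ?p x * H n x) \<longlonglongrightarrow> (LINT x|lborel. ?p x * K x)"
  proof -
    have "(LINT x|lborel. ?p x * H n x) = (\<Sum>i\<le>N. a i * (LINT x|lborel. exp (- (real i * x)) * H n x))" for n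
      by (rule p_int(2)) (use H in auto)
    moreover have "(LINT x|lborel. ?p x * K x) = (\<Sum>i\<le>N. a i * (LINT x|lborel. exp (- (real i * x)) * K x))"
      by (rule p_int(2)) (use K in auto)
    ultimately show ?thesis
      by (simp only:) (intro tendsto_intros lim)
  qed
  moreover have "0 < r / 4"
    using r by simp
  ultimately obtain n0 where n0: "\<And>n. n \<ge> n0 \<Longrightarrow>
      norm ((LINT x|lborel. ?p x * H n x) - (LINT x|lborel. ?p x * K x)) < r / 4"
    using LIMSEQ_D by blast
  show "\<exists>no. \<forall>n\<ge>no. norm ((LINT x|lborel. g x * H n x) - (LINT x|lborel. g x * K x)) < r"
  proof (intro exI allI impI)
    fix n assume "n \<ge> n0"
    from n0[OF this] close[OF H(1)[of n] H(2)[of _ n] C(3)] close[OF K C(2)] r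
    show "norm ((LINT x|lborel. g x * H n x) - (LINT x|lborel. g x * K x)) < r"
      unfolding real_norm_def by linarith
  qed
qed

section \<open>Pointwise convergence of monotone functions from Laplace transforms\<close>

definition tent :: "real \<Rightarrow> real \<Rightarrow> real \<Rightarrow> real" where
  "tent a b x = max 0 (min (x - a) (b - x))"

lemma tent_simps:
  "0 \<le> tent a b x" "x \<le> a \<Longrightarrow> tent a b x = 0" "b \<le> x \<Longrightarrow> tent a b x = 0"
  "a < x \<Longrightarrow> x < b \<Longrightarrow> 0 < tent a b x"
  by (auto simp: tent_def)

lemma continuous_on_tent: "continuous_on A (tent a b)"
  unfolding tent_def by (intro continuous_intros)

lemma tent_measurable [measurable]: "tent a b \<in> borel_measurable borel"
  by (rule borel_measurable_continuous_onI[OF continuous_on_tent])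

lemma integrable_tent_mult:
  assumes f: "continuous_on {a..b} f"
  shows "integrable lborel (\<lambda>x. tent a b x * f x)"
proof -
  have "set_integrable lborel {a..b} (\<lambda>x. tent a b x * f x)"
    unfolding set_integrable_def
    by (intro borel_integrable_compact continuous_intros continuous_on_tent f) auto
  also have "set_integrable lborel {a..b} (\<lambda>x. tent a b x * f x) \<longleftrightarrow> integrable lborel (\<lambda>x. tent a b x * f x)"
    unfolding set_integrable_def
    by (intro Bochner_Integration.integrable_cong refl) (auto simp: indicator_def tent_def)
  finally show ?thesis .
qed

lemma integral_tent_pos:
  assumes "a < b"
  shows "0 < (LINT x|lborel. tent a b x)"
proof -
  have int: "integrable lborel (tent a b)"
    using integrable_tent_mult[of a b "\<lambda>_. 1"] by simp
  have "0 \<le> (LINT x|lborel. tent a b x)"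
    by (rule integral_nonneg_AE) (simp add: tent_simps)
  moreover have "(LINT x|lborel. tent a b x) \<noteq> 0"
  proof
    assume "(LINT x|lborel. tent a b x) = 0"
    then have "AE x in lborel. tent a b x = 0"
      using integral_nonneg_eq_0_iff_AE[OF int] by (simp add: tent_simps)
    then have "AE x in lborel. x \<notin> {a<..<b}"
      by eventually_elim (use tent_simps(4) in force)
    then have "{a<..<b} \<in> null_sets lborel"
      by (subst (asm) AE_iff_null_sets[symmetric]) auto
    then show False
      using assms by (simp add: null_sets_def)
  qed
  ultimately show ?thesis by linarith
qed

lemma integral_tent_mono:
  assumes "integrable lborel (\<lambda>y. tent a b y * f y)" "integrable lborel (\<lambda>y. tent a b y * g y)"
    and le: "\<And>y. a < y \<Longrightarrow> y < b \<Longrightarrow> f y \<le> g y"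
  shows "(LINT y|lborel. tent a b y * f y) \<le> (LINT y|lborel. tent a b y * g y)"
proof (rule integral_mono[OF assms(1,2)])
  fix y
  show "tent a b y * f y \<le> tent a b y * g y"
  proof (cases "a < y \<and> y < b")
    case True
    then show ?thesis
      by (intro mult_left_mono le tent_simps) auto
  qed (auto simp: tent_simps not_less)
qed

text \<open>Weak convergence of monotone functions is pointwise at continuity points of the limit: a
  bump just right of \<open>x\<close> averages values that are at least \<open>f n x\<close>, a bump
  just left of it values that are at most \<open>f n x\<close>. The point 0, where the limit may
  jump, is excluded.\<close>

lemma mono_laplace_limit:
  fixes f :: "nat \<Rightarrow> real \<Rightarrow> real"
  assumes mono: "\<And>n. mono (f n)" and f0: "\<And>n x. x < 0 \<Longrightarrow> f n x = 0"
    and int: "\<And>n m. integrable lborel (\<lambda>x. exp (- (\<theta> + real m) * x) * f n x)"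
    and W: "continuous_on {0..} W" "\<And>x. x < 0 \<Longrightarrow> W x = 0"
    and intW: "integrable lborel (\<lambda>x. exp (- \<theta> * x) * W x)"
    and lim: "\<And>m. (\<lambda>n. LINT x|lborel. exp (- (\<theta> + real m) * x) * f n x)
      \<longlonglongrightarrow> (LINT x|lborel. exp (- (\<theta> + real m) * x) * W x)"
    and x: "0 < x"
  shows "(\<lambda>n. f n x) \<longlonglongrightarrow> W x"
proof -
  have nonneg: "0 \<le> f n y" for n y
    using monoD[OF mono[of n], of "min y (-1)" y] f0[of "min y (-1)" n] by simp
  have [measurable]: "f n \<in> borel_measurable borel" for n
    using mono by (rule borel_measurable_mono)
  let ?H = "\<lambda>n x. exp (- \<theta> * x) * f n x" and ?K = "\<lambda>x. exp (- \<theta> * x) * W x"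
  have exp_split: "exp (- (\<theta> + real m) * y) = exp (- (real m * y)) * exp (- \<theta> * y)" for m y
    by (simp add: algebra_simps flip: exp_add)
  have H: "integrable lborel (?H n)" for n
    using int[of 0 n] by simp
  have "convergent (\<lambda>n. LINT x|lborel. ?H n x)"
    using lim[of 0] by (auto simp: convergent_def)
  then have "Bseq (\<lambda>n. LINT x|lborel. ?H n x)"
    by (rule convergent_imp_Bseq)
  then obtain B where B: "\<And>n. \<bar>LINT x|lborel. ?H n x\<bar> \<le> B"
    by (auto simp: Bseq_def)
  have B': "(LINT x|lborel. \<bar>?H n x\<bar>) \<le> B" for n
    using B[of n] nonneg by (simp add: abs_mult)
  have tent_lim: "(\<lambda>n. LINT y|lborel. tent a b y * f n y) \<longlonglongrightarrow> (LINT y|lborel. tent a b y * W y)" for a b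
  proof -
    have "(\<lambda>n. LINT y|lborel. (tent a b y * exp (\<theta> * y)) * ?H n y)
        \<longlonglongrightarrow> (LINT y|lborel. (tent a b y * exp (\<theta> * y)) * ?K y)"
      by (rule laplace_weak_limit[OF H _ B' intW, where \<beta> = b])
        (use f0 W(2) lim[unfolded exp_split mult.assoc] in
          \<open>auto simp: tent_simps intro!: continuous_intros continuous_on_tent\<close>)
    moreover have "tent a b y * exp (\<theta> * y) * (exp (- \<theta> * y) * z) = tent a b y * z" for y z
      by (simp add: exp_minus field_simps)
    ultimately show ?thesis by (simp only:)
  qed
  have itent: "integrable lborel (tent a b)" for a b
    using integrable_tent_mult[of a b "\<lambda>_. 1"] by simp
  have int_tW: "integrable lborel (\<lambda>y. tent a b y * W y)" if "0 \<le> a" for a b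
    by (rule integrable_tent_mult) (use W(1) that in \<open>auto intro: continuous_on_subset\<close>)
  have int_tf: "integrable lborel (\<lambda>y. tent a b y * f n y)" for a b n
  proof (rule integrable_norm_bound)
    show "integrable lborel (\<lambda>y. tent a b y * f n b)"
      using itent by simp
    show "norm (tent a b y * f n y) \<le> norm (tent a b y * f n b)" for y
      using nonneg monoD[OF mono[of n], of y b]
      by (cases "y \<le> b") (auto simp: abs_mult tent_simps intro!: mult_left_mono)
  qed measurable
  have isCont: "continuous (at x) W"
    using continuous_on_interior[OF W(1), of x] x by simp
  show ?thesis
  proof (rule LIMSEQ_I)
    fix r :: real assume r: "0 < r"
    obtain \<delta>0 where \<delta>0: "0 < \<delta>0" "\<And>y. \<bar>y - x\<bar> < \<delta>0 \<Longrightarrow> \<bar>W y - W x\<bar> < r / 2"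
      using isCont r unfolding continuous_at_eps_delta dist_real_def by (metis half_gt_zero)
    \<comment> \<open>Half of \<open>\<delta>0\<close> allows a closed neighbourhood; the bound
      \<open>x\<close> keeps the left bump inside the half line on which \<open>W\<close> is
      continuous.\<close>
    define \<delta> where "\<delta> = min (\<delta>0 / 2) x"
    have \<delta>: "0 < \<delta>" "\<delta> \<le> x" "\<And>y. \<bar>y - x\<bar> \<le> \<delta> \<Longrightarrow> \<bar>W y - W x\<bar> < r / 2"
      using \<delta>0 x by (auto simp: \<delta>_def)
    let ?T = "\<lambda>a b. LINT y|lborel. tent a b y"
    let ?a = "x - \<delta>" and ?b = "x + \<delta>"
    have Tp: "0 < ?T x ?b" "0 < ?T ?a x"
      using \<delta> by (auto intro: integral_tent_pos)
    have W_le: "W y \<le> W x + r / 2" if "x < y" "y < ?b" for y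
    proof -
      have "\<bar>W y - W x\<bar> < r / 2"
        using that by (intro \<delta>(3)) auto
      then show ?thesis by linarith
    qed
    have W_ge: "W x - r / 2 \<le> W y" if "?a < y" "y < x" for y
    proof -
      have "\<bar>W y - W x\<bar> < r / 2"
        using that by (intro \<delta>(3)) auto
      then show ?thesis by linarith
    qed
    have up: "(LINT y|lborel. tent x ?b y * W y) \<le> ?T x ?b * (W x + r / 2)"
    proof -
      have "(LINT y|lborel. tent x ?b y * W y) \<le> (LINT y|lborel. tent x ?b y * (W x + r / 2))"
        by (rule integral_tent_mono) (use int_tW x itent W_le in auto)
      then show ?thesis by simp
    qed
    have low: "?T ?a x * (W x - r / 2) \<le> (LINT y|lborel. tent ?a x y * W y)"
    proof -
      have "(LINT y|lborel. tent ?a x y * (W x - r / 2)) \<le> (LINT y|lborel. tent ?a x y * W y)"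
        by (rule integral_tent_mono) (use int_tW \<delta>(2) itent W_ge in auto)
      then show ?thesis by simp
    qed
    have fup: "?T x ?b * f n x \<le> (LINT y|lborel. tent x ?b y * f n y)" for n
    proof -
      have "(LINT y|lborel. tent x ?b y * f n x) \<le> (LINT y|lborel. tent x ?b y * f n y)"
        by (rule integral_tent_mono) (use int_tf itent monoD[OF mono[of n]] in auto)
      then show ?thesis by simp
    qed
    have flow: "(LINT y|lborel. tent ?a x y * f n y) \<le> ?T ?a x * f n x" for n
    proof -
      have "(LINT y|lborel. tent ?a x y * f n y) \<le> (LINT y|lborel. tent ?a x y * f n x)"
        by (rule integral_tent_mono) (use int_tf itent monoD[OF mono[of n]] in auto)
      then show ?thesis by simp
    qed
    have "\<forall>\<^sub>F n in sequentially. (LINT y|lborel. tent x ?b y * f n y) < ?T x ?b * (W x + r)"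
      by (rule order_tendstoD(2)[OF tent_lim]) (rule le_less_trans[OF up], use Tp r in simp)
    moreover have "\<forall>\<^sub>F n in sequentially. ?T ?a x * (W x - r) < (LINT y|lborel. tent ?a x y * f n y)"
      by (rule order_tendstoD(1)[OF tent_lim]) (rule less_le_trans[OF _ low], use Tp r in simp)
    ultimately have "\<forall>\<^sub>F n in sequentially. norm (f n x - W x) < r"
    proof eventually_elim
      case (elim n)
      have "?T x ?b * f n x < ?T x ?b * (W x + r)" "?T ?a x * (W x - r) < ?T ?a x * f n x"
        using elim fup[of n] flow[of n] by linarith+
      then show ?case
        using Tp by (simp add: abs_less_iff)
    qed
    then show "\<exists>no. \<forall>n\<ge>no. norm (f n x - W x) < r"
      by (simp add: eventually_sequentially)
  qed
qed

text \<open>The constant sequence 0 is monotone and its transforms converge trivially to those of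
  \<open>h\<close>, so \<open>mono_laplace_limit\<close> identifies \<open>h\<close> with 0 on the
  positive axis; \<open>h\<close> itself need not be monotone.\<close>

lemma laplace_unique:
  assumes h: "continuous_on {0..} h" "\<And>x. x < 0 \<Longrightarrow> h x = 0"
    and int: "integrable lborel (\<lambda>x. exp (- \<theta> * x) * h x)"
    and zero: "\<And>m. (LINT x|lborel. exp (- (\<theta> + real m) * x) * h x) = 0"
  shows "h x = 0"
proof -
  have "h y = 0" if "y > 0" for y
  proof (rule LIMSEQ_unique)
    show "(\<lambda>n. 0) \<longlonglongrightarrow> h y"
      by (rule mono_laplace_limit[where f = "\<lambda>_ _. 0", OF _ _ _ h int _ that])
        (simp_all only: zero mult_zero_right Bochner_Integration.integral_zero tendsto_const, simp_all add: mono_def)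
  qed simp
  then have "h y = 0" if "y \<in> {0<..}" for y
    using that by simp
  moreover have "h 0 = 0"
    by (rule continuous_constant_on_closure[where S = "{0<..}" and f = h and a = 0])
      (use h(1) calculation in \<open>auto intro: continuous_on_subset\<close>)
  ultimately show ?thesis
    using h(2)[of x] by (cases "x < 0"; cases "x = 0") auto
qed

section \<open>Lattice approximation of the Laplace exponent\<close>

text \<open>The upper bound reduces to \<open>1 \<le> (1 - x + x\<^sup>2) * exp x\<close>, for which
  the quadratic Taylor bound of \<open>exp x\<close> is enough.\<close>

lemma exp_minus_bounds:
  fixes x :: real
  assumes "0 \<le> x"
  shows "0 \<le> exp (- x) - 1 + x" "exp (- x) - 1 + x \<le> x\<^sup>2"
proof -
  show "0 \<le> exp (- x) - 1 + x"
    using exp_ge_add_one_self[of "- x"] by simp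
  have "1 \<le> 1 + x\<^sup>2 / 2 + x ^ 3 / 2 + x ^ 4 / 2"
    using assms by simp
  also have "\<dots> = (1 - x + x\<^sup>2) * (1 + x + x\<^sup>2 / 2)"
    by (simp add: field_simps power2_eq_square power3_eq_cube power4_eq_xxxx)
  also have "\<dots> \<le> (1 - x + x\<^sup>2) * exp x"
  proof (rule mult_left_mono)
    show "1 + x + x\<^sup>2 / 2 \<le> exp x"
      by (rule exp_lower_Taylor_quadratic[OF assms])
    show "0 \<le> 1 - x + x\<^sup>2"
      using sum_squares_ge_zero[of "x - 1 / 2" 0] by (simp add: power2_eq_square algebra_simps)
  qed
  finally have "exp (- x) \<le> 1 - x + x\<^sup>2"
    by (simp add: exp_minus field_simps)
  then show "exp (- x) - 1 + x \<le> x\<^sup>2"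
    by simp
qed

definition levy_tail :: "real measure \<Rightarrow> real \<Rightarrow> real" where
  "levy_tail \<nu> e = measure \<nu> {e<..}"

text \<open>The drift that remains when jumps of size at most \<open>e\<close> are removed together
  with their compensator.\<close>

definition truncated_drift :: "real \<Rightarrow> real measure \<Rightarrow> real \<Rightarrow> real" where
  "truncated_drift \<gamma> \<nu> e = \<gamma> + (LINT z:{e<..<1}|\<nu>. z)"

text \<open>Subtracting a linear term from the exponent only shifts \<open>\<gamma>\<close>, so
  every refracted exponent is another instance over the same \<open>\<nu>\<close>; the axiom
  concerns \<open>\<nu>\<close> alone.\<close>

locale levy_exponent =
  fixes \<gamma> \<sigma> :: real and \<nu> :: "real measure"
  assumes levy_measure: "levy_measure \<nu>"
begin

lemma sets_nu [measurable_cong, simp]: "sets \<nu> = sets borel"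
  and int_min: "integrable \<nu> (\<lambda>z. min 1 (z\<^sup>2))"
  using levy_measure by (auto simp: levy_measure_def)

lemma space_nu [simp]: "space \<nu> = UNIV"
  using sets_eq_imp_space_eq[OF sets_nu] by simp

abbreviation jump_integrand :: "real \<Rightarrow> real \<Rightarrow> real" where
  "jump_integrand \<theta> z \<equiv> exp (- \<theta> * z) - 1 + \<theta> * z * indicator {0<..<1} z"

lemma jump_integrand_bound:
  assumes "0 \<le> \<theta>" "0 < z"
  shows "\<bar>jump_integrand \<theta> z\<bar> \<le> (1 + \<theta>\<^sup>2) * min 1 (z\<^sup>2)"
proof (cases "z < 1")
  case True
  have "\<bar>jump_integrand \<theta> z\<bar> \<le> \<theta>\<^sup>2 * z\<^sup>2"
    using exp_minus_bounds[of "\<theta> * z"] True assms by (simp add: power_mult_distrib)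
  also have "\<dots> \<le> (1 + \<theta>\<^sup>2) * z\<^sup>2"
    by (intro mult_right_mono) auto
  also have "z\<^sup>2 = min 1 (z\<^sup>2)"
    using True assms by (simp add: power_le_one)
  finally show ?thesis .
next
  case False
  then have *: "\<bar>jump_integrand \<theta> z\<bar> \<le> 1" "min 1 (z\<^sup>2) = 1"
    using assms by simp_all
  show ?thesis
    unfolding *(2) by (rule order_trans[OF *(1)]) simp
qed

lemma integrable_jump:
  assumes "0 \<le> \<theta>"
  shows "set_integrable \<nu> {0<..} (jump_integrand \<theta>)"
  unfolding set_integrable_def
proof (rule integrable_norm_bound)
  show "integrable \<nu> (\<lambda>z. (1 + \<theta>\<^sup>2) * min 1 (z\<^sup>2))"
    using int_min by simp
  show "norm (indicator {0<..} z *\<^sub>R jump_integrand \<theta> z) \<le> norm ((1 + \<theta>\<^sup>2) * min 1 (z\<^sup>2))" for z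
  proof (cases "0 < z")
    case True
    then show ?thesis
      using jump_integrand_bound[OF assms True] by (simp add: abs_mult)
  qed simp
qed measurable

lemma finite_tail:
  assumes "0 < e"
  shows "emeasure \<nu> {e<..} < \<infinity>"
proof -
  have "integrable \<nu> (indicat_real {e<..})"
  proof (rule Bochner_Integration.integrable_bound)
    show "integrable \<nu> (\<lambda>z. min 1 (z\<^sup>2) / min 1 (e\<^sup>2))"
      using int_min by simp
    show "AE z in \<nu>. norm (indicat_real {e<..} z) \<le> norm (min 1 (z\<^sup>2) / min 1 (e\<^sup>2))"
    proof (rule AE_I2)
      fix z
      have "e < z \<Longrightarrow> min 1 (e\<^sup>2) \<le> min 1 (z\<^sup>2)"
        using assms by (auto simp: min_def intro: power_mono order_trans)
      then show "norm (indicat_real {e<..} z) \<le> norm (min 1 (z\<^sup>2) / min 1 (e\<^sup>2))"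
        using assms by (simp add: indicator_def)
    qed
  qed measurable
  then show ?thesis
    by (simp add: integrable_indicator_iff)
qed

lemma integrable_tail:
  fixes f :: "real \<Rightarrow> real"
  assumes "0 < e" "f \<in> borel_measurable borel" "\<And>z. e < z \<Longrightarrow> \<bar>f z\<bar> \<le> B"
  shows "set_integrable \<nu> {e<..} f"
  unfolding set_integrable_def
proof (rule Bochner_Integration.integrable_bound)
  show "integrable \<nu> (\<lambda>z. B * indicator {e<..} z)"
    using finite_tail[OF assms(1)] by (intro integrable_mult_right) (simp add: integrable_indicator_iff)
  show "AE z in \<nu>. norm (indicator {e<..} z *\<^sub>R f z) \<le> norm (B * indicator {e<..} z)"
    using assms(3) by (intro AE_I2) (fastforce simp: indicator_def)
qed (use assms(2) in measurable)

lemma integral_tail_le: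
  fixes f :: "real \<Rightarrow> real"
  assumes e: "0 < e" and f: "f \<in> borel_measurable borel" and B: "\<And>z. e < z \<Longrightarrow> \<bar>f z\<bar> \<le> B"
  shows "\<bar>LINT z:{e<..}|\<nu>. f z\<bar> \<le> B * levy_tail \<nu> e"
proof -
  have "\<bar>LINT z:{e<..}|\<nu>. f z\<bar> \<le> (LINT z:{e<..}|\<nu>. \<bar>f z\<bar>)"
    using set_integral_norm_bound[OF integrable_tail[OF assms]] by simp
  also have "\<dots> \<le> (LINT z:{e<..}|\<nu>. B)"
    using f B by (intro set_integral_mono integrable_tail[OF e, where B = "\<bar>B\<bar>"]) fastforce+
  also have "\<dots> = B * levy_tail \<nu> e"
    by (simp add: set_lebesgue_integral_def levy_tail_def mult.commute)
  finally show ?thesis .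
qed

lemma levy_tail_nonneg: "0 \<le> levy_tail \<nu> e"
  by (simp add: levy_tail_def)

lemma small_jumps_eq:
  assumes "0 < e"
  shows "(LINT z:{e<..<1}|\<nu>. z) = (LINT z:{e<..}|\<nu>. z * indicator {0<..<1} z)"
  unfolding set_lebesgue_integral_def
  by (rule Bochner_Integration.integral_cong) (use assms in \<open>auto simp: indicator_def\<close>)

lemma truncated_drift_bound:
  assumes "0 < e"
  shows "\<bar>truncated_drift \<gamma> \<nu> e\<bar> \<le> \<bar>\<gamma>\<bar> + levy_tail \<nu> e"
proof -
  have "\<bar>LINT z:{e<..}|\<nu>. z * indicator {0<..<1} z\<bar> \<le> 1 * levy_tail \<nu> e"
    by (rule integral_tail_le[OF assms]) (auto simp: indicator_def)
  then show ?thesis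
    using small_jumps_eq[OF assms] by (simp add: truncated_drift_def)
qed

text \<open>Beyond \<open>e\<close> the measure is finite, so the compensator is integrable by
  itself and can be moved into the drift.\<close>

lemma tail_integral_jump:
  assumes e: "0 < e" and \<theta>: "0 \<le> \<theta>"
  shows "\<gamma> * \<theta> + (LINT z:{e<..}|\<nu>. jump_integrand \<theta> z)
    = truncated_drift \<gamma> \<nu> e * \<theta> - (LINT z:{e<..}|\<nu>. 1 - exp (- \<theta> * z))"
proof -
  have i1: "set_integrable \<nu> {e<..} (\<lambda>z. 1 - exp (- \<theta> * z))"
    by (rule integrable_tail[OF e, where B = 1]) (use e \<theta> in \<open>auto simp: abs_le_iff\<close>)
  have i2: "set_integrable \<nu> {e<..} (\<lambda>z. z * indicator {0<..<1} z)"
    by (rule integrable_tail[OF e, where B = 1]) (auto simp: indicator_def)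
  have "(LINT z:{e<..}|\<nu>. jump_integrand \<theta> z)
      = (LINT z:{e<..}|\<nu>. \<theta> * (z * indicator {0<..<1} z) - (1 - exp (- \<theta> * z)))"
    by (rule set_lebesgue_integral_cong) (auto simp: algebra_simps)
  also have "\<dots> = \<theta> * (LINT z:{e<..}|\<nu>. z * indicator {0<..<1} z) - (LINT z:{e<..}|\<nu>. 1 - exp (- \<theta> * z))"
    by (subst set_integral_diff) (use i1 i2 in auto)
  finally show ?thesis
    by (simp add: truncated_drift_def small_jumps_eq[OF e] algebra_simps)
qed

text \<open>Jumps of size at most \<open>e\<close> are compensated, as \<open>e < 1\<close>, and
  contribute a nonnegative amount; the larger ones, once their compensator is in the drift, cost at
  most their total mass.\<close>

lemma laplace_psi_lower_bound:
  assumes e: "0 < e" "e < 1" and \<theta>: "0 \<le> \<theta>"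
  shows "\<theta> * (1/2 * \<sigma>\<^sup>2 * \<theta> + truncated_drift \<gamma> \<nu> e) - levy_tail \<nu> e \<le> laplace_psi \<gamma> \<sigma> \<nu> \<theta>"
proof -
  have "(LINT z:{e<..}|\<nu>. jump_integrand \<theta> z) \<le> (LINT z:{0<..}|\<nu>. jump_integrand \<theta> z)"
    unfolding set_lebesgue_integral_def
  proof (rule integral_mono)
    show "integrable \<nu> (\<lambda>z. indicator {0<..} z *\<^sub>R jump_integrand \<theta> z)"
      using integrable_jump[OF \<theta>] by (simp add: set_integrable_def)
    show "integrable \<nu> (\<lambda>z. indicator {e<..} z *\<^sub>R jump_integrand \<theta> z)"
      using set_integrable_subset[OF integrable_jump[OF \<theta>], of "{e<..}"] e by (auto simp: set_integrable_def)
    fix z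
    show "indicator {e<..} z *\<^sub>R jump_integrand \<theta> z \<le> indicator {0<..} z *\<^sub>R jump_integrand \<theta> z"
      using exp_minus_bounds(1)[of "\<theta> * z"] \<theta> e by (cases "0 < z \<and> z \<le> e") (auto simp: indicator_def)
  qed
  moreover have "(LINT z:{e<..}|\<nu>. 1 - exp (- \<theta> * z)) \<le> 1 * levy_tail \<nu> e"
    by (rule order_trans[OF abs_ge_self integral_tail_le[OF e(1)]]) (use e \<theta> in \<open>auto simp: abs_le_iff\<close>)
  ultimately show ?thesis
    using tail_integral_jump[OF e(1) \<theta>] by (simp add: laplace_psi_def algebra_simps power2_eq_square)
qed

text \<open>
  If the paths have bounded variation then \<open>truncated_drift \<gamma> \<nu> e\<close> increases to the drift as \<open>e\<close>
  decreases to 0; otherwise \<open>\<sigma> \<noteq> 0\<close> or it tends to infinity.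
\<close>

definition positive_drift :: bool where
  "positive_drift \<longleftrightarrow> \<sigma> \<noteq> 0 \<or> (\<exists>e. 0 < e \<and> e < 1 \<and> 0 < truncated_drift \<gamma> \<nu> e)"

lemma laplace_psi_eventually_gt:
  assumes "positive_drift"
  shows "\<forall>\<^sub>F \<theta> in at_top. q < laplace_psi \<gamma> \<sigma> \<nu> \<theta>"
proof -
  \<comment> \<open>If \<open>\<sigma> \<noteq> 0\<close> any cutoff will do, since the quadratic
    term dominates.\<close>
  have "\<exists>e. 0 < e \<and> e < 1 \<and> (\<sigma> = 0 \<longrightarrow> 0 < truncated_drift \<gamma> \<nu> e)"
  proof (cases "\<sigma> = 0")
    case True
    then show ?thesis
      using assms[unfolded positive_drift_def] by auto
  next
    case False
    then show ?thesis
      by (intro exI[of _ "1 / 2"]) simp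
  qed
  then obtain e where e: "0 < e" "e < 1" "\<sigma> = 0 \<Longrightarrow> 0 < truncated_drift \<gamma> \<nu> e"
    by blast
  have "filterlim (\<lambda>\<theta>. \<theta> * (1/2 * \<sigma>\<^sup>2 * \<theta> + truncated_drift \<gamma> \<nu> e) - levy_tail \<nu> e) at_top at_top"
  proof (cases "\<sigma> = 0")
    case True
    with e(3) have "0 < truncated_drift \<gamma> \<nu> e" by simp
    then show ?thesis
      using True by simp real_asymp
  next
    case False
    then have "0 < \<sigma>\<^sup>2" by simp
    then show ?thesis by real_asymp
  qed
  then have "\<forall>\<^sub>F \<theta> in at_top. q < \<theta> * (1/2 * \<sigma>\<^sup>2 * \<theta> + truncated_drift \<gamma> \<nu> e) - levy_tail \<nu> e"
    by (simp add: filterlim_at_top_dense)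
  moreover have "\<forall>\<^sub>F \<theta> in at_top. (0::real) \<le> \<theta>"
    by (rule eventually_ge_at_top)
  ultimately show ?thesis
    by eventually_elim (use laplace_psi_lower_bound[OF e(1,2)] in \<open>auto intro: less_le_trans\<close>)
qed

end

section \<open>Step functions on a lattice\<close>

lemma has_bochner_integral_exp_tail:
  fixes c \<theta> :: real
  assumes "0 < \<theta>"
  shows "has_bochner_integral lborel (\<lambda>x. indicator {c..} x * exp (- \<theta> * x)) (exp (- \<theta> * c) / \<theta>)"
proof -
  have hi: "((\<lambda>x. exp (- \<theta> * x)) has_integral exp (- \<theta> * c) / \<theta>) {c..}"
    using has_integral_exp_minus_to_infinity[of \<theta> c] assms by simp
  then have "(\<lambda>x. exp (- \<theta> * x)) absolutely_integrable_on {c..}"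
    by (intro nonnegative_absolutely_integrable_1) (auto simp: integrable_on_def)
  then have si: "set_integrable lebesgue {c..} (\<lambda>x. exp (- \<theta> * x))" .
  have m: "(\<lambda>x. indicator {c..} x *\<^sub>R exp (- \<theta> * x)) \<in> borel_measurable lborel"
    by measurable
  have "(LINT x:{c..}|lebesgue. exp (- \<theta> * x)) = exp (- \<theta> * c) / \<theta>"
    using set_lebesgue_integral_eq_integral(2)[OF si] integral_unique[OF hi] by simp
  then show ?thesis
    using si integrable_completion[OF m] integral_completion[OF m]
    by (simp add: has_bochner_integral_iff set_integrable_def set_lebesgue_integral_def)
qed

definition lattice_step :: "(nat \<Rightarrow> real) \<Rightarrow> real \<Rightarrow> real \<Rightarrow> real" where
  "lattice_step w h x = (if x < 0 then 0 else w (nat \<lfloor>x / h\<rfloor>))"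

text \<open>The step function is a superposition of jumps \<open>d m\<close> at the points
  \<open>m * h\<close>, with transforms \<open>d m * exp (- \<theta> * h) ^ m / \<theta>\<close>;
  nonnegativity allows termwise integration.\<close>

lemma laplace_lattice_step:
  assumes d: "\<And>m. 0 \<le> d m" and h: "0 < h" and \<theta>: "0 < \<theta>"
    and D: "(\<lambda>m. d m * exp (- \<theta> * h) ^ m) sums D"
  shows "has_bochner_integral lborel (\<lambda>x. exp (- \<theta> * x) * lattice_step (\<lambda>m. \<Sum>j\<le>m. d j) h x) (D / \<theta>)"
proof -
  let ?f = "\<lambda>m x. d m * (indicator {real m * h..} x * exp (- \<theta> * x))"
  have e: "exp (- \<theta> * (real m * h)) = exp (- \<theta> * h) ^ m" for m
    by (simp add: exp_of_nat_mult[symmetric] mult_ac)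
  have hb: "has_bochner_integral lborel (?f m) (d m * exp (- \<theta> * h) ^ m / \<theta>)" for m
    using has_bochner_integral_mult_right[OF has_bochner_integral_exp_tail[OF \<theta>, of "real m * h"], of "d m"]
    by (simp only: e times_divide_eq_right)
  have f_sums: "(\<lambda>m. ?f m x) sums (exp (- \<theta> * x) * lattice_step (\<lambda>m. \<Sum>j\<le>m. d j) h x)" for x
  proof (cases "x < 0")
    case True
    then have "x < real m * h" for m
      using h by (meson less_le_trans mult_nonneg_nonneg of_nat_0_le_iff less_imp_le)
    then have "(\<lambda>m. ?f m x) = (\<lambda>_. 0)"
      by (intro ext) (simp add: not_le)
    then show ?thesis
      using True by (simp only: lattice_step_def) simp
  next
    case False
    let ?m = "nat \<lfloor>x / h\<rfloor>"
    have iff: "real m * h \<le> x \<longleftrightarrow> m \<le> ?m" for m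
    proof -
      have "real m * h \<le> x \<longleftrightarrow> real m \<le> x / h"
        using h by (simp add: pos_le_divide_eq)
      also have "\<dots> \<longleftrightarrow> m \<le> ?m"
        using False h by (simp add: le_nat_floor le_nat_iff le_floor_iff)
      finally show ?thesis .
    qed
    have "(\<lambda>m. ?f m x) sums (\<Sum>m\<le>?m. ?f m x)"
      by (rule sums_finite) (auto simp: iff)
    also have "(\<Sum>m\<le>?m. ?f m x) = (\<Sum>m\<le>?m. d m * exp (- \<theta> * x))"
      by (rule sum.cong) (auto simp: iff)
    finally show ?thesis
      using False by (simp add: lattice_step_def sum_distrib_right[symmetric] mult.commute)
  qed
  have norm_f: "norm (?f m x) = ?f m x" for m x
    using d by simp
  have s1: "AE x in lborel. summable (\<lambda>m. norm (?f m x))"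
    unfolding norm_f using f_sums by (auto simp: sums_iff)
  have s2: "summable (\<lambda>m. LINT x|lborel. norm (?f m x))"
    unfolding norm_f using D hb by (auto simp: has_bochner_integral_iff sums_iff intro: summable_divide)
  have i: "integrable lborel (?f m)" for m
    using hb by (simp add: has_bochner_integral_iff)
  have "(\<lambda>m. LINT x|lborel. ?f m x) sums (LINT x|lborel. (\<Sum>m. ?f m x))"
    by (rule sums_integral[OF i s1 s2])
  moreover have "(\<lambda>m. LINT x|lborel. ?f m x) sums (D / \<theta>)"
    using sums_divide[OF D, of \<theta>] hb by (simp add: has_bochner_integral_iff)
  ultimately have "(LINT x|lborel. (\<Sum>m. ?f m x)) = D / \<theta>"
    by (rule sums_unique2)
  moreover have "integrable lborel (\<lambda>x. \<Sum>m. ?f m x)"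
    by (rule integrable_suminf[OF i s1 s2])
  moreover have "(\<lambda>x. \<Sum>m. ?f m x) = (\<lambda>x. exp (- \<theta> * x) * lattice_step (\<lambda>m. \<Sum>j\<le>m. d j) h x)"
    using f_sums by (auto simp: sums_iff)
  ultimately show ?thesis
    by (simp add: has_bochner_integral_iff)
qed

lemma mono_lattice_step:
  assumes h: "0 < h" and w: "\<And>m. 0 \<le> w m" "\<And>m n. m \<le> n \<Longrightarrow> w m \<le> w n"
  shows "mono (lattice_step w h)"
proof (rule monoI)
  fix x y :: real assume "x \<le> y"
  then have "nat \<lfloor>x / h\<rfloor> \<le> nat \<lfloor>y / h\<rfloor>"
    using h by (intro nat_mono floor_mono divide_right_mono) auto
  then show "lattice_step w h x \<le> lattice_step w h y"
    using w \<open>x \<le> y\<close> by (auto simp: lattice_step_def)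
qed

text \<open>Rounding costs one lattice step: the floors of \<open>(x + t) / h\<close> and
  \<open>t / h\<close> may add up to one less than the floor of \<open>(x + 2 * t) / h\<close>, and
  the shift by \<open>h\<close> pays for this. The floors of \<open>x / h\<close> and
  \<open>t / h\<close> err in the favourable direction.\<close>

lemma lattice_step_log_concave:
  assumes h: "0 < h" and w: "\<And>m. 0 \<le> w m" "\<And>m n. m \<le> n \<Longrightarrow> w m \<le> w n"
    and lc: "\<And>i m j. i \<le> m \<Longrightarrow> w (m + j) * w i \<le> w (i + j) * w m"
    and x: "0 \<le> x" "0 \<le> t"
  shows "lattice_step w h (x + 2 * t - h) * lattice_step w h x \<le> (lattice_step w h (x + t))\<^sup>2"
proof -
  have nn: "0 \<le> lattice_step w h y" for y
    using w by (simp add: lattice_step_def)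
  show ?thesis
  proof (cases "x + 2 * t - h < 0")
    case True
    then show ?thesis by (simp add: lattice_step_def)
  next
    case False
    let ?i = "nat \<lfloor>x / h\<rfloor>" and ?j = "nat \<lfloor>t / h\<rfloor>" and ?m = "nat \<lfloor>(x + t) / h\<rfloor>"
    have fl: "real (nat \<lfloor>y / h\<rfloor>) \<le> y / h" "y / h < real (nat \<lfloor>y / h\<rfloor>) + 1" if "0 \<le> y" for y
      using that h by (auto simp: of_nat_nat)
    have le: "n \<le> nat \<lfloor>y / h\<rfloor>" if "real n \<le> y / h" for n y
      using that by (simp add: le_nat_floor)
    have im: "?i \<le> ?m"
      using h x by (intro nat_mono floor_mono divide_right_mono) auto
    have "real (?i + ?j) \<le> (x + t) / h"
      using fl[of x] fl[of t] x by (simp add: add_divide_distrib)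
    then have ij: "?i + ?j \<le> ?m"
      by (rule le)
    have "(x + 2 * t - h) / h = (x + t) / h + t / h - 1"
      using h by (simp add: field_simps)
    also have "\<dots> < real (?m + ?j) + 1"
      using fl(2)[of "x + t"] fl(2)[of t] x unfolding of_nat_add by linarith
    finally have "nat \<lfloor>(x + 2 * t - h) / h\<rfloor> \<le> ?m + ?j"
      using fl(1)[of "x + 2 * t - h"] False by linarith
    then have "lattice_step w h (x + 2 * t - h) \<le> w (?m + ?j)"
      using False w(2) by (simp add: lattice_step_def)
    then have "lattice_step w h (x + 2 * t - h) * lattice_step w h x \<le> w (?m + ?j) * lattice_step w h x"
      using nn by (rule mult_right_mono)
    also have "\<dots> = w (?m + ?j) * w ?i"
      using x by (simp add: lattice_step_def)
    also have "\<dots> \<le> w (?i + ?j) * w ?m"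
      by (rule lc[OF im])
    also have "\<dots> \<le> w ?m * w ?m"
      using w ij by (intro mult_right_mono) auto
    finally show ?thesis
      using x by (simp add: lattice_step_def power2_eq_square)
  qed
qed

context levy_exponent
begin

text \<open>
  Jumps are rounded down to the lattice of mesh \<open>h\<close> and those of size at most \<open>e\<close> are dropped;
  the Gaussian part becomes an additional weight on downward jumps of size \<open>h\<close>.
\<close>

definition lattice_rate :: "real \<Rightarrow> real \<Rightarrow> real" where
  "lattice_rate e h = \<sigma>\<^sup>2 / (2 * h) + truncated_drift \<gamma> \<nu> e"

text \<open>The measure term is the tail of the rounded jumps: a jump \<open>z\<close> rounds down
  to at least \<open>i * h\<close> exactly if \<open>real i * h \<le> z\<close>. The Gaussian weight
  sits at index 1, the first one, and so leaves the kernel antitone from there on.\<close>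

definition lattice_kernel :: "real \<Rightarrow> real \<Rightarrow> real \<Rightarrow> nat \<Rightarrow> real" where
  "lattice_kernel q e h i = h / lattice_rate e h *
     ((if i = 1 then \<sigma>\<^sup>2 / (2 * h\<^sup>2) else 0) + measure \<nu> {z. e < z \<and> real i * h \<le> z} + q)"

text \<open>Chosen to make \<open>lattice_kernel_sums\<close> exact; it approximates the Laplace
  exponent minus \<open>q\<close>. The quotient \<open>(1 - s) / h\<close> stands for
  \<open>\<theta>\<close>, and the factor \<open>s\<close> on the jump and \<open>q\<close> terms
  stems from geometric sums that start at index 1.\<close>

definition lattice_psi :: "real \<Rightarrow> real \<Rightarrow> real \<Rightarrow> real \<Rightarrow> real" where
  "lattice_psi q e h \<theta> = (let s = exp (- \<theta> * h) in
     \<sigma>\<^sup>2 / 2 * ((1 - s) / h)\<^sup>2 + truncated_drift \<gamma> \<nu> e * ((1 - s) / h)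
     - s * (LINT z:{e<..}|\<nu>. 1 - s ^ nat \<lfloor>z / h\<rfloor>) - q * s)"

text \<open>Exchanging sum and integral computes the generating function of the tails: for each jump
  size \<open>z\<close> the tail indicators leave a finite geometric sum.\<close>

lemma lattice_kernel_sums:
  assumes e: "0 < e" and h: "0 < h" and \<theta>: "0 < \<theta>" and c: "0 < lattice_rate e h"
  shows "(\<lambda>i. lattice_kernel q e h (Suc i) * exp (- \<theta> * h) ^ Suc i) sums
    (1 - h * lattice_psi q e h \<theta> / (lattice_rate e h * (1 - exp (- \<theta> * h))))"
proof -
  define s where "s = exp (- \<theta> * h)"
  have s: "0 < s" "s < 1"
    using h \<theta> by (auto simp: s_def)
  let ?c = "lattice_rate e h"
  let ?I = "LINT z:{e<..}|\<nu>. 1 - s ^ nat \<lfloor>z / h\<rfloor>"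
  have geo: "(\<lambda>i. s ^ Suc i) sums (s / (1 - s))"
    using sums_mult[OF geometric_sums[of s], of s] s by simp
  have A: "(\<lambda>i. (if i = 0 then \<sigma>\<^sup>2 / (2 * h\<^sup>2) * s else 0)) sums (\<sigma>\<^sup>2 / (2 * h\<^sup>2) * s)"
    using sums_single[of 0 "\<lambda>_. \<sigma>\<^sup>2 / (2 * h\<^sup>2) * s"] by simp
  have B: "(\<lambda>i. measure \<nu> {z. e < z \<and> real (Suc i) * h \<le> z} * s ^ Suc i) sums (s / (1 - s) * ?I)"
  proof -
    let ?f = "\<lambda>i z. indicator {z. e < z \<and> real (Suc i) * h \<le> z} z * s ^ Suc i"
    have fin: "emeasure \<nu> {z. e < z \<and> real (Suc i) * h \<le> z} < \<infinity>" for i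
      by (rule le_less_trans[OF emeasure_mono finite_tail[OF e]]) auto
    have i: "integrable \<nu> (?f i)" for i
      using fin[of i] by (intro integrable_mult_left) (simp add: integrable_indicator_iff)
    have If: "(LINT z|\<nu>. ?f i z) = measure \<nu> {z. e < z \<and> real (Suc i) * h \<le> z} * s ^ Suc i" for i
      by simp
    have fs: "(\<lambda>i. ?f i z) sums (indicator {e<..} z * (s / (1 - s) * (1 - s ^ nat \<lfloor>z / h\<rfloor>)))" for z
    proof (cases "e < z")
      case True
      let ?m = "nat \<lfloor>z / h\<rfloor>"
      have iff: "real (Suc i) * h \<le> z \<longleftrightarrow> i < ?m" for i
      proof -
        have "real (Suc i) * h \<le> z \<longleftrightarrow> real (Suc i) \<le> z / h"
          using h by (simp add: pos_le_divide_eq)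
        also have "\<dots> \<longleftrightarrow> Suc i \<le> ?m"
          using True e h by (simp add: le_nat_iff le_floor_iff)
        finally show ?thesis by (simp only: Suc_le_eq)
      qed
      have "(\<lambda>i. ?f i z) sums (\<Sum>i<?m. ?f i z)"
        by (rule sums_finite) (auto simp: iff simp del: of_nat_Suc)
      also have "(\<Sum>i<?m. ?f i z) = s * (\<Sum>i<?m. s ^ i)"
        unfolding sum_distrib_left using True by (intro sum.cong) (auto simp: iff simp del: of_nat_Suc)
      also have "\<dots> = s / (1 - s) * (1 - s ^ ?m)"
        using s by (simp add: sum_gp_strict)
      finally show ?thesis
        using True by simp
    qed simp
    have nf: "norm (?f i z) = ?f i z" for i z
      using s by simp
    have "(\<lambda>i. LINT z|\<nu>. ?f i z) sums (LINT z|\<nu>. (\<Sum>i. ?f i z))"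
    proof (rule sums_integral[OF i])
      show "AE z in \<nu>. summable (\<lambda>i. norm (?f i z))"
        unfolding nf using fs by (auto simp: sums_iff)
      show "summable (\<lambda>i. LINT z|\<nu>. norm (?f i z))"
        unfolding nf If
      proof (rule summable_comparison_test'[of "\<lambda>i. levy_tail \<nu> e * s ^ Suc i" 0])
        show "summable (\<lambda>i. levy_tail \<nu> e * s ^ Suc i)"
          using geo by (intro summable_mult) (auto simp: sums_iff)
        fix i
        have "measure \<nu> {z. e < z \<and> real (Suc i) * h \<le> z} \<le> levy_tail \<nu> e"
          unfolding levy_tail_def using finite_tail[OF e] by (intro measure_mono_fmeasurable) (auto simp: fmeasurable_def)
        then show "norm (measure \<nu> {z. e < z \<and> real (Suc i) * h \<le> z} * s ^ Suc i) \<le> levy_tail \<nu> e * s ^ Suc i"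
          using s by (simp add: abs_mult mult_right_mono del: of_nat_Suc power_Suc)
      qed
    qed
    also have "(LINT z|\<nu>. (\<Sum>i. ?f i z)) = s / (1 - s) * ?I"
      using fs by (simp add: sums_iff set_lebesgue_integral_def mult.left_commute)
    finally show ?thesis
      unfolding If .
  qed
  have C: "(\<lambda>i. q * s ^ Suc i) sums (q * (s / (1 - s)))"
    by (rule sums_mult[OF geo])
  have "(\<lambda>i. h / ?c * ((if i = 0 then \<sigma>\<^sup>2 / (2 * h\<^sup>2) * s else 0)
      + measure \<nu> {z. e < z \<and> real (Suc i) * h \<le> z} * s ^ Suc i + q * s ^ Suc i))
    sums (h / ?c * (\<sigma>\<^sup>2 / (2 * h\<^sup>2) * s + s / (1 - s) * ?I + q * (s / (1 - s))))"
    by (rule sums_mult[OF sums_add[OF sums_add[OF A B] C]])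
  moreover have "h / ?c * ((if i = 0 then \<sigma>\<^sup>2 / (2 * h\<^sup>2) * s else 0)
      + measure \<nu> {z. e < z \<and> real (Suc i) * h \<le> z} * s ^ Suc i + q * s ^ Suc i)
    = lattice_kernel q e h (Suc i) * s ^ Suc i" for i
    by (simp add: lattice_kernel_def algebra_simps)
  moreover have "h / ?c * (\<sigma>\<^sup>2 / (2 * h\<^sup>2) * s + s / (1 - s) * ?I + q * (s / (1 - s)))
    = 1 - h * lattice_psi q e h \<theta> / (?c * (1 - s))"
  proof -
    have "h * lattice_psi q e h \<theta> = ?c * (1 - s) - h * (1 - s) * (\<sigma>\<^sup>2 / (2 * h\<^sup>2) * s + s / (1 - s) * ?I + q * (s / (1 - s)))"
    proof -
      have "h * (D * (u / h)\<^sup>2 + A * (u / h) - t * I - q * t)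
          = (D / h + A) * u - h * u * (D / h\<^sup>2 * t + t / u * I + q * (t / u))"
        if "u \<noteq> 0" "t = 1 - u" for D A I u t
        unfolding that(2) using that(1) h by (simp add: field_simps power2_eq_square)
      from this[of "1 - s" s "\<sigma>\<^sup>2 / 2" "truncated_drift \<gamma> \<nu> e" ?I] s h \<theta> show ?thesis
        by (simp add: lattice_psi_def lattice_rate_def Let_def s_def)
    qed
    moreover have "h / c * Q = 1 - P / (c * u)" if "P = c * u - h * u * Q" "c \<noteq> 0" "u \<noteq> 0" for c Q P u
      unfolding that(1) using that(2,3) by (simp add: diff_divide_distrib)
    ultimately show ?thesis
      using c s by simp
  qed
  ultimately show ?thesis
    by (simp add: s_def)
qed

end

lemma scale_function_laplace:
  assumes "is_scale_function \<psi> q W" "right_inverse \<psi> q < \<theta>"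
  shows "integrable lborel (\<lambda>x. exp (- \<theta> * x) * W x)"
    and "(LINT x|lborel. exp (- \<theta> * x) * W x) = 1 / (\<psi> \<theta> - q)"
proof -
  have eq: "(\<lambda>x. indicator {0..} x *\<^sub>R (exp (- \<theta> * x) * W x)) = (\<lambda>x. exp (- \<theta> * x) * W x)"
    using assms(1) by (auto simp: is_scale_function_def indicator_def fun_eq_iff not_le)
  have "integrable lborel (\<lambda>x. indicator {0..} x *\<^sub>R (exp (- \<theta> * x) * W x))
    \<and> (LINT x|lborel. indicator {0..} x *\<^sub>R (exp (- \<theta> * x) * W x)) = 1 / (\<psi> \<theta> - q)"
    using assms unfolding is_scale_function_def set_integrable_def set_lebesgue_integral_def by blast
  then show "integrable lborel (\<lambda>x. exp (- \<theta> * x) * W x)"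
    "(LINT x|lborel. exp (- \<theta> * x) * W x) = 1 / (\<psi> \<theta> - q)"
    unfolding eq by blast+
qed

context levy_exponent
begin

text \<open>With the initial value \<open>1 / lattice_rate e h\<close> the rate cancels. Apart from
  a factor that tends to 1 with the mesh, the reciprocal of \<open>lattice_psi\<close> remains, in
  analogy to the transform of a scale function.\<close>

lemma lattice_laplace:
  assumes e: "0 < e" and h: "0 < h" and \<theta>: "0 < \<theta>" and c: "0 < lattice_rate e h" and q: "0 \<le> q"
    and psi: "0 < lattice_psi q e h \<theta>"
  defines "f \<equiv> lattice_step (renewal_sum (lattice_kernel q e h) (1 / lattice_rate e h)) h"
  shows "has_bochner_integral lborel (\<lambda>x. exp (- \<theta> * x) * f x)
    ((1 - exp (- \<theta> * h)) / h / \<theta> / lattice_psi q e h \<theta>)"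
proof -
  let ?c = "lattice_rate e h" and ?s = "exp (- \<theta> * h)" and ?k = "lattice_kernel q e h"
  define K where "K = 1 - h * lattice_psi q e h \<theta> / (?c * (1 - ?s))"
  have s: "0 < ?s" "?s < 1"
    using h \<theta> by auto
  have k: "0 \<le> ?k i" for i
    unfolding lattice_kernel_def using h c q by (intro mult_nonneg_nonneg add_nonneg_nonneg) auto
  have a: "0 \<le> 1 / ?c"
    using c by simp
  have K1: "K < 1"
    using h c s psi by (simp add: K_def)
  have "(\<lambda>m. renewal ?k (1 / ?c) m * ?s ^ m) sums (1 / ?c / (1 - K))"
    by (rule renewal_generating_function[OF k a _ _ K1])
      (use lattice_kernel_sums[OF e h \<theta> c] in \<open>simp_all add: K_def\<close>)
  from laplace_lattice_step[OF renewal_nonneg[of ?k, OF k a] h \<theta> this]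
  have "has_bochner_integral lborel (\<lambda>x. exp (- \<theta> * x) * f x) (1 / ?c / (1 - K) / \<theta>)"
    by (simp add: f_def renewal_sum_def[abs_def])
  also have "1 / ?c / (1 - K) / \<theta> = (1 - ?s) / h / \<theta> / lattice_psi q e h \<theta>"
    using c s h \<theta> psi by (simp add: K_def)
  finally show ?thesis .
qed

definition cutoff :: "nat \<Rightarrow> real" where
  "cutoff n = 1 / (real n + 2)"

text \<open>Rounding makes an error of order \<open>h\<close> on a set of jumps of mass
  \<open>levy_tail\<close>, which may grow without bound as the cutoff decreases. The denominator
  makes the product of mesh and tail mass at most the cutoff.\<close>

definition mesh :: "nat \<Rightarrow> real" where
  "mesh n = cutoff n / (1 + levy_tail \<nu> (cutoff n))"

lemma cutoff: "0 < cutoff n" "cutoff n < 1" "cutoff \<longlonglongrightarrow> 0"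
proof -
  show "cutoff \<longlonglongrightarrow> 0"
    unfolding cutoff_def by real_asymp
qed (simp_all add: cutoff_def)

lemma mesh: "0 < mesh n" "mesh n \<le> cutoff n" "mesh n * levy_tail \<nu> (cutoff n) \<le> cutoff n"
  "mesh \<longlonglongrightarrow> 0"
proof -
  have N: "0 \<le> levy_tail \<nu> (cutoff n)" for n
    by (rule levy_tail_nonneg)
  show pos: "0 < mesh n" for n
    unfolding mesh_def using cutoff(1)[of n] N[of n] by (intro divide_pos_pos) auto
  show le: "mesh n \<le> cutoff n" for n
    using cutoff(1)[of n] N[of n] by (simp add: mesh_def field_simps)
  show "mesh n * levy_tail \<nu> (cutoff n) \<le> cutoff n"
    using cutoff(1)[of n] N[of n] by (simp add: mesh_def field_simps)
  show "mesh \<longlonglongrightarrow> 0"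
    by (rule tendsto_sandwich[OF _ _ tendsto_const cutoff(3)]) (use pos le in \<open>auto intro!: always_eventually less_imp_le\<close>)
qed

lemma tail_integral_lim:
  assumes \<theta>: "0 \<le> \<theta>"
  shows "(\<lambda>n. LINT z:{cutoff n<..}|\<nu>. jump_integrand \<theta> z) \<longlonglongrightarrow> (LINT z:{0<..}|\<nu>. jump_integrand \<theta> z)"
  unfolding set_lebesgue_integral_def
proof (rule integral_dominated_convergence)
  show "integrable \<nu> (\<lambda>z. \<bar>indicator {0<..} z *\<^sub>R jump_integrand \<theta> z\<bar>)"
    using integrable_jump[OF \<theta>] by (simp only: set_integrable_def integrable_abs)
  show "AE z in \<nu>. (\<lambda>n. indicator {cutoff n<..} z *\<^sub>R jump_integrand \<theta> z)
      \<longlonglongrightarrow> indicator {0<..} z *\<^sub>R jump_integrand \<theta> z"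
  proof (rule AE_I2)
    fix z
    show "(\<lambda>n. indicator {cutoff n<..} z *\<^sub>R jump_integrand \<theta> z) \<longlonglongrightarrow> indicator {0<..} z *\<^sub>R jump_integrand \<theta> z"
    proof (cases "0 < z")
      case True
      have "\<forall>\<^sub>F n in sequentially. cutoff n < z"
        by (rule order_tendstoD(2)[OF cutoff(3) True])
      then have "\<forall>\<^sub>F n in sequentially. indicator {cutoff n<..} z *\<^sub>R jump_integrand \<theta> z
          = indicator {0<..} z *\<^sub>R jump_integrand \<theta> z"
        by eventually_elim (use True in simp)
      then show ?thesis
        by (rule tendsto_eventually)
    next
      case False
      then have "indicat_real {cutoff n<..} z = 0" for n
        using cutoff(1)[of n] by (simp add: indicator_def)
      then show ?thesis
        using False by simp
    qed
  qed
  show "AE z in \<nu>. norm (indicator {cutoff n<..} z *\<^sub>R jump_integrand \<theta> z)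
      \<le> \<bar>indicator {0<..} z *\<^sub>R jump_integrand \<theta> z\<bar>" for n
    using cutoff(1)[of n] by (intro AE_I2) (auto simp: indicator_def)
qed measurable

lemma rounding_error:
  fixes h \<theta> z :: real
  assumes h: "0 < h" and \<theta>: "0 \<le> \<theta>" and z: "0 < z"
  shows "\<bar>exp (- \<theta> * h) ^ nat \<lfloor>z / h\<rfloor> - exp (- \<theta> * z)\<bar> \<le> \<theta> * h"
proof -
  let ?m = "nat \<lfloor>z / h\<rfloor>"
  have "real ?m \<le> z / h" "z / h < real ?m + 1"
    using z h by (auto simp: of_nat_nat)
  then have m: "real ?m * h \<le> z" "z < real ?m * h + h"
    using h by (simp_all add: field_simps)
  have "exp (- \<theta> * h) ^ ?m = exp (- \<theta> * (real ?m * h))"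
    by (simp add: exp_of_nat_mult[symmetric] mult_ac)
  moreover have "exp (- \<theta> * z) = exp (- \<theta> * (real ?m * h)) * exp (- (\<theta> * (z - real ?m * h)))"
    by (simp add: algebra_simps flip: exp_add)
  moreover have "1 - \<theta> * h \<le> exp (- (\<theta> * (z - real ?m * h)))"
  proof -
    have "\<theta> * (z - real ?m * h) \<le> \<theta> * h"
      using m \<theta> by (intro mult_left_mono) auto
    then show ?thesis
      using exp_ge_add_one_self[of "- (\<theta> * (z - real ?m * h))"] by linarith
  qed
  moreover have "exp (- (\<theta> * (z - real ?m * h))) \<le> 1"
    using m \<theta> by simp
  moreover have "0 < exp (- \<theta> * (real ?m * h))" "exp (- \<theta> * (real ?m * h)) \<le> 1"
    using h \<theta> by simp_all
  moreover have "\<bar>E - E * F\<bar> \<le> C" if "1 - C \<le> F" "F \<le> 1" "0 < E" "E \<le> 1" for E F C :: real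
  proof -
    have "E * (1 - F) \<le> 1 * (1 - F)"
      using that by (intro mult_right_mono) auto
    moreover have "0 \<le> E * (1 - F)"
      using that by simp
    ultimately show ?thesis
      using that by (simp add: algebra_simps abs_le_iff)
  qed
  ultimately show ?thesis by simp
qed

text \<open>The truncated drift and the uncompensated jump integral may both diverge, so neither is
  passed to the limit alone: \<open>tail_integral_jump\<close> recombines them into the convergent
  compensated integral. The remaining errors are of order mesh times tail mass or smaller
  quantities, and vanish by the choice of \<open>mesh\<close>.\<close>

lemma lattice_psi_lim:
  assumes \<theta>: "0 < \<theta>"
  shows "(\<lambda>n. (1 - exp (- \<theta> * mesh n)) / mesh n) \<longlonglongrightarrow> \<theta>"
    and "(\<lambda>n. lattice_psi q (cutoff n) (mesh n) \<theta>) \<longlonglongrightarrow> laplace_psi \<gamma> \<sigma> \<nu> \<theta> - q"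
proof -
  define s where "s n = exp (- \<theta> * mesh n)" for n
  define u where "u n = (1 - s n) / mesh n" for n
  let ?N = "\<lambda>n. levy_tail \<nu> (cutoff n)" and ?A = "\<lambda>n. truncated_drift \<gamma> \<nu> (cutoff n)"
  let ?J = "\<lambda>n. LINT z:{cutoff n<..}|\<nu>. 1 - s n ^ nat \<lfloor>z / mesh n\<rfloor>"
  let ?I = "\<lambda>n. LINT z:{cutoff n<..}|\<nu>. 1 - exp (- \<theta> * z)"
  have u_bound: "\<bar>u n - \<theta>\<bar> \<le> \<theta>\<^sup>2 * mesh n" for n
  proof -
    have "0 \<le> s n - 1 + \<theta> * mesh n" "s n - 1 + \<theta> * mesh n \<le> (\<theta> * mesh n)\<^sup>2"
      using exp_minus_bounds[of "\<theta> * mesh n"] \<theta> mesh(1)[of n] by (simp_all add: s_def)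
    moreover have "\<theta> - u n = (s n - 1 + \<theta> * mesh n) / mesh n"
      using mesh(1)[of n] by (simp add: u_def field_simps)
    ultimately have "0 \<le> \<theta> - u n" "\<theta> - u n \<le> \<theta>\<^sup>2 * mesh n"
      using mesh(1)[of n] by (simp_all add: pos_divide_le_eq power2_eq_square mult_ac)
    then show ?thesis by simp
  qed
  have u: "u \<longlonglongrightarrow> \<theta>"
  proof -
    have "(\<lambda>n. u n - \<theta>) \<longlonglongrightarrow> 0"
    proof (rule Lim_null_comparison)
      show "\<forall>\<^sub>F n in sequentially. norm (u n - \<theta>) \<le> \<theta>\<^sup>2 * mesh n"
        using u_bound by simp
      show "(\<lambda>n. \<theta>\<^sup>2 * mesh n) \<longlonglongrightarrow> 0"
        using tendsto_mult_right_zero[OF mesh(4)] .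
    qed
    then show ?thesis
      by (rule LIM_zero_cancel)
  qed
  then show "(\<lambda>n. (1 - exp (- \<theta> * mesh n)) / mesh n) \<longlonglongrightarrow> \<theta>"
    by (simp add: u_def[abs_def] s_def[abs_def])
  have s: "s \<longlonglongrightarrow> 1"
  proof -
    have "s \<longlonglongrightarrow> exp (- \<theta> * 0)"
      unfolding s_def by (intro tendsto_intros mesh(4))
    then show ?thesis by simp
  qed
  have s01: "0 < s n" "s n \<le> 1" "1 - s n \<le> \<theta> * mesh n" for n
    using \<theta> mesh(1)[of n] exp_ge_add_one_self[of "- \<theta> * mesh n"] by (simp_all add: s_def)
  have drift_err: "(\<lambda>n. ?A n * (u n - \<theta>)) \<longlonglongrightarrow> 0"
  proof (rule Lim_null_comparison)
    show "\<forall>\<^sub>F n in sequentially. norm (?A n * (u n - \<theta>)) \<le> \<theta>\<^sup>2 * (\<bar>\<gamma>\<bar> * mesh n + cutoff n)"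
    proof (intro always_eventually allI)
      fix n
      have "norm (?A n * (u n - \<theta>)) \<le> (\<bar>\<gamma>\<bar> + ?N n) * (\<theta>\<^sup>2 * mesh n)"
        unfolding real_norm_def abs_mult
        by (intro mult_mono truncated_drift_bound cutoff u_bound) (auto intro: add_nonneg_nonneg levy_tail_nonneg)
      also have "\<dots> = \<theta>\<^sup>2 * (\<bar>\<gamma>\<bar> * mesh n + mesh n * ?N n)"
        by (simp add: algebra_simps)
      also have "\<dots> \<le> \<theta>\<^sup>2 * (\<bar>\<gamma>\<bar> * mesh n + cutoff n)"
        using mesh(3)[of n] by (intro mult_left_mono add_left_mono) auto
      finally show "norm (?A n * (u n - \<theta>)) \<le> \<theta>\<^sup>2 * (\<bar>\<gamma>\<bar> * mesh n + cutoff n)" .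
    qed
    have "(\<lambda>n. \<theta>\<^sup>2 * (\<bar>\<gamma>\<bar> * mesh n + cutoff n)) \<longlonglongrightarrow> \<theta>\<^sup>2 * (\<bar>\<gamma>\<bar> * 0 + 0)"
      by (intro tendsto_intros mesh cutoff)
    then show "(\<lambda>n. \<theta>\<^sup>2 * (\<bar>\<gamma>\<bar> * mesh n + cutoff n)) \<longlonglongrightarrow> 0"
      by simp
  qed
  have jump_err: "(\<lambda>n. ?I n - s n * ?J n) \<longlonglongrightarrow> 0"
  proof (rule Lim_null_comparison)
    show "\<forall>\<^sub>F n in sequentially. norm (?I n - s n * ?J n) \<le> 2 * \<theta> * cutoff n"
    proof (intro always_eventually allI)
      fix n
      have i1: "set_integrable \<nu> {cutoff n<..} (\<lambda>z. 1 - exp (- \<theta> * z))"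
        by (rule integrable_tail[OF cutoff(1), where B = 1])
          (use cutoff(1)[of n] \<theta> in \<open>auto simp: abs_le_iff\<close>)
      have b2: "\<bar>1 - s n ^ nat \<lfloor>z / mesh n\<rfloor>\<bar> \<le> 1" for z
        using s01[of n] by (simp add: power_le_one abs_le_iff)
      have i2: "set_integrable \<nu> {cutoff n<..} (\<lambda>z. 1 - s n ^ nat \<lfloor>z / mesh n\<rfloor>)"
        by (rule integrable_tail[OF cutoff(1), where B = 1]) (use b2 in auto)
      have "?I n - ?J n = (LINT z:{cutoff n<..}|\<nu>. s n ^ nat \<lfloor>z / mesh n\<rfloor> - exp (- \<theta> * z))"
        using set_integral_diff(2)[OF i1 i2] by simp
      also have "\<bar>\<dots>\<bar> \<le> \<theta> * mesh n * ?N n"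
        by (rule integral_tail_le[OF cutoff(1)])
          (use rounding_error[OF mesh(1)] \<theta> cutoff(1)[of n] in \<open>auto simp: s_def\<close>)
      finally have 1: "\<bar>?I n - ?J n\<bar> \<le> \<theta> * mesh n * ?N n" .
      have "\<bar>?J n\<bar> \<le> 1 * ?N n"
        by (rule integral_tail_le[OF cutoff(1)]) (use b2 in auto)
      then have "\<bar>(1 - s n) * ?J n\<bar> \<le> \<theta> * mesh n * ?N n"
        unfolding abs_mult using s01[of n] levy_tail_nonneg[of "cutoff n"] \<theta> mesh(1)[of n]
        by (intro mult_mono) auto
      moreover have "?I n - s n * ?J n = (?I n - ?J n) + (1 - s n) * ?J n"
        by (simp add: algebra_simps)
      ultimately have "norm (?I n - s n * ?J n) \<le> 2 * \<theta> * (mesh n * ?N n)"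
        using 1 unfolding real_norm_def by (simp add: mult.assoc)
      also have "\<dots> \<le> 2 * \<theta> * cutoff n"
        using mesh(3)[of n] \<theta> by (intro mult_left_mono) auto
      finally show "norm (?I n - s n * ?J n) \<le> 2 * \<theta> * cutoff n" .
    qed
    show "(\<lambda>n. 2 * \<theta> * cutoff n) \<longlonglongrightarrow> 0"
      using tendsto_mult_right_zero[OF cutoff(3)] .
  qed
  have "(\<lambda>n. \<sigma>\<^sup>2 / 2 * (u n)\<^sup>2 + ?A n * (u n - \<theta>)
      + (\<gamma> * \<theta> + (LINT z:{cutoff n<..}|\<nu>. jump_integrand \<theta> z)) + (?I n - s n * ?J n) - q * s n)
    \<longlonglongrightarrow> \<sigma>\<^sup>2 / 2 * \<theta>\<^sup>2 + 0 + (\<gamma> * \<theta> + (LINT z:{0<..}|\<nu>. jump_integrand \<theta> z)) + 0 - q * 1"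
    using \<theta> by (intro tendsto_intros u s drift_err jump_err tail_integral_lim) simp
  moreover have "\<sigma>\<^sup>2 / 2 * (u n)\<^sup>2 + ?A n * (u n - \<theta>)
      + (\<gamma> * \<theta> + (LINT z:{cutoff n<..}|\<nu>. jump_integrand \<theta> z)) + (?I n - s n * ?J n) - q * s n
    = lattice_psi q (cutoff n) (mesh n) \<theta>" for n
    using tail_integral_jump[OF cutoff(1), of \<theta> n] \<theta>
    by (simp add: lattice_psi_def Let_def s_def u_def algebra_simps)
  ultimately show "(\<lambda>n. lattice_psi q (cutoff n) (mesh n) \<theta>) \<longlonglongrightarrow> laplace_psi \<gamma> \<sigma> \<nu> \<theta> - q"
    by (simp add: laplace_psi_def algebra_simps)
qed

lemma truncated_drift_antimono:
  assumes "0 < e" "e \<le> e'"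
  shows "truncated_drift \<gamma> \<nu> e' \<le> truncated_drift \<gamma> \<nu> e"
proof -
  have "(LINT z:{e'<..<1}|\<nu>. z) \<le> (LINT z:{e<..<1}|\<nu>. z)"
    unfolding set_lebesgue_integral_def
  proof (rule integral_mono)
    have i: "integrable \<nu> (\<lambda>z. indicator {r<..<1} z *\<^sub>R z)" if "0 < r" for r
    proof -
      have "set_integrable \<nu> {r<..} (\<lambda>z. z * indicator {0<..<1} z)"
        by (rule integrable_tail[OF that, where B = 1]) (auto simp: indicator_def)
      also have "set_integrable \<nu> {r<..} (\<lambda>z. z * indicator {0<..<1} z)
          \<longleftrightarrow> integrable \<nu> (\<lambda>z. indicator {r<..<1} z *\<^sub>R z)"
        unfolding set_integrable_def
        by (rule Bochner_Integration.integrable_cong) (use that in \<open>auto simp: indicator_def\<close>)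
      finally show ?thesis .
    qed
    show "integrable \<nu> (\<lambda>z. indicator {e'<..<1} z *\<^sub>R z)" "integrable \<nu> (\<lambda>z. indicator {e<..<1} z *\<^sub>R z)"
      using i assms by auto
    fix z
    show "indicator {e'<..<1} z *\<^sub>R z \<le> indicator {e<..<1} z *\<^sub>R z"
      using assms by (auto simp: indicator_def)
  qed
  then show ?thesis
    by (simp add: truncated_drift_def)
qed

lemma lattice_rate_eventually_pos:
  assumes "positive_drift"
  shows "\<forall>\<^sub>F n in sequentially. 0 < lattice_rate (cutoff n) (mesh n)"
proof (cases "\<sigma> = 0")
  case True
  then obtain e where e: "0 < e" "0 < truncated_drift \<gamma> \<nu> e"
    using assms[unfolded positive_drift_def] by auto
  have "\<forall>\<^sub>F n in sequentially. cutoff n < e"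
    by (rule order_tendstoD(2)[OF cutoff(3) e(1)])
  then show ?thesis
  proof eventually_elim
    case (elim n)
    then have "0 < truncated_drift \<gamma> \<nu> (cutoff n)"
      using truncated_drift_antimono[OF cutoff(1)[of n], of e] e by simp
    then show ?case
      using mesh(1)[of n] unfolding lattice_rate_def by (intro add_nonneg_pos) auto
  qed
next
  case False
  \<comment> \<open>At cutoff 1 the integral is empty, so \<open>\<gamma>\<close> bounds the
    truncated drifts from below while the Gaussian rate tends to infinity.\<close>
  have low: "truncated_drift \<gamma> \<nu> 1 \<le> truncated_drift \<gamma> \<nu> (cutoff n)" for n
    using truncated_drift_antimono[OF cutoff(1)[of n], of 1] cutoff(2)[of n] by simp
  have "filterlim (\<lambda>n. \<sigma>\<^sup>2 / (2 * mesh n)) at_top sequentially"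
  proof -
    have "filterlim mesh (at_right 0) sequentially"
      using mesh(4) mesh(1) mesh(1)[THEN less_imp_neq, THEN not_sym] by (auto simp: filterlim_at)
    moreover have "filterlim (\<lambda>h. \<sigma>\<^sup>2 / (2 * h)) at_top (at_right 0)"
    proof -
      have "0 < \<sigma>\<^sup>2" using False by simp
      then show ?thesis by real_asymp
    qed
    ultimately show ?thesis
      by (rule filterlim_compose[rotated])
  qed
  then have "\<forall>\<^sub>F n in sequentially. - truncated_drift \<gamma> \<nu> 1 < \<sigma>\<^sup>2 / (2 * mesh n)"
    by (simp add: filterlim_at_top_dense)
  then show ?thesis
  proof eventually_elim
    case (elim n)
    then show ?case
      using low[of n] by (simp add: lattice_rate_def)
  qed
qed

lemma lattice_kernel_antimono:
  assumes "0 < e" "0 < h" "0 < lattice_rate e h" "1 \<le> i"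
  shows "lattice_kernel q e h (Suc i) \<le> lattice_kernel q e h i"
proof -
  have "measure \<nu> {z. e < z \<and> real (Suc i) * h \<le> z} \<le> measure \<nu> {z. e < z \<and> real i * h \<le> z}"
  proof (rule measure_mono_fmeasurable)
    have "real i * h \<le> real (Suc i) * h"
      using assms by (intro mult_right_mono) auto
    then show "{z. e < z \<and> real (Suc i) * h \<le> z} \<subseteq> {z. e < z \<and> real i * h \<le> z}"
      by auto
    have "emeasure \<nu> {z. e < z \<and> real i * h \<le> z} < \<infinity>"
      by (rule le_less_trans[OF emeasure_mono finite_tail[OF assms(1)]]) auto
    then show "{z. e < z \<and> real i * h \<le> z} \<in> fmeasurable \<nu>"
      by (auto simp: fmeasurable_def)
  qed simp
  then show ?thesis
    unfolding lattice_kernel_def using assms by (intro mult_left_mono) (auto intro: add_increasing)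
qed

text \<open>
  The lattice functions are renewal sequences with antitone kernel, hence log-concave, and their
  Laplace transforms converge to that of the scale function.
\<close>

lemma scale_function_log_concave:
  assumes W: "is_scale_function (laplace_psi \<gamma> \<sigma> \<nu>) q W" and q: "0 \<le> q" and pd: "positive_drift"
  shows "0 \<le> W x" and "0 \<le> x \<Longrightarrow> x \<le> y \<Longrightarrow> W x \<le> W y"
    and "0 < x \<Longrightarrow> x \<le> y \<Longrightarrow> W y * W x \<le> (W ((x + y) / 2))\<^sup>2"
proof -
  let ?psi = "laplace_psi \<gamma> \<sigma> \<nu>"
  have Wc: "continuous_on {0..} W" and W0: "\<And>x. x < 0 \<Longrightarrow> W x = 0"
    using W by (auto simp: is_scale_function_def)
  obtain \<theta>0 where \<theta>0: "\<And>\<theta>. \<theta> \<ge> \<theta>0 \<Longrightarrow> q < ?psi \<theta>"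
    using laplace_psi_eventually_gt[OF pd, of q] by (auto simp: eventually_at_top_linorder)
  define \<theta> where "\<theta> = max (max \<theta>0 1) (right_inverse ?psi q + 1)"
  have \<theta>: "0 < \<theta>" "\<And>m. q < ?psi (\<theta> + real m)" "\<And>m. right_inverse ?psi q < \<theta> + real m"
  proof -
    show "q < ?psi (\<theta> + real m)" for m
      by (rule \<theta>0) (auto simp: \<theta>_def)
  qed (auto simp: \<theta>_def)
  note Wi = scale_function_laplace(1)[OF W \<theta>(3)] and WL = scale_function_laplace(2)[OF W \<theta>(3)]
  let ?k = "\<lambda>n. lattice_kernel q (cutoff n) (mesh n)" and ?c = "\<lambda>n. lattice_rate (cutoff n) (mesh n)"
  define w where "w n = renewal_sum (?k n) (1 / ?c n)" for n
  define F where "F n = lattice_step (w n) (mesh n)" for n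
  have psi_pos: "\<forall>\<^sub>F n in sequentially. 0 < lattice_psi q (cutoff n) (mesh n) (\<theta> + real m)" for m
    by (rule order_tendstoD(1)[OF lattice_psi_lim(2)]) (use \<theta>(1) \<theta>(2)[of m] in auto)
  obtain n0 where n0: "\<And>n. n \<ge> n0 \<Longrightarrow> 0 < ?c n"
    "\<And>n. n \<ge> n0 \<Longrightarrow> 0 < lattice_psi q (cutoff n) (mesh n) \<theta>"
    using eventually_conj[OF lattice_rate_eventually_pos[OF pd] psi_pos[of 0]]
    by (auto simp: eventually_sequentially)
  have k: "0 \<le> ?k n i" if "n \<ge> n0" for n i
    unfolding lattice_kernel_def using n0(1)[OF that] q mesh(1)[of n]
    by (intro mult_nonneg_nonneg add_nonneg_nonneg) auto
  have w: "0 \<le> w n i" "i \<le> j \<Longrightarrow> w n i \<le> w n j" if "n \<ge> n0" for n i j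
    using renewal_sum_pos[of "?k n" "1 / ?c n" i] renewal_sum_mono[of "?k n" "1 / ?c n" i j]
      k[OF that] n0(1)[OF that] by (auto simp: w_def intro: less_imp_le)
  have w_lc: "w n (m + j) * w n i \<le> w n (i + j) * w n m" if "n \<ge> n0" "i \<le> m" for n i m j
    unfolding w_def using k[OF that(1)] n0(1)[OF that(1)] that
    by (intro renewal_sum_log_concave lattice_kernel_antimono cutoff mesh) auto
  have F_mono: "mono (F n)" if "n \<ge> n0" for n
    unfolding F_def by (rule mono_lattice_step[OF mesh(1)]) (use w[OF that] in auto)
  have F0: "F n x = 0" if "x < 0" for n x
    using that by (simp add: F_def lattice_step_def)
  have F_laplace: "has_bochner_integral lborel (\<lambda>x. exp (- (\<theta> + real m) * x) * F n x)
      ((1 - exp (- (\<theta> + real m) * mesh n)) / mesh n / (\<theta> + real m) / lattice_psi q (cutoff n) (mesh n) (\<theta> + real m))"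
    if "n \<ge> n0" "0 < lattice_psi q (cutoff n) (mesh n) (\<theta> + real m)" for n m
    unfolding F_def w_def
    by (rule lattice_laplace) (use that n0(1) cutoff(1) mesh(1) \<theta>(1) q in auto)
  have F_nonneg: "0 \<le> F n x" if "n \<ge> n0" for n x
    using w[OF that] by (simp add: F_def lattice_step_def)
  \<comment> \<open>Positivity of \<open>lattice_psi\<close> at \<open>\<theta> + real m\<close>
    sets in at an index depending on \<open>m\<close>; for the fixed \<open>n0\<close>,
    integrability is inherited from \<open>m = 0\<close> by domination.\<close>
  have Fi: "integrable lborel (\<lambda>x. exp (- (\<theta> + real m) * x) * F n x)" if "n \<ge> n0" for n m
  proof (rule integrable_norm_bound)
    show "integrable lborel (\<lambda>x. exp (- \<theta> * x) * F n x)"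
      using F_laplace[of n 0] n0(2) that by (simp add: has_bochner_integral_iff)
    have [measurable]: "F n \<in> borel_measurable borel"
      by (rule borel_measurable_mono[OF F_mono[OF that]])
    show "(\<lambda>x. exp (- (\<theta> + real m) * x) * F n x) \<in> borel_measurable lborel"
      by measurable
    show "norm (exp (- (\<theta> + real m) * x) * F n x) \<le> norm (exp (- \<theta> * x) * F n x)" for x
    proof (cases "x < 0")
      case False
      then show ?thesis
        using F_nonneg[OF that] by (auto simp: abs_mult algebra_simps intro!: mult_left_mono)
    qed (simp add: F0)
  qed
  have Flim: "(\<lambda>n. LINT x|lborel. exp (- (\<theta> + real m) * x) * F (n + n0) x)
      \<longlonglongrightarrow> (LINT x|lborel. exp (- (\<theta> + real m) * x) * W x)" for m
  proof -
    let ?t = "\<theta> + real m"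
    have t: "0 < ?t" using \<theta>(1) by simp
    have "(\<lambda>n. (1 - exp (- ?t * mesh n)) / mesh n / ?t / lattice_psi q (cutoff n) (mesh n) ?t)
        \<longlonglongrightarrow> ?t / ?t / (?psi ?t - q)"
      by (intro tendsto_intros lattice_psi_lim t) (use t \<theta>(2)[of m] in auto)
    then have "(\<lambda>n. (1 - exp (- ?t * mesh n)) / mesh n / ?t / lattice_psi q (cutoff n) (mesh n) ?t)
        \<longlonglongrightarrow> (LINT x|lborel. exp (- ?t * x) * W x)"
      using WL[of m] t by simp
    moreover have "\<forall>\<^sub>F n in sequentially. (1 - exp (- ?t * mesh n)) / mesh n / ?t / lattice_psi q (cutoff n) (mesh n) ?t
        = (LINT x|lborel. exp (- ?t * x) * F n x)"
      using psi_pos[of m] eventually_ge_at_top[of n0]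
      by eventually_elim (use F_laplace in \<open>auto simp: has_bochner_integral_iff\<close>)
    ultimately have "(\<lambda>n. LINT x|lborel. exp (- ?t * x) * F n x) \<longlonglongrightarrow> (LINT x|lborel. exp (- ?t * x) * W x)"
      by (rule Lim_transform_eventually)
    then show ?thesis
      by (rule LIMSEQ_ignore_initial_segment)
  qed
  have lim: "(\<lambda>n. F (n + n0) x) \<longlonglongrightarrow> W x" if "0 < x" for x
    by (rule mono_laplace_limit[where f = "\<lambda>n. F (n + n0)" and \<theta> = \<theta>, OF _ _ _ Wc W0 _ Flim that])
      (use F_mono F0 Fi Wi[of 0] in auto)
  have mono_pos: "W x \<le> W y" if "0 < x" "x \<le> y" for x y
  proof (rule LIMSEQ_le[OF lim[OF that(1)] lim])
    show "\<exists>N. \<forall>n\<ge>N. F (n + n0) x \<le> F (n + n0) y"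
      using monoD[OF F_mono _] that(2) by auto
  qed (use that in simp)
  have nonneg_pos: "0 \<le> W x" if "0 < x" for x
    by (rule LIMSEQ_le_const[OF lim[OF that]]) (use F_nonneg in auto)
  \<comment> \<open>The limit identifies \<open>W\<close> on the positive axis only; the value at 0
    is reached by right continuity.\<close>
  have right_cont: "(W \<longlongrightarrow> W 0) (at_right 0)"
    using Wc by (auto simp: continuous_on_def intro: tendsto_within_subset)
  have pos_ev: "\<forall>\<^sub>F x in at_right 0. (0::real) < x"
    by (rule eventually_at_right_less)
  have nonneg0: "0 \<le> W 0"
    by (rule tendsto_lowerbound[OF right_cont]) (use pos_ev in \<open>auto elim!: eventually_mono intro: nonneg_pos\<close>)
  show "0 \<le> W x"
    using nonneg0 nonneg_pos[of x] W0[of x] by (cases "x < 0"; cases "x = 0") auto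
  show "W x \<le> W y" if "0 \<le> x" "x \<le> y"
  proof (cases "x = 0")
    case True
    show ?thesis
    proof (cases "y = 0")
      case False
      then have y: "0 < y" using that True by simp
      have "W 0 \<le> W y"
      proof (rule tendsto_upperbound[OF right_cont])
        have "\<forall>\<^sub>F x in at_right 0. x < y"
          using y eventually_at_right_field by blast
        with pos_ev show "\<forall>\<^sub>F x in at_right 0. W x \<le> W y"
          by eventually_elim (use mono_pos in auto)
      qed simp
      then show ?thesis using True by simp
    qed (use True in simp)
  qed (use that mono_pos in auto)
  show "W y * W x \<le> (W ((x + y) / 2))\<^sup>2" if x: "0 < x" "x \<le> y"
  proof -
    \<comment> \<open>The defect of one mesh in \<open>lattice_step_log_concave\<close> eventually
      falls below \<open>\<eta>\<close>; afterwards \<open>\<eta>\<close> tends to 0, by continuity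
      of \<open>W\<close> at \<open>y\<close>.\<close>
    have *: "W (y - \<eta>) * W x \<le> (W ((x + y) / 2))\<^sup>2" if \<eta>: "0 < \<eta>" "\<eta> < y" for \<eta>
    proof (rule LIMSEQ_le)
      show "(\<lambda>n. F (n + n0) (y - \<eta>) * F (n + n0) x) \<longlonglongrightarrow> W (y - \<eta>) * W x"
        using x \<eta> by (intro tendsto_mult lim) auto
      show "(\<lambda>n. (F (n + n0) ((x + y) / 2))\<^sup>2) \<longlonglongrightarrow> (W ((x + y) / 2))\<^sup>2"
        using x by (intro tendsto_power lim) auto
      have "\<forall>\<^sub>F n in sequentially. mesh n < \<eta>"
        by (rule order_tendstoD(2)[OF mesh(4) \<eta>(1)])
      then obtain n1 where n1: "\<And>n. n \<ge> n1 \<Longrightarrow> mesh n < \<eta>"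
        by (auto simp: eventually_sequentially)
      show "\<exists>N. \<forall>n\<ge>N. F (n + n0) (y - \<eta>) * F (n + n0) x \<le> (F (n + n0) ((x + y) / 2))\<^sup>2"
      proof (intro exI allI impI)
        fix n assume "n \<ge> n1"
        let ?n = "n + n0" and ?t = "(y - x) / 2"
        have n: "?n \<ge> n0" "mesh ?n < \<eta>"
          using n1[of ?n] \<open>n \<ge> n1\<close> by auto
        have "F ?n (y - \<eta>) * F ?n x \<le> F ?n (x + 2 * ?t - mesh ?n) * F ?n x"
          using n(2) by (intro mult_right_mono monoD[OF F_mono[OF n(1)]] F_nonneg[OF n(1)]) (simp add: field_simps)
        also have "\<dots> \<le> (F ?n (x + ?t))\<^sup>2"
          unfolding F_def
          by (rule lattice_step_log_concave[OF mesh(1)]) (use w[OF n(1)] w_lc[OF n(1)] x in auto)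
        also have "x + ?t = (x + y) / 2"
          by (simp add: field_simps)
        finally show "F ?n (y - \<eta>) * F ?n x \<le> (F ?n ((x + y) / 2))\<^sup>2" .
      qed
    qed
    have "continuous (at y) W"
      using continuous_on_interior[OF Wc, of y] x by simp
    then have "((\<lambda>\<eta>. W (y - \<eta>)) \<longlongrightarrow> W (y - 0)) (at_right 0)"
      by (intro isCont_tendsto_compose[of _ W] tendsto_intros) (auto simp: filterlim_ident)
    then have "((\<lambda>\<eta>. W (y - \<eta>) * W x) \<longlongrightarrow> W y * W x) (at_right 0)"
      by (intro tendsto_intros) simp
    then show ?thesis
    proof (rule tendsto_upperbound)
      have "\<forall>\<^sub>F \<eta> in at_right 0. \<eta> < y"
        unfolding eventually_at_right_field using x by (intro exI[of _ y]) auto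
      with pos_ev show "\<forall>\<^sub>F \<eta> in at_right 0. W (y - \<eta>) * W x \<le> (W ((x + y) / 2))\<^sup>2"
        by eventually_elim (rule *)
    qed simp
  qed
qed

end

section \<open>Convolution of causal functions\<close>

definition causal :: "real \<Rightarrow> (real \<Rightarrow> real) \<Rightarrow> bool" where
  "causal a f \<longleftrightarrow> f \<in> borel_measurable borel \<and> (\<forall>x<a. f x = 0) \<and>
     (\<forall>T. set_integrable lborel {..T} f)"

text \<open>For causal factors the integrand has bounded support, so no range of integration is
  needed. Where it is not integrable the value is 0 by default; for two merely locally integrable
  factors this can happen on a null set.\<close>

definition conv :: "(real \<Rightarrow> real) \<Rightarrow> (real \<Rightarrow> real) \<Rightarrow> real \<Rightarrow> real" where
  "conv f g x = (LINT y|lborel. f (x - y) * g y)"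

lemma integrable_shear:
  fixes f g :: "real \<Rightarrow> real"
  assumes f: "integrable lborel f" and g: "integrable lborel g"
  shows "integrable (lborel \<Otimes>\<^sub>M lborel) (\<lambda>(x, y). f (x - y) * g y)"
proof -
  have [measurable]: "f \<in> borel_measurable borel" "g \<in> borel_measurable borel"
    using f g by auto
  have "integrable (lborel \<Otimes>\<^sub>M lborel) (\<lambda>(y, x). f (x - y) * g y)"
  proof (rule lborel_pair.Fubini_integrable)
    have *: "(LINT x|lborel. norm (f (x - y) * g y)) = (LINT x|lborel. norm (f x)) * norm (g y)" for y
      using lborel_integral_real_affine[of 1 "\<lambda>x. norm (f x)" "-y"]
      by (simp add: abs_mult del: abs_mult_pos abs_mult_pos')
    show "integrable lborel (\<lambda>y. LINT x|lborel. norm (case (y, x) of (y, x) \<Rightarrow> f (x - y) * g y))"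
      using g by (simp only: * prod.case) simp
    have "integrable lborel (\<lambda>x. f (x - y) * g y)" for y
      using lborel_integrable_real_affine[OF f, of 1 "-y"] by simp
    then show "AE y in lborel. integrable lborel (\<lambda>x. case (y, x) of (y, x) \<Rightarrow> f (x - y) * g y)"
      by simp
  qed measurable
  from lborel_pair.integrable_product_swap[OF this] show ?thesis
    by (simp add: case_prod_beta' split_beta)
qed

definition locally_bounded :: "(real \<Rightarrow> real) \<Rightarrow> bool" where
  "locally_bounded f \<longleftrightarrow> (\<forall>T. \<exists>B. \<forall>x\<le>T. \<bar>f x\<bar> \<le> B)"

lemma causal_measurable: "causal a f \<Longrightarrow> f \<in> borel_measurable borel"
  by (simp add: causal_def)

lemma causal_zero: "causal a f \<Longrightarrow> x < a \<Longrightarrow> f x = 0"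
  by (simp add: causal_def)

lemma causal_truncation:
  "causal a f \<Longrightarrow> integrable lborel (\<lambda>x. indicator {..T} x * f x)"
  by (simp add: causal_def set_integrable_def)

lemma causal_set_integrable:
  assumes "causal a f" "A \<in> sets borel" "A \<subseteq> {..T}"
  shows "set_integrable lborel A f"
  by (rule set_integrable_subset[of lborel "{..T}"]) (use assms in \<open>auto simp: causal_def\<close>)

lemma locally_bounded_add:
  assumes "locally_bounded f" "locally_bounded g"
  shows "locally_bounded (\<lambda>x. f x + g x)"
  unfolding locally_bounded_def
proof
  fix T
  obtain B C where "\<forall>x\<le>T. \<bar>f x\<bar> \<le> B" "\<forall>x\<le>T. \<bar>g x\<bar> \<le> C"
    using assms unfolding locally_bounded_def by blast
  then have "\<forall>x\<le>T. \<bar>f x + g x\<bar> \<le> B + C"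
    by (smt (verit))
  then show "\<exists>B. \<forall>x\<le>T. \<bar>f x + g x\<bar> \<le> B" ..
qed

lemma locally_bounded_cmult:
  assumes "locally_bounded f"
  shows "locally_bounded (\<lambda>x. c * f x)"
  unfolding locally_bounded_def
proof
  fix T
  obtain B where "\<forall>x\<le>T. \<bar>f x\<bar> \<le> B"
    using assms by (auto simp: locally_bounded_def)
  then have "\<forall>x\<le>T. \<bar>c * f x\<bar> \<le> \<bar>c\<bar> * B"
    by (auto simp: abs_mult intro: mult_left_mono)
  then show "\<exists>B. \<forall>x\<le>T. \<bar>c * f x\<bar> \<le> B" ..
qed

lemma causalI_locally_bounded:
  assumes f: "f \<in> borel_measurable borel" "\<And>x. x < a \<Longrightarrow> f x = 0" "locally_bounded f"
  shows "causal a f"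
  unfolding causal_def
proof (intro conjI allI impI)
  fix T
  obtain B where B: "\<bar>f x\<bar> \<le> B" if "x \<le> T" for x
    using f(3) by (auto simp: locally_bounded_def)
  show "set_integrable lborel {..T} f"
    unfolding set_integrable_def
  proof (rule integrable_norm_bound)
    show "integrable lborel (\<lambda>x. B * indicator {a..T} x)"
      by (intro integrable_mult_right) (simp add: integrable_indicator_iff emeasure_lborel_Icc_eq)
    show "norm (indicator {..T} x *\<^sub>R f x) \<le> norm (B * indicator {a..T} x)" for x
      using f(2)[of x] B[of x] by (cases "x \<le> T"; cases "x < a") (auto simp: indicator_def)
  qed (use f(1) in measurable)
qed (simp_all add: f(1,2))

text \<open>Up to \<open>T\<close> only the values of \<open>f\<close> up to \<open>T - b\<close>
  and of \<open>g\<close> up to \<open>T - a\<close> enter. The truncations are globally integrable,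
  so Fubini arguments such as \<open>integrable_shear\<close> apply to them.\<close>

lemma conv_truncation:
  assumes f: "causal a f" and g: "causal b g" and x: "x \<le> T"
  shows "conv f g x
    = conv (\<lambda>x. indicator {..T - b} x * f x) (\<lambda>x. indicator {..T - a} x * g x) x"
  unfolding conv_def
proof (rule Bochner_Integration.integral_cong)
  fix y
  show "f (x - y) * g y
    = indicator {..T - b} (x - y) * f (x - y) * (indicator {..T - a} y * g y)"
    using causal_zero[OF f, of "x - y"] causal_zero[OF g, of y] x
    by (cases "x - y < a"; cases "y < b") (auto simp: indicator_def)
qed simp

lemma conv_measurable [measurable]:
  assumes [measurable]: "f \<in> borel_measurable borel" "g \<in> borel_measurable borel"
  shows "conv f g \<in> borel_measurable borel"
  unfolding conv_def by measurable

lemma causal_conv: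
  assumes f: "causal a f" and g: "causal b g"
  shows "causal (a + b) (conv f g)"
  unfolding causal_def
proof (intro conjI allI impI)
  show "conv f g \<in> borel_measurable borel"
    using causal_measurable[OF f] causal_measurable[OF g] by measurable
next
  fix x assume x: "x < a + b"
  have "f (x - y) * g y = 0" for y
    using causal_zero[OF f, of "x - y"] causal_zero[OF g, of y] x by (cases "y < b") auto
  then show "conv f g x = 0"
    unfolding conv_def by (simp only:) simp
next
  fix T
  let ?f = "\<lambda>x. indicator {..T - b} x * f x" and ?g = "\<lambda>x. indicator {..T - a} x * g x"
  have "integrable lborel (\<lambda>x. LINT y|lborel. ?f (x - y) * ?g y)"
    using lborel_pair.integrable_fst'[OF integrable_shear[OF causal_truncation[OF f] causal_truncation[OF g]]]
    by simp
  then have "integrable lborel (\<lambda>x. indicator {..T} x *\<^sub>R conv ?f ?g x)"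
    unfolding conv_def by (intro integrable_mult_indicator) auto
  also have "(\<lambda>x. indicator {..T} x *\<^sub>R conv ?f ?g x) = (\<lambda>x. indicator {..T} x *\<^sub>R conv f g x)"
    using conv_truncation[OF f g] by (auto simp: indicator_def fun_eq_iff)
  finally show "set_integrable lborel {..T} (conv f g)"
    by (simp add: set_integrable_def)
qed

lemma conv_integrable:
  assumes f: "causal a f" "locally_bounded f" and g: "causal b g"
  shows "integrable lborel (\<lambda>y. f (x - y) * g y)"
proof -
  obtain B where B: "\<bar>f z\<bar> \<le> B" if "z \<le> x - b" for z
    using f(2) by (auto simp: locally_bounded_def)
  show ?thesis
  proof (rule integrable_norm_bound)
    show "integrable lborel (\<lambda>y. B * (indicator {..x - a} y * g y))"
      using causal_truncation[OF g] by simp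
    show "norm (f (x - y) * g y) \<le> norm (B * (indicator {..x - a} y * g y))" for y
    proof (cases "x - y < a \<or> y < b")
      case True
      then show ?thesis
        using causal_zero[OF f(1), of "x - y"] causal_zero[OF g, of y] by auto
    next
      case False
      then have "\<bar>f (x - y)\<bar> \<le> \<bar>B\<bar>" "indicat_real {..x - a} y = 1"
        using B[of "x - y"] by auto
      then show ?thesis
        by (simp add: abs_mult mult_right_mono)
    qed
  qed (use causal_measurable[OF f(1)] causal_measurable[OF g] in measurable)
qed

text \<open>
  Local boundedness of \<open>f\<close> makes the triple product absolutely integrable for every \<open>x\<close>, so that
  associativity holds pointwise and not only almost everywhere.
\<close>

lemma conv_assoc:
  assumes f: "causal a f" "locally_bounded f" and g: "causal b g" and h: "causal c h"
  shows "conv (conv f g) h x = conv f (conv g h) x"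
proof -
  have [measurable]: "f \<in> borel_measurable borel" "g \<in> borel_measurable borel"
    "h \<in> borel_measurable borel"
    using causal_measurable f(1) g h by blast+
  obtain B where B: "\<bar>f z\<bar> \<le> B" if "z \<le> x - b - c" for z
    using f(2) by (auto simp: locally_bounded_def)
  let ?F = "\<lambda>(y, z). f (x - y) * (g (y - z) * h z)"
  let ?g = "\<lambda>y. indicator {..x - a - c} y * g y" and ?h = "\<lambda>y. indicator {..x - a - b} y * h y"
  have int: "integrable (lborel \<Otimes>\<^sub>M lborel) ?F"
  proof (rule Bochner_Integration.integrable_bound)
    show "integrable (lborel \<Otimes>\<^sub>M lborel) (\<lambda>p. B * (case p of (y, z) \<Rightarrow> ?g (y - z) * ?h z))"
      using integrable_shear[OF causal_truncation[OF g] causal_truncation[OF h]] by simp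
    have "norm (f (x - y) * (g (y - z) * h z)) \<le> norm (B * (?g (y - z) * ?h z))" for y z
    proof (cases "x - y < a \<or> y - z < b \<or> z < c")
      case True
      then show ?thesis
        using causal_zero[OF f(1), of "x - y"] causal_zero[OF g, of "y - z"] causal_zero[OF h, of z]
        by auto
    next
      case False
      then have "\<bar>f (x - y)\<bar> \<le> \<bar>B\<bar>" "indicat_real {..x - a - c} (y - z) = 1"
          "indicat_real {..x - a - b} z = 1"
        using B[of "x - y"] by auto
      then show ?thesis
        by (simp add: abs_mult mult_right_mono)
    qed
    then show "AE p in lborel \<Otimes>\<^sub>M lborel. norm (?F p) \<le> norm (B * (case p of (y, z) \<Rightarrow> ?g (y - z) * ?h z))"
      by (intro AE_I2) auto
  qed measurable
  have "conv (conv f g) h x = (LINT z|lborel. LINT y|lborel. f (x - y) * (g (y - z) * h z))"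
    unfolding conv_def
  proof (rule Bochner_Integration.integral_cong)
    fix z
    have "(LINT y|lborel. f (x - y) * (g (y - z) * h z))
        = (LINT y|lborel. f (x - z - y) * g y * h z)"
      using lborel_integral_real_affine[of 1 "\<lambda>y. f (x - y) * (g (y - z) * h z)" z]
      by (simp add: algebra_simps)
    then show "(LINT y|lborel. f (x - z - y) * g y) * h z
        = (LINT y|lborel. f (x - y) * (g (y - z) * h z))"
      by simp
  qed simp
  also have "\<dots> = (LINT y|lborel. LINT z|lborel. f (x - y) * (g (y - z) * h z))"
    using lborel_pair.Fubini_integral[of "\<lambda>y z. f (x - y) * (g (y - z) * h z)"] int by simp
  also have "\<dots> = conv f (conv g h) x"
    by (simp add: conv_def)
  finally show ?thesis .
qed

lemma conv_cong_AE:
  assumes "AE y in lborel. g y = g' y"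
    and [measurable]: "f \<in> borel_measurable borel" "g \<in> borel_measurable borel" "g' \<in> borel_measurable borel"
  shows "conv f g x = conv f g' x"
  unfolding conv_def
proof (rule integral_cong_AE)
  show "AE y in lborel. f (x - y) * g y = f (x - y) * g' y"
    using assms(1) by eventually_elim simp
qed measurable

lemma causal_add: "causal a f \<Longrightarrow> causal a g \<Longrightarrow> causal a (\<lambda>x. f x + g x)"
  by (auto simp: causal_def intro: borel_measurable_add)

lemma causal_cmult: "causal a f \<Longrightarrow> causal a (\<lambda>x. c * f x)"
  by (auto simp: causal_def)

lemma causal_mono: "causal a f \<Longrightarrow> b \<le> a \<Longrightarrow> causal b f"
  by (simp add: causal_def)

lemma causal_bounded_mult:
  assumes f: "causal a f" and [measurable]: "p \<in> borel_measurable borel"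
    and p: "\<And>x. \<bar>p x\<bar> \<le> C"
  shows "causal a (\<lambda>x. p x * f x)"
  unfolding causal_def
proof (intro conjI allI impI)
  fix T
  show "set_integrable lborel {..T} (\<lambda>x. p x * f x)"
    unfolding set_integrable_def
  proof (rule Bochner_Integration.integrable_bound)
    show "integrable lborel (\<lambda>x. C * (indicator {..T} x * f x))"
      using causal_truncation[OF f] by simp
    show "AE x in lborel. norm (indicator {..T} x *\<^sub>R (p x * f x)) \<le> norm (C * (indicator {..T} x * f x))"
      using p order_trans[OF p abs_ge_self]
      by (intro AE_I2) (auto simp: abs_mult indicator_def intro!: mult_right_mono)
  qed (use causal_measurable[OF f] in measurable)
qed (use causal_measurable[OF f] causal_zero[OF f] in simp_all)

section \<open>Differentiating convolutions almost everywhere\<close>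

lemma indefinite_integral_right_derivative:
  fixes f :: "real \<Rightarrow> real"
  assumes "\<And>a b. f integrable_on {a..b}"
  shows "\<exists>N. negligible N \<and> (\<forall>x. x \<notin> N \<longrightarrow>
    ((\<lambda>h. integral {x..x + h} f / h) \<longlongrightarrow> f x) (at_right 0))"
proof -
  obtain N where N: "negligible N" "\<And>x e. \<lbrakk>x \<notin> N; 0 < e\<rbrakk> \<Longrightarrow>
      \<exists>d>0. \<forall>h. 0 < h \<and> h < d \<longrightarrow>
        norm (integral (cbox x (x + h *\<^sub>R One)) f /\<^sub>R h ^ DIM(real) - f x) < e"
    using integrable_ccontinuous_explicit[where f = f] assms by (metis cbox_interval)
  have "((\<lambda>h. integral {x..x + h} f / h) \<longlongrightarrow> f x) (at_right 0)" if "x \<notin> N" for x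
  proof (rule tendstoI)
    fix e :: real assume "0 < e"
    from N(2)[OF that this] obtain d where d: "d > 0"
      "\<And>h. 0 < h \<Longrightarrow> h < d \<Longrightarrow> norm (integral {x..x + h} f / h - f x) < e"
      by (auto simp: divide_inverse mult.commute)
    then show "\<forall>\<^sub>F h in at_right 0. dist (integral {x..x + h} f / h) (f x) < e"
      by (auto simp: eventually_at_right_field dist_norm)
  qed
  with N(1) show ?thesis by blast
qed

text \<open>Averages over intervals with left endpoint \<open>x\<close> give the right derivative;
  the left one is the same statement for the reflected function
  \<open>\<lambda>x. f (- x)\<close>.\<close>

lemma AE_has_derivative_indefinite_integral:
  fixes f F :: "real \<Rightarrow> real"
  assumes f: "\<And>a b. f integrable_on {a..b}"
    and F: "\<And>x y. x \<le> y \<Longrightarrow> F y - F x = integral {x..y} f"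
  shows "AE x in lebesgue. (F has_real_derivative f x) (at x)"
proof -
  obtain N where N: "negligible N" "\<And>x. x \<notin> N \<Longrightarrow>
      ((\<lambda>h. integral {x..x + h} f / h) \<longlongrightarrow> f x) (at_right 0)"
    using indefinite_integral_right_derivative[OF f] by blast
  have f': "(\<lambda>x. f (- x)) integrable_on {a..b}" for a b
    using f[of "-b" "-a"] Henstock_Kurzweil_Integration.integrable_reflect_real[where f = f and a = "-b" and b = "-a"] by simp
  obtain N' where N': "negligible N'" "\<And>x. x \<notin> N' \<Longrightarrow>
      ((\<lambda>h. integral {x..x + h} (\<lambda>x. f (- x)) / h) \<longlongrightarrow> f (- x)) (at_right 0)"
    using indefinite_integral_right_derivative[of "\<lambda>x. f (- x)", OF f'] by blast
  have "(F has_real_derivative f x) (at x)" if x: "x \<notin> N \<union> uminus ` N'" for x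
  proof -
    have "((\<lambda>h. (F (x + h) - F x) / h) \<longlongrightarrow> f x) (at_right 0)"
      using N(2)[of x] x
      by (rule_tac Lim_transform_eventually) (auto simp: F eventually_at_right_less intro!: eventually_at_rightI[of _ 1])
    moreover have "((\<lambda>h. (F (x + h) - F x) / h) \<longlongrightarrow> f x) (at_left 0)"
    proof -
      have "- x \<notin> N'" using x by force
      then have "((\<lambda>h. integral {-x..-x + h} (\<lambda>x. f (- x)) / h) \<longlongrightarrow> f x) (at_right 0)"
        using N'(2)[of "-x"] by simp
      then have "((\<lambda>h. (F (x + (- h)) - F x) / (- h)) \<longlongrightarrow> f x) (at_right 0)"
      proof (rule Lim_transform_eventually)
        show "\<forall>\<^sub>F h in at_right 0. integral {-x..-x + h} (\<lambda>x. f (- x)) / h = (F (x + (- h)) - F x) / (- h)"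
        proof (rule eventually_at_rightI[of _ 1])
          fix h :: real assume "h \<in> {0<..<1}"
          then have "F x - F (x - h) = integral {x - h..x} f"
            by (intro F) auto
          moreover have "integral {-x..-x + h} (\<lambda>x. f (- x)) = integral {x - h..x} f"
            using Henstock_Kurzweil_Integration.integral_reflect_real[of x "x - h" f] by (simp add: add.commute)
          ultimately show "integral {-x..-x + h} (\<lambda>x. f (- x)) / h = (F (x + (- h)) - F x) / (- h)"
            by (simp add: field_simps)
        qed simp
      qed
      then show ?thesis
        by (subst filterlim_at_left_to_right) simp
    qed
    ultimately show ?thesis
      unfolding DERIV_def by (simp add: filterlim_at_split)
  qed
  moreover have "negligible (N \<union> uminus ` N')"
    using N(1) N'(1)
    by (intro negligible_Un negligible_differentiable_image_negligible)
      (auto intro!: differentiable_on_minus differentiable_on_id)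
  ultimately show ?thesis
    unfolding eventually_ae_filter negligible_iff_null_sets by blast
qed

lemma conv_add_right:
  assumes f: "causal a f" "locally_bounded f" and g: "causal b g" and h: "causal c h"
  shows "conv f (\<lambda>x. g x + h x) x = conv f g x + conv f h x"
  unfolding conv_def
  using conv_integrable[OF f g] conv_integrable[OF f h]
  by (simp add: distrib_left)

lemma conv_add_left:
  assumes f: "causal a f" "locally_bounded f" and g: "causal b g" "locally_bounded g" and h: "causal c h"
  shows "conv (\<lambda>x. f x + g x) h x = conv f h x + conv g h x"
  unfolding conv_def
  using conv_integrable[OF f h] conv_integrable[OF g h]
  by (simp add: distrib_right)

lemma conv_cmult_right: "conv f (\<lambda>x. c * g x) x = c * conv f g x"
  by (simp add: conv_def mult.left_commute[of _ c])

lemma conv_cmult_left: "conv (\<lambda>x. c * f x) g x = c * conv f g x"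
  by (simp add: conv_def mult.assoc)

abbreviation heaviside :: "real \<Rightarrow> real" where
  "heaviside \<equiv> indicator {0..}"

lemma locally_bounded_heaviside: "locally_bounded heaviside"
  unfolding locally_bounded_def by (intro allI exI[of _ 1]) (simp add: indicator_def)

lemma causal_heaviside: "causal 0 heaviside"
  by (rule causalI_locally_bounded) (simp_all add: locally_bounded_heaviside)

lemma conv_heaviside: "conv heaviside m x = (LINT y:{..x}|lborel. m y)"
proof -
  have "indicat_real {0..} (x - y) = indicator {..x} y" for y
    by (simp add: indicator_def)
  then show ?thesis
    by (simp add: conv_def set_lebesgue_integral_def)
qed

lemma causal_integrable_on:
  assumes "causal a m"
  shows "m integrable_on {x..y}"
  using causal_set_integrable[OF assms, of "{x..y}" y] by (intro set_borel_integral_eq_integral(1)) auto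

lemma conv_heaviside_diff:
  assumes m: "causal a m" and "x \<le> y"
  shows "conv heaviside m y - conv heaviside m x = integral {x..y} m"
proof -
  have "conv heaviside m y = (LINT z:{..x} \<union> {x<..y}|lborel. m z)"
    using \<open>x \<le> y\<close> by (simp add: conv_heaviside ivl_disj_un)
  also have "\<dots> = (LINT z:{..x}|lborel. m z) + (LINT z:{x<..y}|lborel. m z)"
    by (intro set_integral_Un causal_set_integrable[OF m, of _ y]) (use \<open>x \<le> y\<close> in auto)
  also have "(LINT z:{x<..y}|lborel. m z) = integral {x<..y} m"
    by (intro set_borel_integral_eq_integral(2) causal_set_integrable[OF m, of _ y]) auto
  also have "\<dots> = integral {x..y} m"
    by (rule integral_subset_negligible) (auto intro: negligible_subset[of "{x}"])
  finally show ?thesis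
    by (simp add: conv_heaviside)
qed

lemma AE_DERIV_conv_heaviside:
  assumes "causal a m"
  shows "AE x in lebesgue. (conv heaviside m has_real_derivative m x) (at x)"
  using assms by (intro AE_has_derivative_indefinite_integral causal_integrable_on conv_heaviside_diff)

lemma continuous_on_conv_heaviside:
  assumes m: "causal a m"
  shows "continuous_on UNIV (conv heaviside m)"
proof -
  have "isCont (conv heaviside m) x" for x
  proof -
    have "continuous_on {x - 1..x + 1} (\<lambda>y. conv heaviside m (x - 1) + integral {x - 1..y} m)"
      by (intro continuous_intros indefinite_integral_continuous_1 causal_integrable_on[OF m])
    then have "continuous_on {x - 1..x + 1} (conv heaviside m)"
      by (rule continuous_on_eq) (auto simp flip: conv_heaviside_diff[OF m])
    then have "continuous_on {x - 1<..<x + 1} (conv heaviside m)"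
      by (rule continuous_on_subset) auto
    then show ?thesis
      by (simp add: continuous_on_eq_continuous_at)
  qed
  then show ?thesis
    by (simp add: continuous_on_eq_continuous_at)
qed

lemma locally_bounded_conv_heaviside:
  assumes m: "causal a m"
  shows "locally_bounded (conv heaviside m)"
  unfolding locally_bounded_def
proof (intro allI exI impI)
  fix T x :: real assume "x \<le> T"
  have "\<bar>conv heaviside m x\<bar> \<le> (LINT z:{..x}|lborel. \<bar>m z\<bar>)"
    using set_integral_norm_bound[of lborel "{..x}" m] causal_set_integrable[OF m, of "{..x}" x]
    by (simp add: conv_heaviside)
  also have "\<dots> \<le> (LINT z:{..T}|lborel. \<bar>m z\<bar>)"
    unfolding set_lebesgue_integral_def
    using \<open>x \<le> T\<close> causal_set_integrable[OF m, of "{..x}" T, THEN set_integrable_abs]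
      causal_set_integrable[OF m, of "{..T}" T, THEN set_integrable_abs]
    by (intro integral_mono) (simp_all add: set_integrable_def indicator_def)
  finally show "\<bar>conv heaviside m x\<bar> \<le> (LINT z:{..T}|lborel. \<bar>m z\<bar>)" .
qed

text \<open>The Stieltjes measure of \<open>W\<close> is a point mass \<open>c\<close> at 0 plus the
  density \<open>v\<close>. Since \<open>conv heaviside v\<close> vanishes at 0, \<open>c\<close> is
  \<open>W 0\<close>.\<close>

definition has_density :: "(real \<Rightarrow> real) \<Rightarrow> real \<Rightarrow> (real \<Rightarrow> real) \<Rightarrow> bool" where
  "has_density W c v \<longleftrightarrow> causal 0 v \<and> (\<forall>x. W x = c * heaviside x + conv heaviside v x)"

lemma has_density_causal: 
  assumes "has_density W c v"
  shows "causal 0 W" "locally_bounded W"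
proof -
  have v: "causal 0 v" and W: "W = (\<lambda>x. c * heaviside x + conv heaviside v x)"
    using assms by (auto simp: has_density_def)
  show "causal 0 W"
    unfolding W using causal_conv[OF causal_heaviside v] by (intro causal_add causal_cmult causal_heaviside) simp
  show "locally_bounded W"
    unfolding W
    by (intro locally_bounded_add locally_bounded_cmult locally_bounded_heaviside locally_bounded_conv_heaviside[OF v])
qed

text \<open>Associativity, applied to \<open>heaviside\<close>, \<open>v\<close> and
  \<open>f\<close>, turns \<open>conv W f\<close> into an indefinite integral, whose integrand is
  \<open>f\<close> convolved with the Stieltjes measure of \<open>W\<close>.\<close>

lemma conv_has_density:
  assumes W: "has_density W c v" and f: "causal a f"
  shows "conv W f x = conv heaviside (\<lambda>y. c * f y + conv v f y) x"
proof -
  note H = causal_heaviside locally_bounded_heaviside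
  have v: "causal 0 v" and W': "W = (\<lambda>x. c * heaviside x + conv heaviside v x)"
    using W by (auto simp: has_density_def)
  have cH: "causal 0 (\<lambda>x. c * heaviside x)" "locally_bounded (\<lambda>x. c * heaviside x)"
    using causal_cmult[OF H(1)] locally_bounded_cmult[OF H(2)] by blast+
  have Hv: "causal 0 (conv heaviside v)"
    using causal_conv[OF causal_heaviside v] by simp
  have vf: "causal a (conv v f)" using causal_conv[OF v f] by simp
  have "conv W f x = conv (\<lambda>x. c * heaviside x) f x + conv (conv heaviside v) f x"
    unfolding W' by (rule conv_add_left[OF cH Hv locally_bounded_conv_heaviside[OF v] f])
  also have "\<dots> = conv heaviside (\<lambda>y. c * f y) x + conv heaviside (conv v f) x"
    by (simp add: conv_cmult_left conv_cmult_right conv_assoc[OF H v f])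
  also have "\<dots> = conv heaviside (\<lambda>y. c * f y + conv v f y) x"
    by (rule conv_add_right[OF H causal_cmult[OF f] vf, symmetric])
  finally show ?thesis .
qed

lemma causal_has_density_deriv:
  assumes W: "has_density W c v" and f: "causal a f"
  shows "causal a (\<lambda>y. c * f y + conv v f y)"
  using causal_conv[of 0 v a f] W f by (auto simp: has_density_def intro!: causal_add causal_cmult)

lemma AE_DERIV_conv:
  assumes W: "has_density W c v" and f: "causal a f"
  shows "AE x in lebesgue. (conv W f has_real_derivative c * f x + conv v f x) (at x)"
proof -
  have eq: "conv W f = conv heaviside (\<lambda>y. c * f y + conv v f y)"
    using conv_has_density[OF W f] by (rule ext)
  show ?thesis
    unfolding eq by (rule AE_DERIV_conv_heaviside[OF causal_has_density_deriv[OF W f]])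
qed

lemma causal_shift:
  assumes f: "causal a f"
  shows "causal (a + d) (\<lambda>x. f (x - d))"
  unfolding causal_def
proof (intro conjI allI impI)
  show "(\<lambda>x. f (x - d)) \<in> borel_measurable borel"
    using causal_measurable[OF f] by measurable
  show "f (x - d) = 0" if "x < a + d" for x
    using that causal_zero[OF f] by simp
  fix T
  have "integrable lborel (\<lambda>x. indicator {..T - d} (x - d) * f (x - d))"
    using lborel_integrable_real_affine[OF causal_truncation[OF f, of "T - d"], of 1 "-d"] by simp
  also have "(\<lambda>x. indicator {..T - d} (x - d) * f (x - d)) = (\<lambda>x. indicator {..T} x * f (x - d))"
    by (auto simp: indicator_def)
  finally show "set_integrable lborel {..T} (\<lambda>x. f (x - d))"
    by (simp add: set_integrable_def)
qed

lemma conv_shift: "conv f g (x - d) = conv f (\<lambda>x. g (x - d)) x"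
  unfolding conv_def
  using lborel_integral_real_affine[of 1 "\<lambda>y. f (x - y) * g (y - d)" d]
  by (simp add: algebra_simps)

lemma AE_lebesgue_neq: "AE x in lebesgue. x \<noteq> (a::real)"
  by (rule AE_I[of _ _ "{a}"]) auto

lemma AE_DERIV_has_density:
  assumes W: "has_density W c v"
  shows "AE x in lebesgue. ((\<lambda>x. W (x - d)) has_real_derivative v (x - d)) (at x)"
proof -
  have v: "causal 0 v"
    and W': "(\<lambda>x. W (x - d)) = (\<lambda>x. c * heaviside (x - d) + conv heaviside (\<lambda>x. v (x - d)) x)"
    using W by (auto simp: has_density_def conv_shift)
  from AE_DERIV_conv_heaviside[OF causal_shift[OF v, of d]] AE_lebesgue_neq[of d] show ?thesis
  proof eventually_elim
    case (elim x)
    have "\<forall>\<^sub>F y in nhds x. heaviside (x - d) = heaviside (y - d)"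
      using elim(2) eventually_nhds_in_open[of "{d<..}" x] eventually_nhds_in_open[of "{..<d}" x]
      by (cases "x > d") (auto elim!: eventually_mono simp: indicator_def)
    then have "((\<lambda>x. heaviside (x - d)) has_real_derivative 0) (at x)"
      by (rule DERIV_cong_ev[OF refl _ refl, THEN iffD1]) (rule DERIV_const)
    then show ?case
      unfolding W' using elim(1) by (auto intro!: derivative_eq_intros)
  qed
qed

section \<open>The integral equation\<close>

text \<open>The equation is posed with \<open>lebesgue\<close> and an arbitrary
  \<open>deriv\<close>, whereas convolutions use Borel functions. Measurability of \<open>F\<close>
  is not assumed: it follows from completeness of the measure.\<close>

lemma lebesgue_AE_eq_borel:
  fixes F h :: "real \<Rightarrow> real"
  assumes h: "h \<in> borel_measurable borel" and eq: "AE x in lebesgue. F x = h x"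
  shows "integrable lebesgue F \<longleftrightarrow> integrable lborel h" "(LINT x|lebesgue. F x) = (LINT x|lborel. h x)"
proof -
  have h': "h \<in> borel_measurable lebesgue" "h \<in> borel_measurable lborel"
    using h by (auto intro: measurable_completion)
  have F: "F \<in> borel_measurable lebesgue"
    by (rule borel_measurable_AE[OF h'(1)]) (use eq in eventually_elim, simp)
  show "integrable lebesgue F \<longleftrightarrow> integrable lborel h"
    using integrable_cong_AE[OF F h'(1) eq] integrable_completion[OF h'(2)] by simp
  show "(LINT x|lebesgue. F x) = (LINT x|lborel. h x)"
    using integral_cong_AE[OF F h'(1) eq] integral_completion[OF h'(2)] by simp
qed

lemma AE_lborel_lebesgue: "(AE x in lborel. P x) \<longleftrightarrow> (AE x in lebesgue. P x)"
  by (simp add: AE_completion_iff)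

lemma conv_lebesgue:
  assumes W: "causal 0 W" "locally_bounded W" and g: "causal a g"
    and eq: "AE y in lebesgue. y \<ge> a \<longrightarrow> G y = g y"
  shows "set_integrable lebesgue {a..x} (\<lambda>y. W (x - y) * G y)"
    and "(LINT y:{a..x}|lebesgue. W (x - y) * G y) = conv W g x"
proof -
  have h: "(\<lambda>y. W (x - y) * g y) \<in> borel_measurable borel"
    using causal_measurable[OF W(1)] causal_measurable[OF g] by measurable
  have eq': "AE y in lebesgue. indicator {a..x} y *\<^sub>R (W (x - y) * G y) = W (x - y) * g y"
    using eq
  proof eventually_elim
    case (elim y)
    then show ?case
      using causal_zero[OF W(1), of "x - y"] causal_zero[OF g, of y]
      by (cases "y < a"; cases "y > x") auto
  qed
  show "set_integrable lebesgue {a..x} (\<lambda>y. W (x - y) * G y)"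
    using lebesgue_AE_eq_borel(1)[OF h eq'] conv_integrable[OF W g] by (simp add: set_integrable_def)
  show "(LINT y:{a..x}|lebesgue. W (x - y) * G y) = conv W g x"
    using lebesgue_AE_eq_borel(2)[OF h eq'] by (simp add: set_lebesgue_integral_def conv_def)
qed

lemma refraction_rate_measurable [measurable]: "refraction_rate \<delta> b k \<in> borel_measurable borel"
  unfolding refraction_rate_def by measurable

lemma refraction_rate_bounds:
  assumes "\<And>i. i \<in> {1..k} \<Longrightarrow> 0 \<le> \<delta> i"
  shows "0 \<le> refraction_rate \<delta> b k x" "refraction_rate \<delta> b k x \<le> (\<Sum>i=1..k. \<delta> i)"
proof -
  show "0 \<le> refraction_rate \<delta> b k x"
    unfolding refraction_rate_def using assms by (intro sum_nonneg) auto
  have "\<delta> i * indicator {b i<..} x \<le> \<delta> i" if "i \<in> {1..k}" for i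
    using assms[OF that] by (simp add: indicator_def)
  then show "refraction_rate \<delta> b k x \<le> (\<Sum>i=1..k. \<delta> i)"
    unfolding refraction_rate_def by (rule sum_mono)
qed

lemma refraction_rate_Suc:
  "refraction_rate \<delta> b (Suc k) x = refraction_rate \<delta> b k x + \<delta> (Suc k) * indicator {b (Suc k)<..} x"
  by (simp add: refraction_rate_def)

text \<open>
  With \<open>\<mu>\<^sub>j\<close> the Stieltjes measure of \<open>W j\<close> and \<open>\<chi>\<close> the indicator of \<open>{b (j + 1)<..}\<close>, the
  derivatives \<open>g\<^sub>j\<close> of the functions \<open>refracted_w W \<delta> b d j\<close> satisfy
  \<open>g\<^sub>j\<^sub>+\<^sub>1 = g\<^sub>j + \<delta> (j + 1) \<mu>\<^sub>j\<^sub>+\<^sub>1 * (\<chi> g\<^sub>j)\<close>. The added term \<open>m\<close> vanishes up to \<open>b (j + 1)\<close>, beyond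
  which the refraction rate is constant, so that \<open>resolvent\<close> applies to \<open>W 0 * m\<close>.
\<close>

lemma refracted_w_representation:
  assumes W: "\<And>j. j \<le> k \<Longrightarrow> has_density (W j) (c j) (v j)"
    and resolvent: "\<And>j x. 1 \<le> j \<Longrightarrow> j \<le> k \<Longrightarrow>
      W j x - W 0 x = (\<Sum>i=1..j. \<delta> i) * (c j * W 0 x + conv (W 0) (v j) x)"
    and \<delta>: "\<And>i. i \<in> {1..k} \<Longrightarrow> 0 \<le> \<delta> i"
    and b: "mono_on {1..k} b" and d: "\<And>i. i \<in> {1..k} \<Longrightarrow> d < b i"
    and "j \<le> k"
  shows "\<exists>g. causal d g \<and>
    (AE x in lebesgue. (refracted_w W \<delta> b d j has_real_derivative g x) (at x)) \<and>
    (\<forall>x. refracted_w W \<delta> b d j x = W 0 (x - d) + conv (W 0) (\<lambda>y. refraction_rate \<delta> b j y * g y) x)"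
  using \<open>j \<le> k\<close>
proof (induction j)
  case 0
  have "causal 0 (v 0)"
    using W[of 0] by (simp add: has_density_def)
  from causal_shift[OF this, of d] AE_DERIV_has_density[OF W[of 0], of d] show ?case
    by (intro exI[of _ "\<lambda>x. v 0 (x - d)"]) (simp add: refraction_rate_def conv_def)
next
  case (Suc j)
  then obtain g where g: "causal d g"
    and g': "AE x in lebesgue. (refracted_w W \<delta> b d j has_real_derivative g x) (at x)"
    and rep: "\<And>x. refracted_w W \<delta> b d j x
      = W 0 (x - d) + conv (W 0) (\<lambda>y. refraction_rate \<delta> b j y * g y) x"
    by auto
  let ?w = "refracted_w W \<delta> b d" and ?B = "b (Suc j)" and ?J = "Suc j" and ?D = "\<Sum>i=1..Suc j. \<delta> i"
  let ?phi = "refraction_rate \<delta> b"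
  have dB: "d < ?B" and \<delta>J: "0 \<le> \<delta> ?J"
    using d[of ?J] \<delta>[of ?J] Suc.prems by auto
  note WJ = W[OF Suc.prems] and W0 = W[of 0, OF le0]
  note cW0 = has_density_causal[OF W0] and cWJ = has_density_causal[OF WJ]
  \<comment> \<open>The indicator is strict, as in the refraction rate; the recursion integrates
    from \<open>?B\<close> inclusive, which differs by a null set.\<close>
  define f where "f y = indicator {?B<..} y * g y" for y
  define m where "m y = c ?J * f y + conv (v ?J) f y" for y
  have "causal d f"
    unfolding f_def using g by (rule causal_bounded_mult[where C = 1]) (auto simp: indicator_def)
  then have f: "causal ?B f"
    by (simp add: causal_def f_def)
  have v: "causal 0 (v ?J)"
    using WJ by (simp add: has_density_def)
  have m: "causal ?B m"
    unfolding m_def by (rule causal_has_density_deriv[OF WJ f])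
  have md: "causal d m"
    using causal_mono[OF m] dB by simp
  have rec: "?w ?J x = ?w j x + \<delta> ?J * conv (W ?J) f x" for x
  proof -
    have "AE y in lebesgue. y \<ge> ?B \<longrightarrow> deriv (?w j) y = f y"
      using g' AE_lebesgue_neq[of ?B]
      by eventually_elim (auto simp: f_def DERIV_imp_deriv)
    from conv_lebesgue(2)[OF cWJ f this] show ?thesis
      by simp
  qed
  have phi: "\<bar>?phi l y\<bar> \<le> (\<Sum>i=1..k. \<delta> i)" if "l \<le> k" for l y
  proof -
    have "(\<Sum>i=1..l. \<delta> i) \<le> (\<Sum>i=1..k. \<delta> i)"
      using that \<delta> by (intro sum_mono2) auto
    moreover have "0 \<le> ?phi l y" "?phi l y \<le> (\<Sum>i=1..l. \<delta> i)"
      using refraction_rate_bounds[of l \<delta> b y] \<delta> that by auto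
    ultimately show ?thesis by simp
  qed
  have cphi: "causal d (\<lambda>y. ?phi l y * h y)" if "l \<le> k" "causal d h" for l h
    by (rule causal_bounded_mult[OF that(2) _ phi[OF that(1)]]) simp
  define g1 where "g1 y = g y + \<delta> ?J * m y" for y
  have g1: "causal d g1"
    unfolding g1_def by (intro causal_add g causal_cmult md)
  have "AE x in lebesgue. (?w ?J has_real_derivative g1 x) (at x)"
    using g' AE_DERIV_conv[OF WJ f]
  proof eventually_elim
    case (elim x)
    have "?w ?J = (\<lambda>x. ?w j x + \<delta> ?J * conv (W ?J) f x)"
      using rec by (rule ext)
    then show ?case
      using elim by (auto intro!: derivative_eq_intros simp: g1_def m_def)
  qed
  moreover have "?w ?J x = W 0 (x - d) + conv (W 0) (\<lambda>y. ?phi ?J y * g1 y) x" for x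
  proof -
    have phim: "AE y in lborel. ?phi ?J y * m y = ?D * m y"
    proof -
      have *: "?phi ?J y * m y = ?D * m y" if "y \<noteq> ?B" for y
      proof (cases "y < ?B")
        case True
        then show ?thesis using causal_zero[OF m] by simp
      next
        case False
        have "b i \<le> ?B" if "i \<in> {1..?J}" for i
          using mono_onD[OF b, of i ?J] that Suc.prems by auto
        then have "b i < y" if "i \<in> {1..?J}" for i
          using that False \<open>y \<noteq> ?B\<close> by fastforce
        then have "?phi ?J y = ?D"
          unfolding refraction_rate_def by (intro sum.cong) auto
        then show ?thesis by simp
      qed
      show ?thesis
        unfolding AE_lborel_lebesgue using AE_lebesgue_neq[of ?B] by eventually_elim (rule *)
    qed
    have "conv (W 0) (\<lambda>y. ?phi ?J y * g1 y) x
        = conv (W 0) (\<lambda>y. ?phi ?J y * g y + \<delta> ?J * (?phi ?J y * m y)) x"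
      by (simp add: g1_def algebra_simps)
    also have "\<dots> = conv (W 0) (\<lambda>y. ?phi ?J y * g y) x + \<delta> ?J * conv (W 0) (\<lambda>y. ?phi ?J y * m y) x"
      using conv_add_right[OF cW0 cphi[OF Suc.prems g] causal_cmult[OF cphi[OF Suc.prems md]]]
      by (simp add: conv_cmult_right)
    also have "conv (W 0) (\<lambda>y. ?phi ?J y * m y) x = conv (W 0) (\<lambda>y. ?D * m y) x"
      using causal_measurable[OF cW0(1)] causal_measurable[OF md]
      by (intro conv_cong_AE phim borel_measurable_times) simp_all
    also have "\<dots> = conv (W ?J) f x - conv (W 0) f x"
    proof -
      have "conv (W 0) m x = c ?J * conv (W 0) f x + conv (conv (W 0) (v ?J)) f x"
        unfolding m_def
        using conv_add_right[OF cW0 causal_cmult[OF f] causal_conv[OF v f]] conv_assoc[OF cW0 v f]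
        by (simp add: conv_cmult_right)
      moreover have "conv (W ?J) f x
          = conv (W 0) f x + ?D * (c ?J * conv (W 0) f x + conv (conv (W 0) (v ?J)) f x)"
      proof -
        have WJ_eq: "W ?J = (\<lambda>y. W 0 y + (?D * c ?J * W 0 y + ?D * conv (W 0) (v ?J) y))"
          using resolvent[of ?J] Suc.prems by (intro ext) (simp add: algebra_simps)
        have W0v: "causal 0 (conv (W 0) (v ?J))" "locally_bounded (conv (W 0) (v ?J))"
          using causal_conv[OF cW0(1) v] locally_bounded_conv_heaviside[OF causal_has_density_deriv[OF W0 v]]
            ext[of "conv (W 0) (v ?J)", OF conv_has_density[OF W0 v]] by simp_all
        show ?thesis
          unfolding WJ_eq
          using conv_add_left[OF cW0 causal_add[OF causal_cmult[OF cW0(1)] causal_cmult[OF W0v(1)]]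
              locally_bounded_add[OF locally_bounded_cmult[OF cW0(2)] locally_bounded_cmult[OF W0v(2)]] f]
            conv_add_left[OF causal_cmult[OF cW0(1)] locally_bounded_cmult[OF cW0(2)]
              causal_cmult[OF W0v(1)] locally_bounded_cmult[OF W0v(2)] f]
          by (simp only: conv_cmult_left) (simp add: algebra_simps)
      qed
      ultimately show ?thesis
        by (simp only: conv_cmult_right)
    qed
    \<comment> \<open>The new refraction term contributes
      \<open>\<delta> ?J * conv (W 0) f x\<close>, which cancels the negative term left by the
      resolvent; \<open>\<delta> ?J * conv (W ?J) f x\<close> of the recursion remains.\<close>
    also have "conv (W 0) (\<lambda>y. ?phi ?J y * g y) x
        = conv (W 0) (\<lambda>y. ?phi j y * g y) x + \<delta> ?J * conv (W 0) f x"
    proof -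
      have "conv (W 0) (\<lambda>y. ?phi ?J y * g y) x = conv (W 0) (\<lambda>y. ?phi j y * g y + \<delta> ?J * f y) x"
        by (simp add: refraction_rate_Suc f_def algebra_simps)
      also have "\<dots> = conv (W 0) (\<lambda>y. ?phi j y * g y) x + \<delta> ?J * conv (W 0) f x"
        using conv_add_right[OF cW0 cphi[OF _ g] causal_cmult[OF f], of j] Suc.prems
        by (simp add: conv_cmult_right)
      finally show ?thesis .
    qed
    finally show ?thesis
      unfolding rec rep by (simp add: algebra_simps)
  qed
  ultimately show ?case
    using g1 by blast
qed

section \<open>Uniqueness for the Volterra equation\<close>

lemma integral_conv:
  assumes f: "integrable lborel f" and g: "integrable lborel g"
  shows "integrable lborel (conv f g)" "(LINT x|lborel. conv f g x) = (LINT x|lborel. f x) * (LINT x|lborel. g x)"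
proof -
  note shear = integrable_shear[OF f g]
  show "integrable lborel (conv f g)"
    using lborel_pair.integrable_fst'[OF shear] by (simp add: conv_def[abs_def])
  have "(LINT x|lborel. conv f g x) = (LINT y|lborel. LINT x|lborel. f (x - y) * g y)"
    unfolding conv_def using lborel_pair.Fubini_integral[of "\<lambda>x y. f (x - y) * g y"] shear by simp
  also have "\<dots> = (LINT y|lborel. (LINT x|lborel. f x) * g y)"
  proof (rule Bochner_Integration.integral_cong)
    fix y
    show "(LINT x|lborel. f (x - y) * g y) = (LINT x|lborel. f x) * g y"
      using lborel_integral_real_affine[of 1 f "-y"] by simp
  qed simp
  also have "\<dots> = (LINT x|lborel. f x) * (LINT x|lborel. g x)"
    by simp
  finally show "(LINT x|lborel. conv f g x) = (LINT x|lborel. f x) * (LINT x|lborel. g x)" .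
qed

lemma causal_abs: "causal a f \<Longrightarrow> causal a (\<lambda>x. \<bar>f x\<bar>)"
  by (auto simp: causal_def intro: set_integrable_abs)

text \<open>As \<open>e\<close> starts at \<open>S\<close>, on a window of length
  \<open>\<eta>\<close> only the part of \<open>v\<close> up to \<open>\<eta>\<close> enters.
  Integrating gives \<open>I \<le> C * V * I\<close> for the mass \<open>I\<close> of
  \<open>e\<close> on the window and the mass \<open>V\<close> of that part;
  \<open>C * V < 1\<close> forces \<open>I = 0\<close>.\<close>

lemma volterra_step:
  assumes v: "causal 0 v" and e: "causal S e" and \<eta>: "0 \<le> \<eta>"
    and small: "C * (LINT x:{..\<eta>}|lborel. \<bar>v x\<bar>) < 1"
    and C: "0 \<le> C"
    and ineq: "AE x in lborel. \<bar>e x\<bar> \<le> C * conv (\<lambda>x. \<bar>v x\<bar>) (\<lambda>x. \<bar>e x\<bar>) x"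
  shows "AE x in lborel. x \<le> S + \<eta> \<longrightarrow> e x = 0"
proof -
  let ?v = "\<lambda>x. indicator {..\<eta>} x * \<bar>v x\<bar>" and ?e = "\<lambda>x. indicator {..S + \<eta>} x * \<bar>e x\<bar>"
  let ?I = "LINT x|lborel. ?e x" and ?V = "LINT x|lborel. ?v x"
  have iv: "integrable lborel ?v" and ie: "integrable lborel ?e"
    using causal_truncation[OF causal_abs[OF v]] causal_truncation[OF causal_abs[OF e]] by auto
  have "?I \<le> (LINT x|lborel. C * conv ?v ?e x)"
  proof (rule integral_mono_AE[OF ie])
    show "integrable lborel (\<lambda>x. C * conv ?v ?e x)"
      using integral_conv(1)[OF iv ie] by simp
    show "AE x in lborel. ?e x \<le> C * conv ?v ?e x"
      using ineq
    proof eventually_elim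
      case (elim x)
      have "0 \<le> conv ?v ?e x"
        unfolding conv_def by (intro integral_nonneg_AE) auto
      moreover have "conv (\<lambda>x. \<bar>v x\<bar>) (\<lambda>x. \<bar>e x\<bar>) x = conv ?v ?e x" if "x \<le> S + \<eta>"
        using conv_truncation[OF causal_abs[OF v] causal_abs[OF e] that] by simp
      ultimately show ?case
        using elim C by (cases "x \<le> S + \<eta>") auto
    qed
  qed
  also have "\<dots> = C * ?V * ?I"
    using integral_conv(2)[OF iv ie] by simp
  finally have "?I * (1 - C * ?V) \<le> 0"
    by (simp add: algebra_simps)
  moreover have "C * ?V < 1"
    using small by (simp add: set_lebesgue_integral_def)
  moreover have "0 \<le> ?I"
    by (intro integral_nonneg_AE) auto
  ultimately have "?I = 0"
    by (simp add: mult_le_0_iff)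
  then have "AE x in lborel. ?e x = 0"
    using integral_nonneg_eq_0_iff_AE[OF ie] by simp
  then show ?thesis
    by eventually_elim (auto simp: indicator_def split: if_splits)
qed

text \<open>The window length depends on \<open>v\<close> and \<open>C\<close> only; it exists
  because the integral of \<open>\<bar>v\<bar>\<close> up to \<open>x\<close> tends to 0 as
  \<open>x\<close> decreases to 0. Hence finitely many windows of equal length reach any
  point.\<close>

lemma volterra_AE_zero:
  assumes v: "causal 0 v" and e: "causal d e" and C: "0 \<le> C"
    and ineq: "AE x in lborel. \<bar>e x\<bar> \<le> C * conv (\<lambda>x. \<bar>v x\<bar>) (\<lambda>x. \<bar>e x\<bar>) x"
  shows "AE x in lborel. e x = 0"
proof -
  let ?V = "conv heaviside (\<lambda>x. \<bar>v x\<bar>)"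
  have [measurable]: "v \<in> borel_measurable borel" "e \<in> borel_measurable borel"
    using causal_measurable v e by blast+
  have "?V 0 = 0"
  proof -
    have "AE x in lborel. x \<noteq> (0::real)"
      unfolding AE_lborel_lebesgue by (rule AE_lebesgue_neq)
    then have "AE x in lborel. indicator {..0} x *\<^sub>R \<bar>v x\<bar> = 0"
      by eventually_elim (use causal_zero[OF v] in \<open>auto simp: indicator_def\<close>)
    then show ?thesis
      unfolding conv_heaviside set_lebesgue_integral_def by (rule integral_eq_zero_AE)
  qed
  then have "((\<lambda>x. C * ?V x) \<longlongrightarrow> 0) (at_right 0)"
    using continuous_on_conv_heaviside[OF causal_abs[OF v]]
    by (auto simp: continuous_on_eq_continuous_at continuous_at_imp_continuous_at_within
        dest!: spec[of _ 0] intro!: tendsto_eq_intros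
        elim!: continuous_within[THEN iffD1, OF continuous_at_imp_continuous_at_within, THEN tendsto_cong[THEN iffD1, rotated]])
  then have "\<forall>\<^sub>F x in at_right 0. C * ?V x < 1"
    by (rule order_tendstoD) simp
  then obtain \<eta> where \<eta>: "0 < \<eta>" "C * ?V \<eta> < 1"
    unfolding eventually_at_right_field using dense by blast
  have "AE x in lborel. x \<le> d + real n * \<eta> \<longrightarrow> e x = 0" for n
  proof (induction n)
    case 0
    have "AE x in lborel. x \<noteq> d"
      unfolding AE_lborel_lebesgue by (rule AE_lebesgue_neq)
    then show ?case
      by eventually_elim (use causal_zero[OF e] in auto)
  next
    case (Suc n)
    let ?S = "d + real n * \<eta>"
    \<comment> \<open>So far \<open>e\<close> vanishes only almost everywhere up to
      \<open>?S\<close>; cutting it off there makes it exactly causal.\<close>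
    define e' where "e' x = indicator {?S<..} x * e x" for x
    have ee': "AE x in lborel. e' x = e x"
      using Suc by eventually_elim (auto simp: e'_def indicator_def)
    have "causal d e'"
      unfolding e'_def by (rule causal_bounded_mult[OF e, where C = 1]) auto
    then have e': "causal ?S e'"
      by (simp add: causal_def e'_def)
    have [measurable]: "e' \<in> borel_measurable borel"
      using causal_measurable[OF e'] .
    have *: "conv (\<lambda>x. \<bar>v x\<bar>) (\<lambda>x. \<bar>e' x\<bar>) x = conv (\<lambda>x. \<bar>v x\<bar>) (\<lambda>x. \<bar>e x\<bar>) x" for x
      by (rule conv_cong_AE) (use ee' in \<open>auto elim: eventually_mono\<close>)
    have "AE x in lborel. \<bar>e' x\<bar> \<le> C * conv (\<lambda>x. \<bar>v x\<bar>) (\<lambda>x. \<bar>e' x\<bar>) x"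
      using ineq ee' by eventually_elim (simp add: *)
    with volterra_step[OF v e' _ _ C, of \<eta>] \<eta> have "AE x in lborel. x \<le> ?S + \<eta> \<longrightarrow> e' x = 0"
      by (simp add: conv_heaviside)
    with ee' show ?case
      by eventually_elim (auto simp: algebra_simps)
  qed
  then have "AE x in lborel. \<forall>n. x \<le> d + real n * \<eta> \<longrightarrow> e x = 0"
    unfolding AE_all_countable by blast
  then show ?thesis
  proof eventually_elim
    case (elim x)
    obtain n where "(x - d) / \<eta> \<le> real n"
      using real_arch_simple by blast
    then show ?case
      using elim \<eta> by (auto simp: field_simps)
  qed
qed

text \<open>
  A solution is not assumed to have a locally integrable derivative. But the integrals in the
  equation exist for all \<open>x\<close>, and \<open>W\<close> is bounded away from 0 on some interval; translates of
  this interval cover every bounded set.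
\<close>

lemma solution_locally_integrable:
  assumes W: "has_density W c v" and z: "W z \<noteq> 0"
    and int: "\<And>x. set_integrable lebesgue {d..x} (\<lambda>y. W (x - y) * F y)"
  shows "\<exists>f. causal d f \<and> (AE y in lebesgue. y \<ge> d \<longrightarrow> F y = f y)"
proof -
  have [measurable]: "W \<in> borel_measurable borel"
    using has_density_causal(1)[OF W] by (rule causal_measurable)
  have z0: "0 \<le> z"
    using causal_zero[OF has_density_causal(1)[OF W], of z] z by linarith
  have v: "causal 0 v"
    using W by (simp add: has_density_def)
  \<comment> \<open>Only a right neighbourhood of \<open>z\<close> is used, since \<open>z\<close>
    may be 0, where \<open>W\<close> can jump.\<close>
  have "continuous_on {z..} (\<lambda>x. c + conv heaviside v x)"
    using continuous_on_subset[OF continuous_on_conv_heaviside[OF v]] by (intro continuous_intros) auto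
  then have "continuous_on {z..} W"
    by (rule continuous_on_eq) (use W z0 in \<open>auto simp: has_density_def\<close>)
  then have "(W \<longlongrightarrow> W z) (at z within {z..})"
    by (simp add: continuous_on_def)
  then have "((\<lambda>x. \<bar>W x\<bar>) \<longlongrightarrow> \<bar>W z\<bar>) (at z within {z..})"
    by (rule tendsto_rabs)
  then have "\<forall>\<^sub>F x in at z within {z..}. \<bar>W z\<bar> / 2 < \<bar>W x\<bar>"
    using z by (intro order_tendstoD(1)[of _ "\<bar>W z\<bar>"]) auto
  then obtain l where l: "0 < l" "\<And>x. x \<in> {z..} \<Longrightarrow> x \<noteq> z \<Longrightarrow> dist x z < l \<Longrightarrow> \<bar>W z\<bar> / 2 < \<bar>W x\<bar>"
    unfolding eventually_at by auto
  define r where "r = l / 2"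
  have r: "0 < r" "\<bar>W z\<bar> / 2 \<le> \<bar>W x\<bar>" if "x \<in> {z..z + r}" for x
    using l that z by (cases "x = z"; force simp: r_def dist_real_def)+
  have r0: "0 < r"
    using l by (simp add: r_def)
  define A where "A n = {d + real n * r..d + real n * r + r}" for n
  have A: "set_integrable lebesgue (A n) F" for n
  proof -
    \<comment> \<open>For \<open>y\<close> in \<open>A n\<close> the argument \<open>?x - y\<close>
      stays in \<open>{z..z + r}\<close>, where \<open>W\<close> is bounded away from 0.\<close>
    let ?x = "d + real n * r + z + r"
    let ?p = "\<lambda>y. indicator (A n) y / W (?x - y)"
    have p: "\<bar>?p y\<bar> \<le> 2 / \<bar>W z\<bar>" for y
    proof (cases "y \<in> A n")
      case True
      then have "\<bar>W z\<bar> / 2 \<le> \<bar>W (?x - y)\<bar>"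
        using r by (auto simp: A_def)
      then show ?thesis
        using True z by (auto simp: field_simps)
    qed simp
    have [measurable]: "?p \<in> borel_measurable borel"
      unfolding A_def by measurable
    let ?G = "\<lambda>y. indicator {d..?x} y *\<^sub>R (W (?x - y) * F y)"
    have G: "integrable lebesgue ?G"
      using int[of ?x] by (simp add: set_integrable_def)
    have "integrable lebesgue (\<lambda>y. ?p y * ?G y)"
    proof (rule Bochner_Integration.integrable_bound)
      show "integrable lebesgue (\<lambda>y. (2 / \<bar>W z\<bar>) * ?G y)"
        using G by simp
      show "(\<lambda>y. ?p y * ?G y) \<in> borel_measurable lebesgue"
        by (intro borel_measurable_times measurable_completion borel_measurable_integrable[OF G]) simp
      show "AE y in lebesgue. norm (?p y * ?G y) \<le> norm ((2 / \<bar>W z\<bar>) * ?G y)"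
        unfolding real_norm_def abs_mult[of "?p _"] abs_mult[of "2 / \<bar>W z\<bar>"]
        by (intro AE_I2 mult_right_mono order_trans[OF p abs_ge_self]) simp
    qed
    also have "(\<lambda>y. ?p y * ?G y) = (\<lambda>y. indicator (A n) y *\<^sub>R F y)"
    proof
      fix y
      show "?p y * ?G y = indicator (A n) y *\<^sub>R F y"
      proof (cases "y \<in> A n")
        case True
        then have "\<bar>W z\<bar> / 2 \<le> \<bar>W (?x - y)\<bar>"
          using r by (auto simp: A_def)
        then have "W (?x - y) \<noteq> 0"
          using z by auto
        moreover have "0 \<le> real n * r"
          using r0 by simp
        then have "y \<in> {d..?x}"
          using True z0 r0 unfolding A_def atLeastAtMost_iff by linarith
        ultimately show ?thesis
          using True by simp
      qed simp
    qed
    finally show ?thesis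
      by (simp add: set_integrable_def)
  qed
  have int': "set_integrable lebesgue {d..T} F" for T
  proof -
    obtain N where N: "(T - d) / r \<le> real N"
      using real_arch_simple by blast
    have "set_integrable lebesgue (\<Union>n<Suc N. A n) F"
      by (rule set_integrable_UN) (use A in \<open>auto simp: A_def\<close>)
    moreover have "{d..T} \<subseteq> (\<Union>n<Suc N. A n)"
    proof
      fix y assume y: "y \<in> {d..T}"
      let ?n = "nat \<lfloor>(y - d) / r\<rfloor>"
      have "0 \<le> (y - d) / r" using y r0 by simp
      then have n: "real ?n \<le> (y - d) / r" "(y - d) / r \<le> real ?n + 1"
        by linarith+
      have "(y - d) / r \<le> (T - d) / r"
        using y r0 by (intro divide_right_mono) auto
      then have "?n < Suc N"
        using n N by linarith
      moreover have "y \<in> A ?n"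
        using n r0 by (auto simp: A_def field_simps)
      ultimately show "y \<in> (\<Union>n<Suc N. A n)" by blast
    qed
    moreover have "{d..T} \<in> sets lebesgue" by simp
    ultimately show ?thesis
      by (metis set_integrable_subset)
  qed
  let ?F = "\<lambda>y. indicator {d..} y * F y"
  have "?F \<in> borel_measurable lebesgue"
  proof (rule borel_measurable_LIMSEQ_real)
    show "(\<lambda>y. indicator {d..real n} y * F y) \<in> borel_measurable lebesgue" for n
      using int'[of n] by (auto simp: set_integrable_def)
    fix y
    have "\<forall>\<^sub>F n in sequentially. indicator {d..real n} y * F y = ?F y"
      using eventually_ge_at_top[of "nat \<lceil>y\<rceil>"]
    proof eventually_elim
      case (elim n)
      then have "y \<le> real n" by linarith
      then show ?case by (auto simp: indicator_def)
    qed
    then show "(\<lambda>n. indicator {d..real n} y * F y) \<longlonglongrightarrow> ?F y"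
      by (rule tendsto_eventually)
  qed
  then obtain f0 where f0: "f0 \<in> borel_measurable lborel" "AE y in lborel. ?F y = f0 y"
    using completion_ex_borel_measurable_real by blast
  define f where "f y = indicator {d..} y * f0 y" for y
  have f_m: "f \<in> borel_measurable borel"
    unfolding f_def using f0(1) by measurable
  have eq: "AE y in lebesgue. ?F y = f y"
    using f0(2) unfolding AE_lborel_lebesgue by eventually_elim (auto simp: f_def indicator_def)
  have "set_integrable lborel {..T} f" for T
  proof -
    have "AE y in lebesgue. indicator {d..T} y *\<^sub>R F y = indicator {..T} y * f y"
      using eq by eventually_elim (auto simp: f_def indicator_def)
    from lebesgue_AE_eq_borel(1)[OF _ this] int'[of T] f_m show ?thesis
      by (simp add: set_integrable_def)
  qed
  then have "causal d f"
    using f_m by (simp add: causal_def f_def)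
  moreover have "AE y in lebesgue. y \<ge> d \<longrightarrow> F y = f y"
    using eq by eventually_elim auto
  ultimately show ?thesis by blast
qed

text \<open>\<open>f\<close> stands for the product of \<open>\<phi>\<close> and the derivative. As
  it is locally integrable, the equation can be differentiated almost everywhere, and substituting
  the result for the derivative gives a fixed point equation in \<open>f\<close> alone.\<close>

lemma solution_representation:
  assumes W: "has_density W c v" and z: "W z \<noteq> 0"
    and [measurable]: "\<phi> \<in> borel_measurable borel" and \<phi>: "\<And>x. \<bar>\<phi> x\<bar> \<le> C"
    and u: "is_solution W \<phi> d u"
  shows "\<exists>f. causal d f \<and> (\<forall>x. u x = W (x - d) + conv W f x) \<and>
    (AE x in lebesgue. f x = \<phi> x * (v (x - d) + (c * f x + conv v f x)))"
proof -
  have v: "causal 0 v"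
    using W by (simp add: has_density_def)
  note cW = has_density_causal[OF W]
  have int: "set_integrable lebesgue {d..x} (\<lambda>y. W (x - y) * (\<phi> y * deriv u y))"
    and eq: "u x = W (x - d) + (LINT y:{d..x}|lebesgue. W (x - y) * (\<phi> y * deriv u y))" for x
    using u by (auto simp: is_solution_def mult.assoc)
  obtain f where f: "causal d f" and Ff: "AE y in lebesgue. y \<ge> d \<longrightarrow> \<phi> y * deriv u y = f y"
    using solution_locally_integrable[OF W z int] by blast
  have rep: "u x = W (x - d) + conv W f x" for x
    using eq conv_lebesgue(2)[OF cW f Ff] by simp
  have "AE x in lebesgue. f x = \<phi> x * (v (x - d) + (c * f x + conv v f x))"
    using Ff AE_DERIV_has_density[OF W, of d] AE_DERIV_conv[OF W f]
  proof eventually_elim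
    case (elim x)
    have "u = (\<lambda>x. W (x - d) + conv W f x)"
      using rep by (rule ext)
    then have "(u has_real_derivative v (x - d) + (c * f x + conv v f x)) (at x)"
      using elim(2,3) by (auto intro!: derivative_eq_intros)
    then have "deriv u x = v (x - d) + (c * f x + conv v f x)"
      by (rule DERIV_imp_deriv)
    then show ?case
      using elim(1) causal_zero[OF f, of x] causal_zero[OF v, of "x - d"]
        causal_zero[OF causal_conv[OF v f], of x]
      by (cases "x < d") auto
  qed
  with f rep show ?thesis by blast
qed

text \<open>For the difference \<open>e\<close> of two such \<open>f\<close> the inhomogeneous terms
  cancel; moving the point mass term to the left, with factor \<open>1 - c * C\<close>, leaves a
  Volterra inequality. Almost everywhere equal \<open>f\<close> give solutions equal everywhere,
  because \<open>f\<close> enters through a convolution only.\<close>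

lemma solution_unique:
  assumes W: "has_density W c v" and z: "W z \<noteq> 0"
    and \<phi>m: "\<phi> \<in> borel_measurable borel" and \<phi>: "\<And>x. 0 \<le> \<phi> x" "\<And>x. \<phi> x \<le> C"
    and c: "0 \<le> c" "c * C < 1"
    and u: "is_solution W \<phi> d u" and u': "is_solution W \<phi> d u'"
  shows "u = u'"
proof
  fix x
  have \<phi>': "\<bar>\<phi> x\<bar> \<le> C" for x
    using \<phi>[of x] by simp
  have C: "0 \<le> C"
    using \<phi>[of 0] by linarith
  have v: "causal 0 v"
    using W by (simp add: has_density_def)
  note cW = has_density_causal[OF W]
  obtain f where f: "causal d f" "\<And>x. u x = W (x - d) + conv W f x"
    "AE x in lebesgue. f x = \<phi> x * (v (x - d) + (c * f x + conv v f x))"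
    using solution_representation[OF W z \<phi>m \<phi>' u] by (elim exE conjE) (rule that, auto)
  obtain f' where f': "causal d f'" "\<And>x. u' x = W (x - d) + conv W f' x"
    "AE x in lebesgue. f' x = \<phi> x * (v (x - d) + (c * f' x + conv v f' x))"
    using solution_representation[OF W z \<phi>m \<phi>' u'] by (elim exE conjE) (rule that, auto)
  have nf': "causal d (\<lambda>x. - f' x)"
    using causal_cmult[OF f'(1), of "-1"] by simp
  define e where "e x = f x + - f' x" for x
  have e: "causal d e"
    unfolding e_def by (rule causal_add[OF f(1) nf'])
  have [measurable]: "e \<in> borel_measurable borel" "v \<in> borel_measurable borel"
    using causal_measurable e v by blast+
  \<comment> \<open>\<open>v\<close> need not be locally bounded, so \<open>conv v\<close> is linear
    only at the points where the integrals converge. Countably many truncations show that these are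
    almost all.\<close>
  have int_AE: "AE x in lborel. integrable lborel (\<lambda>y. v (x - y) * g y)" if g: "causal d g" for g
  proof -
    have "AE x in lborel. x \<le> real n \<longrightarrow> integrable lborel (\<lambda>y. v (x - y) * g y)" for n
    proof -
      let ?v = "\<lambda>x. indicator {..real n - d} x * v x" and ?g = "\<lambda>x. indicator {..real n - 0} x * g x"
      have "AE x in lborel. integrable lborel (\<lambda>y. ?v (x - y) * ?g y)"
        using lborel_pair.AE_integrable_fst'[OF integrable_shear[OF causal_truncation[OF v] causal_truncation[OF g]]]
        by simp
      then show ?thesis
      proof eventually_elim
        case (elim x)
        show ?case
        proof
          assume "x \<le> real n"
          then have "(\<lambda>y. ?v (x - y) * ?g y) = (\<lambda>y. v (x - y) * g y)"
            using causal_zero[OF v] causal_zero[OF g] by (fastforce simp: indicator_def)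
          then show "integrable lborel (\<lambda>y. v (x - y) * g y)"
            using elim by simp
        qed
      qed
    qed
    then have "AE x in lborel. \<forall>n. x \<le> real n \<longrightarrow> integrable lborel (\<lambda>y. v (x - y) * g y)"
      unfolding AE_all_countable by blast
    then show ?thesis
      by eventually_elim (use real_arch_simple in blast)
  qed
  have "AE x in lborel. \<bar>e x\<bar> \<le> C / (1 - c * C) * conv (\<lambda>x. \<bar>v x\<bar>) (\<lambda>x. \<bar>e x\<bar>) x"
    using f(3)[folded AE_lborel_lebesgue] f'(3)[folded AE_lborel_lebesgue] int_AE[OF f(1)] int_AE[OF f'(1)]
  proof eventually_elim
    case (elim x)
    have ce: "conv v e x = conv v f x - conv v f' x"
      unfolding conv_def e_def using elim(3,4) by (simp add: algebra_simps)
    have "e x = \<phi> x * (c * e x + conv v e x)"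
      unfolding ce e_def using elim(1,2) by (simp add: algebra_simps)
    then have "\<bar>e x\<bar> = \<phi> x * \<bar>c * e x + conv v e x\<bar>"
      using \<phi>(1)[of x] by (metis abs_mult abs_of_nonneg)
    also have "\<dots> \<le> C * (c * \<bar>e x\<bar> + \<bar>conv v e x\<bar>)"
      using \<phi>[of x] c C abs_triangle_ineq[of "c * e x" "conv v e x"]
      by (intro mult_mono) (auto simp: abs_mult)
    finally have 1: "\<bar>e x\<bar> * (1 - c * C) \<le> C * \<bar>conv v e x\<bar>"
      by (simp add: algebra_simps)
    have "\<bar>conv v e x\<bar> \<le> (LINT y|lborel. \<bar>v (x - y) * e y\<bar>)"
      unfolding conv_def by (rule integral_abs_bound)
    also have "\<dots> = conv (\<lambda>x. \<bar>v x\<bar>) (\<lambda>x. \<bar>e x\<bar>) x"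
      by (simp add: conv_def abs_mult)
    finally have "\<bar>e x\<bar> * (1 - c * C) \<le> C * conv (\<lambda>x. \<bar>v x\<bar>) (\<lambda>x. \<bar>e x\<bar>) x"
      using 1 C by (meson mult_left_mono order_trans)
    then show ?case
      using c(2) by (simp add: pos_le_divide_eq)
  qed
  then have "AE x in lborel. e x = 0"
    by (rule volterra_AE_zero[OF v e, rotated]) (use C c in auto)
  then have "AE x in lborel. f x = f' x"
    by eventually_elim (simp add: e_def)
  then have "conv W f x = conv W f' x"
    using causal_measurable[OF f(1)] causal_measurable[OF f'(1)] causal_measurable[OF cW(1)]
    by (intro conv_cong_AE)
  then show "u x = u' x"
    by (simp add: f(2) f'(2))
qed

lemma is_solution_of_representation:
  assumes W: "has_density W c v" and \<phi>m: "\<phi> \<in> borel_measurable borel" and \<phi>: "\<And>x. \<bar>\<phi> x\<bar> \<le> C"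
    and g: "causal d g" and u': "AE x in lebesgue. (u has_real_derivative g x) (at x)"
    and rep: "\<And>x. u x = W (x - d) + conv W (\<lambda>y. \<phi> y * g y) x"
  shows "is_solution W \<phi> d u"
proof -
  note cW = has_density_causal[OF W]
  have \<phi>g: "causal d (\<lambda>y. \<phi> y * g y)"
    using g \<phi>m \<phi> by (rule causal_bounded_mult)
  have eq: "AE y in lebesgue. y \<ge> d \<longrightarrow> \<phi> y * deriv u y = \<phi> y * g y"
    using u' by eventually_elim (simp add: DERIV_imp_deriv)
  have "AE x in lebesgue. u differentiable at x"
    using u' by eventually_elim (auto simp: real_differentiable_def)
  then show ?thesis
    unfolding is_solution_def
    using conv_lebesgue[OF cW \<phi>g eq] rep by (simp add: mult.assoc)
qed

section \<open>Density of the scale functions\<close>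

text \<open>Subtract the chord. At the leftmost point of a positive maximum of the difference, a
  symmetric pair of neighbours contradicts the midpoint inequality, since the left neighbour has a
  strictly smaller value.\<close>

lemma midpoint_convex_imp_convex:
  fixes f :: "real \<Rightarrow> real"
  assumes I: "convex I" and f: "continuous_on I f"
    and mid: "\<And>x y. x \<in> I \<Longrightarrow> y \<in> I \<Longrightarrow> f ((x + y) / 2) \<le> (f x + f y) / 2"
  shows "convex_on I f"
proof (rule convex_onI)
  fix t x y :: real
  assume t: "0 < t" "t < 1" and xy: "x \<in> I" "y \<in> I"
  define h where "h s = (1 - s) * x + s * y" for s
  define g where "g s = f (h s) - ((1 - s) * f x + s * f y)" for s
  have h: "h s \<in> I" if "s \<in> {0..1}" for s
    using convexD[OF I xy, of "1 - s" s] that by (simp add: h_def)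
  have cg: "continuous_on {0..1} g"
    unfolding g_def
    by (intro continuous_intros continuous_on_compose2[OF f]) (use h in \<open>auto simp: h_def intro!: continuous_intros\<close>)
  have g01: "g 0 = 0" "g 1 = 0"
    by (simp_all add: g_def h_def)
  have gmid: "g ((r + s) / 2) \<le> (g r + g s) / 2" if "r \<in> {0..1}" "s \<in> {0..1}" for r s
  proof -
    have "h ((r + s) / 2) = (h r + h s) / 2"
      by (simp add: h_def field_simps)
    then show ?thesis
      using mid[OF h[OF that(1)] h[OF that(2)]] by (simp add: g_def add_divide_distrib algebra_simps)
  qed
  obtain m where m: "m \<in> {0..1}" "\<And>s. s \<in> {0..1} \<Longrightarrow> g s \<le> g m"
    using continuous_attains_sup[OF _ _ cg] by auto
  have "g m \<le> 0"
  proof (rule ccontr)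
    assume pos: "\<not> g m \<le> 0"
    define S where "S = {s \<in> {0..1}. g s = g m}"
    have "closed S"
      unfolding S_def using continuous_closed_preimage_constant[OF cg, of "g m"] by simp
    have S: "S \<noteq> {}" "bdd_below S"
      using m(1) by (auto simp: S_def intro!: bdd_belowI[of _ 0])
    define s where "s = Inf S"
    have "s \<in> S"
      unfolding s_def using closed_contains_Inf[OF S \<open>closed S\<close>] .
    then have s: "s \<in> {0..1}" "g s = g m"
      by (auto simp: S_def)
    with pos g01 have "s \<noteq> 0" "s \<noteq> 1"
      by auto
    define e where "e = min s (1 - s)"
    have e: "0 < e" "s - e \<in> {0..1}" "s + e \<in> {0..1}"
      using s \<open>s \<noteq> 0\<close> \<open>s \<noteq> 1\<close> by (auto simp: e_def)
    have "s - e \<notin> S"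
      using cInf_lower[OF _ S(2), of "s - e"] e by (auto simp: s_def)
    then have "g (s - e) < g m"
      using m(2)[OF e(2)] e by (auto simp: S_def)
    then show False
      using gmid[OF e(2,3)] m(2)[OF e(3)] s by simp
  qed
  then have "g t \<le> 0"
    using m(2)[of t] t by simp
  then show "f ((1 - t) *\<^sub>R x + t *\<^sub>R y) \<le> (1 - t) * f x + t * f y"
    by (simp add: g_def h_def)
qed (rule I)

text \<open>Over a partition into equal pieces the bounds telescope in \<open>m\<close> and keep the
  common length as a factor, which can be made arbitrarily small.\<close>

lemma eq_endpoints_if_increments_small:
  fixes G m :: "real \<Rightarrow> real"
  assumes "a \<le> b"
    and G: "\<And>x y. a \<le> x \<Longrightarrow> x \<le> y \<Longrightarrow> y \<le> b \<Longrightarrow> \<bar>G y - G x\<bar> \<le> (m y - m x) * (y - x)"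
  shows "G a = G b"
proof -
  have est: "\<bar>G b - G a\<bar> \<le> (m b - m a) * (b - a) * inverse (real (Suc n))" for n
  proof -
    define h where "h = (b - a) / real (Suc n)"
    define p where "p i = a + real i * h" for i
    have h: "0 \<le> h" using \<open>a \<le> b\<close> by (simp add: h_def)
    have p: "p 0 = a" "p (Suc n) = b" "p (Suc i) - p i = h" "a \<le> p i" for i
    proof -
      have "real (Suc n) * h = b - a"
        by (simp add: h_def del: of_nat_Suc)
      then show "p (Suc n) = b"
        by (simp add: p_def del: of_nat_Suc)
    qed (use h in \<open>simp_all add: p_def algebra_simps\<close>)
    have pb: "p i \<le> b" if "i \<le> Suc n" for i
    proof -
      have "real i * h \<le> real (Suc n) * h"
        using that h by (intro mult_right_mono) auto
      then show ?thesis using p(2) by (simp add: p_def)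
    qed
    have "\<bar>G b - G a\<bar> = \<bar>\<Sum>i<Suc n. G (p (Suc i)) - G (p i)\<bar>"
      using sum_lessThan_telescope[of "\<lambda>i. G (p i)" "Suc n"] p by simp
    also have "\<dots> \<le> (\<Sum>i<Suc n. \<bar>G (p (Suc i)) - G (p i)\<bar>)"
      by (rule sum_abs)
    also have "\<dots> \<le> (\<Sum>i<Suc n. (m (p (Suc i)) - m (p i)) * h)"
    proof (rule sum_mono)
      fix i assume "i \<in> {..<Suc n}"
      then show "\<bar>G (p (Suc i)) - G (p i)\<bar> \<le> (m (p (Suc i)) - m (p i)) * h"
        using G[of "p i" "p (Suc i)"] p(3,4)[of i] pb[of "Suc i"] h by simp
    qed
    also have "\<dots> = (m b - m a) * h"
      using sum_lessThan_telescope[of "\<lambda>i. m (p i)" "Suc n"] p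
      by (simp flip: sum_distrib_right del: sum.lessThan_Suc)
    finally show ?thesis
      by (simp add: h_def divide_inverse mult.assoc)
  qed
  have "(\<lambda>n. (m b - m a) * (b - a) * inverse (real (Suc n))) \<longlonglongrightarrow> (m b - m a) * (b - a) * 0"
    by (intro tendsto_intros LIMSEQ_inverse_real_of_nat)
  then have "\<bar>G b - G a\<bar> \<le> 0"
    using LIMSEQ_le_const[of _ _ "\<bar>G b - G a\<bar>"] est by (metis mult_zero_right)
  then show ?thesis by simp
qed

text \<open>Midpoint log-concavity and continuity make \<open>- ln (W x)\<close> convex in
  \<open>x\<close>; minus the infimum of its slopes to the right of \<open>x\<close>, the right
  derivative of the logarithm of \<open>W\<close>, serves as \<open>r x\<close>.\<close>

lemma log_concave_supergradient:
  fixes W :: "real \<Rightarrow> real"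
  assumes W: "continuous_on {x0<..} W" and pos: "\<And>x. x0 < x \<Longrightarrow> 0 < W x"
    and lc: "\<And>x y. x0 < x \<Longrightarrow> x \<le> y \<Longrightarrow> W y * W x \<le> (W ((x + y) / 2))\<^sup>2"
  shows "\<exists>r. \<forall>x>x0. \<forall>y>x0. ln (W y) \<le> ln (W x) + r x * (y - x)"
proof -
  let ?f = "\<lambda>x. - ln (W x)"
  have "convex_on {x0<..} ?f"
  proof (rule midpoint_convex_imp_convex)
    show "continuous_on {x0<..} ?f"
      using W pos by (intro continuous_intros) (auto simp: less_imp_neq[symmetric] dest: order.strict_implies_not_eq[OF pos])
    fix x y assume xy: "x \<in> {x0<..}" "y \<in> {x0<..}"
    have m: "W y * W x \<le> (W ((x + y) / 2))\<^sup>2"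
      using lc[of x y] lc[of y x] xy by (cases "x \<le> y") (simp_all add: mult.commute add.commute)
    have "ln (W y * W x) \<le> ln ((W ((x + y) / 2))\<^sup>2)"
      using m pos[of x] pos[of y] pos[of "(x + y) / 2"] xy by (subst ln_le_cancel_iff) auto
    then show "?f ((x + y) / 2) \<le> (?f x + ?f y) / 2"
      using pos[of x] pos[of y] pos[of "(x + y) / 2"] xy by (simp add: ln_mult ln_realpow)
  qed simp
  then have "?f y \<ge> ?f x + Inf ((\<lambda>t. (?f x - ?f t) / (x - t)) ` ({x<..} \<inter> {x0<..})) * (y - x)"
    if "x > x0" "y > x0" for x y
    using convex_le_Inf_differential[of "{x0<..}" ?f x y] that by (simp add: interior_open)
  then show ?thesis
    by (intro exI[of _ "\<lambda>x. - Inf ((\<lambda>t. (?f x - ?f t) / (x - t)) ` ({x<..} \<inter> {x0<..}))"]) fastforce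
qed

text \<open>\<open>r x * W x\<close> is the derivative of \<open>W\<close> read off from its
  logarithm. Increments of \<open>W\<close> and integrals of this product over \<open>{x..y}\<close>
  share the bounds \<open>r y * W x * (y - x)\<close> and \<open>r x * W y * (y - x)\<close>. As
  \<open>r\<close> decreases and \<open>W\<close> increases, the gap is at most \<open>y - x\<close>
  times an increment of a monotone function, so no differentiability argument is needed.\<close>

lemma log_concave_integral:
  fixes W r :: "real \<Rightarrow> real"
  assumes pos: "\<And>x. x0 < x \<Longrightarrow> 0 < W x"
    and mono: "\<And>x y. x0 < x \<Longrightarrow> x \<le> y \<Longrightarrow> W x \<le> W y"
    and r: "\<And>x y. x0 < x \<Longrightarrow> x0 < y \<Longrightarrow> ln (W y) \<le> ln (W x) + r x * (y - x)"
    and ab: "x0 < a" "a \<le> b"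
  shows "(\<lambda>x. indicator {x0<..} x * (r x * W x)) \<in> borel_measurable borel"
    and "\<And>x. x0 < x \<Longrightarrow> 0 \<le> r x"
    and "set_integrable lborel {a..b} (\<lambda>x. r x * W x)"
    and "(LINT x:{a..b}|lborel. r x * W x) = W b - W a"
proof -
  have r_nonneg: "0 \<le> r x" if "x0 < x" for x
  proof -
    have "ln (W x) \<le> ln (W (x + 1))"
      using mono[of x "x + 1"] pos[of x] pos[of "x + 1"] that by (subst ln_le_cancel_iff) auto
    then show ?thesis
      using r[of x "x + 1"] that by simp
  qed
  have r_anti: "r y \<le> r x" if "x0 < x" "x \<le> y" for x y
  proof (cases "x = y")
    case False
    have "0 \<le> (r x - r y) * (y - x)"
      using r[of x y] r[of y x] that by (simp add: algebra_simps)
    then show ?thesis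
      using False that by (simp add: zero_le_mult_iff)
  qed simp
  have "W \<in> borel_measurable (restrict_space borel {x0<..})"
    by (rule borel_measurable_mono_on_fnc) (use mono in \<open>auto intro!: mono_onI\<close>)
  moreover have "(\<lambda>x. - r x) \<in> borel_measurable (restrict_space borel {x0<..})"
    by (rule borel_measurable_mono_on_fnc) (use r_anti in \<open>auto intro!: mono_onI\<close>)
  then have "(\<lambda>x. - (- r x)) \<in> borel_measurable (restrict_space borel {x0<..})"
    by (rule borel_measurable_uminus)
  ultimately have "(\<lambda>x. r x * W x) \<in> borel_measurable (restrict_space borel {x0<..})"
    by simp
  then have meas: "(\<lambda>x. indicator {x0<..} x * (r x * W x)) \<in> borel_measurable borel"
    by (subst (asm) borel_measurable_restrict_space_iff) simp_all
  have sint: "set_integrable lborel {x..y} (\<lambda>x. r x * W x)" if "x0 < x" for x y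
    unfolding set_integrable_def
  proof (rule Bochner_Integration.integrable_bound)
    show "integrable lborel (\<lambda>z. r x * W y * indicator {x..y} z)"
      by (intro integrable_mult_right) (simp add: integrable_indicator_iff emeasure_lborel_Icc_eq)
    have "(\<lambda>z. indicator {x..y} z * (indicator {x0<..} z * (r z * W z))) \<in> borel_measurable borel"
      using meas by simp
    also have "(\<lambda>z. indicator {x..y} z * (indicator {x0<..} z * (r z * W z)))
        = (\<lambda>z. indicator {x..y} z *\<^sub>R (r z * W z))"
      using that by (auto simp: indicator_def)
    finally show "(\<lambda>z. indicator {x..y} z *\<^sub>R (r z * W z)) \<in> borel_measurable lborel"
      by simp
    have "r z * W z \<le> r x * W y" if "z \<in> {x..y}" for z
      using r_anti[of x z] mono[of z y] r_nonneg[of x] pos[of z] that \<open>x0 < x\<close>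
      by (intro mult_mono) auto
    moreover have "0 \<le> r z * W z" if "z \<in> {x..y}" for z
      using r_nonneg[of z] pos[of z] that \<open>x0 < x\<close> by simp
    ultimately show "AE z in lborel. norm (indicator {x..y} z *\<^sub>R (r z * W z))
        \<le> norm (r x * W y * indicator {x..y} z)"
      by (intro AE_I2) (fastforce simp: indicator_def)
  qed
  have int: "(\<lambda>x. r x * W x) integrable_on {x..y}" if "x0 < x" for x y
    using set_borel_integral_eq_integral(1)[OF sint[OF that]] .
  define G where "G x = W x - integral {a..x} (\<lambda>x. r x * W x)" for x
  \<comment> \<open>A bound on \<open>{a..b}\<close> for both \<open>r\<close> and \<open>W\<close>;
    it turns the oscillation of their product into increments of
    \<open>K * (W x - r x)\<close>.\<close>
  define K where "K = r a + W b"
  have "G a = G b"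
  proof (rule eq_endpoints_if_increments_small[where G = G and a = a and b = b and m = "\<lambda>x. K * (W x - r x)"])
    fix x y assume xy: "a \<le> x" "x \<le> y" "y \<le> b"
    then have x0: "x0 < x" "x0 < y"
      using ab by auto
    let ?I = "integral {x..y} (\<lambda>x. r x * W x)"
    have "integral {a..y} (\<lambda>x. r x * W x) = integral {a..x} (\<lambda>x. r x * W x) + ?I"
      using xy int[OF ab(1)] by (intro Henstock_Kurzweil_Integration.integral_combine[symmetric]) auto
    then have G: "G y - G x = W y - W x - ?I"
      by (simp add: G_def)
    have rW: "r z * W z \<le> r x * W y" "r y * W x \<le> r z * W z" if "z \<in> {x..y}" for z
      using r_anti[of x z] r_anti[of z y] mono[of z y] mono[of x z] that x0
        r_nonneg[of x] r_nonneg[of z] pos[of z] pos[of x]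
      by (auto intro!: mult_mono)
    have "?I \<le> integral {x..y} (\<lambda>_. r x * W y)"
      by (rule integral_le[OF int[OF x0(1)]]) (use rW(1) in auto)
    then have I1: "?I \<le> r x * W y * (y - x)"
      using xy by (simp add: mult_ac)
    have "integral {x..y} (\<lambda>_. r y * W x) \<le> ?I"
      by (rule integral_le[OF _ int[OF x0(1)]]) (use rW(2) in auto)
    then have I2: "r y * W x * (y - x) \<le> ?I"
      using xy by (simp add: mult_ac)
    \<comment> \<open>The inequality \<open>1 + t \<le> exp t\<close> converts increments of the
      logarithm into increments of \<open>W\<close>; the sign of \<open>t\<close> decides which
      endpoint value of \<open>W\<close> becomes the factor.\<close>
    have W1: "W y - W x \<le> r x * W y * (y - x)"
    proof -
      have "1 + (ln (W x) - ln (W y)) \<le> exp (ln (W x) - ln (W y))"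
        by (rule exp_ge_add_one_self)
      also have "\<dots> = W x / W y"
        using pos x0 by (simp add: exp_diff)
      finally have "W y * (1 + (ln (W x) - ln (W y))) \<le> W x"
        using pos[OF x0(2)] by (simp add: field_simps)
      then have "W y - W x \<le> W y * (ln (W y) - ln (W x))"
        by (simp add: algebra_simps)
      also have "\<dots> \<le> W y * (r x * (y - x))"
        using r[OF x0] pos[OF x0(2)] by (intro mult_left_mono) auto
      finally show ?thesis by (simp add: mult_ac)
    qed
    have W2: "r y * W x * (y - x) \<le> W y - W x"
    proof -
      have "1 + (ln (W y) - ln (W x)) \<le> exp (ln (W y) - ln (W x))"
        by (rule exp_ge_add_one_self)
      also have "\<dots> = W y / W x"
        using pos x0 by (simp add: exp_diff)
      finally have "W x * (1 + (ln (W y) - ln (W x))) \<le> W y"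
        using pos[OF x0(1)] by (simp add: field_simps)
      moreover have "W x * (r y * (y - x)) \<le> W x * (ln (W y) - ln (W x))"
        using r[OF x0(2,1)] pos[OF x0(1)] by (intro mult_left_mono) (auto simp: algebra_simps)
      ultimately show ?thesis by (simp add: algebra_simps)
    qed
    have "r x * W y - r y * W x \<le> K * (W y - r y) - K * (W x - r x)"
    proof -
      have "r x * W y - r y * W x = (r x - r y) * W y + r y * (W y - W x)"
        by (simp add: algebra_simps)
      also have "\<dots> \<le> (r x - r y) * K + K * (W y - W x)"
      proof (rule add_mono)
        have "W y \<le> K" "r y \<le> K"
          using mono[of y b] r_anti[of a y] r_nonneg[OF ab(1)] pos[of b] xy x0 ab by (auto simp: K_def)
        then show "(r x - r y) * W y \<le> (r x - r y) * K" "r y * (W y - W x) \<le> K * (W y - W x)"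
          using r_anti[of x y] mono[of x y] xy x0 by (auto intro: mult_left_mono mult_right_mono)
      qed
      finally show ?thesis by (simp add: algebra_simps)
    qed
    then have "(r x * W y - r y * W x) * (y - x) \<le> (K * (W y - r y) - K * (W x - r x)) * (y - x)"
      using xy by (intro mult_right_mono) auto
    then show "\<bar>G y - G x\<bar> \<le> (K * (W y - r y) - K * (W x - r x)) * (y - x)"
      using I1 I2 W1 W2 unfolding G by (simp add: algebra_simps abs_le_iff)
  qed (rule ab(2))
  then have "integral {a..b} (\<lambda>x. r x * W x) = W b - W a"
    by (simp add: G_def)
  then show "(LINT x:{a..b}|lborel. r x * W x) = W b - W a"
    using set_borel_integral_eq_integral(2)[OF sint[OF ab(1)]] by simp
  show "set_integrable lborel {a..b} (\<lambda>x. r x * W x)"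
    by (rule sint[OF ab(1)])
  show "(\<lambda>x. indicator {x0<..} x * (r x * W x)) \<in> borel_measurable borel"
    by (rule meas)
  show "0 \<le> r x" if "x0 < x" for x
    using that by (rule r_nonneg)
qed

text \<open>The logarithm exists only right of the point \<open>x0\<close> at which \<open>W\<close>
  becomes positive; between 0 and \<open>x0\<close> the function is constant. \<open>r\<close> may
  be unbounded near \<open>x0\<close>, so integrals up to \<open>b\<close> are monotone limits of
  those over \<open>{a n..b}\<close>, and continuity of \<open>W\<close> at \<open>x0\<close>
  prevents a loss of mass.\<close>

lemma log_concave_has_density:
  fixes W :: "real \<Rightarrow> real"
  assumes W: "continuous_on {0..} W" "\<And>x. x < 0 \<Longrightarrow> W x = 0" "\<And>x. 0 \<le> W x"
    and mono: "\<And>x y. 0 \<le> x \<Longrightarrow> x \<le> y \<Longrightarrow> W x \<le> W y"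
    and lc: "\<And>x y. 0 < x \<Longrightarrow> x \<le> y \<Longrightarrow> W y * W x \<le> (W ((x + y) / 2))\<^sup>2"
  shows "\<exists>v. has_density W (W 0) v \<and> (\<forall>x. 0 \<le> v x)"
proof (cases "\<exists>x. 0 < x \<and> 0 < W x")
  case False
  then have z: "W x = 0" if "0 \<le> x" for x
  proof -
    have "\<not> 0 < W (x + 1)"
      using False that by auto
    then show ?thesis
      using W(3)[of x] mono[of x "x + 1"] that by linarith
  qed
  then have "W = (\<lambda>_. 0)"
    using W(2) by (meson ext not_le)
  then have "has_density W (W 0) (\<lambda>_. 0)"
    by (auto simp: has_density_def causal_def conv_def set_integrable_def indicator_def)
  then show ?thesis by auto
next
  case True
  define I where "I = {x. 0 < x \<and> 0 < W x}"
  define x0 where "x0 = Inf I"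
  have I: "I \<noteq> {}" "bdd_below I"
    using True by (auto simp: I_def intro!: bdd_belowI[of _ 0])
  have x0: "0 \<le> x0"
    unfolding x0_def using I by (intro cInf_greatest) (auto simp: I_def)
  have pos: "0 < W x" if "x0 < x" for x
  proof -
    obtain y where "y \<in> I" "y < x"
      using cInf_lessD[OF I(1), of x] \<open>x0 < x\<close> by (auto simp: x0_def)
    then show ?thesis
      using mono[of y x] by (auto simp: I_def)
  qed
  have W_le_x0: "W x = W 0" if "0 \<le> x" "x \<le> x0" for x
  proof (cases "x0 = 0")
    case False
    then have "0 < x0" using x0 by simp
    have zero: "W y = 0" if "y \<in> {0<..<x0}" for y
      using cInf_lower[OF _ I(2), of y] that W(3)[of y] by (force simp: x0_def I_def)
    have "W y = 0" if "y \<in> closure {0<..<x0}" for y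
      by (rule continuous_constant_on_closure[OF _ zero that])
        (use W(1) \<open>0 < x0\<close> in \<open>auto intro: continuous_on_subset simp: closure_greaterThanLessThan\<close>)
    then show ?thesis
      using that \<open>0 < x0\<close> by (auto simp: closure_greaterThanLessThan)
  qed (use that in auto)
  have "\<exists>r. \<forall>x>x0. \<forall>y>x0. ln (W y) \<le> ln (W x) + r x * (y - x)"
  proof (rule log_concave_supergradient)
    show "continuous_on {x0<..} W"
      using W(1) x0 by (auto intro: continuous_on_subset)
  qed (use pos lc x0 in auto)
  then obtain r where r: "\<And>x y. x0 < x \<Longrightarrow> x0 < y \<Longrightarrow> ln (W y) \<le> ln (W x) + r x * (y - x)"
    by blast
  have mono': "W x \<le> W y" if "x0 < x" "x \<le> y" for x y
    using mono that x0 by simp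
  have rW_m: "(\<lambda>x. indicator {x0<..} x * (r x * W x)) \<in> borel_measurable borel"
    by (rule log_concave_integral(1)[of x0 W r "x0 + 1" "x0 + 1"]; use pos mono' r in simp)
  have r_nonneg: "0 \<le> r x" if "x0 < x" for x
    by (rule log_concave_integral(2)[of x0 W r "x0 + 1" "x0 + 1"]; use pos mono' r that in simp)
  have rW: "set_integrable lborel {a..b} (\<lambda>x. r x * W x)"
    "(LINT x:{a..b}|lborel. r x * W x) = W b - W a" if "x0 < a" "a \<le> b" for a b
    by (rule log_concave_integral(3,4)[of x0 W r a b]; use pos mono' r that in simp)+
  define v where "v x = indicator {x0<..} x * (r x * W x)" for x
  have v_m [measurable]: "v \<in> borel_measurable borel"
    unfolding v_def by (rule rW_m)
  have v_nonneg: "0 \<le> v x" for x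
  proof (cases "x0 < x")
    case True
    then have "0 \<le> r x"
      by (rule r_nonneg)
    then show ?thesis
      using pos[OF True] by (simp add: v_def)
  qed (simp add: v_def)
  have main: "set_integrable lborel {..b} v \<and> (LINT x:{..b}|lborel. v x) = W b - W 0" if "0 \<le> b" for b
  proof (cases "b \<le> x0")
    case True
    then have "(\<lambda>x. indicator {..b} x *\<^sub>R v x) = (\<lambda>_. 0)"
      by (intro ext) (auto simp: v_def indicator_def)
    then show ?thesis
      unfolding set_integrable_def set_lebesgue_integral_def using W_le_x0[OF that True] by simp
  next
    case False
    define a where "a n = x0 + (b - x0) * inverse (real (Suc n))" for n
    have a: "x0 < a n" "a n \<le> b" for n
    proof -
      have "inverse (real (Suc n)) \<le> 1"
        by (simp add: field_simps)
      then have "(b - x0) * inverse (real (Suc n)) \<le> (b - x0) * 1"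
        using False by (intro mult_left_mono) auto
      then show "a n \<le> b"
        by (simp add: a_def)
      show "x0 < a n"
        using False by (simp add: a_def)
    qed
    have a_anti: "a n \<le> a m" if "m \<le> n" for m n
      using that False by (auto simp: a_def intro!: mult_left_mono le_imp_inverse_le)
    have a_lim: "a \<longlonglongrightarrow> x0"
    proof -
      have "a \<longlonglongrightarrow> x0 + (b - x0) * 0"
        unfolding a_def by (intro tendsto_intros LIMSEQ_inverse_real_of_nat)
      then show ?thesis by simp
    qed
    let ?f = "\<lambda>n x. indicator {a n..b} x *\<^sub>R (r x * W x)" and ?u = "\<lambda>x. indicator {..b} x *\<^sub>R v x"
    have f_eq: "?f n x = indicator {a n..b} x * v x" for n x
      using a[of n] by (auto simp: v_def indicator_def)
    have i: "integrable lborel (?f n)" for n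
      using rW(1)[OF a] by (simp add: set_integrable_def)
    have m: "AE x in lborel. mono (\<lambda>n. ?f n x)"
    proof (intro AE_I2 monoI)
      fix x and m n :: nat assume "m \<le> n"
      then show "?f m x \<le> ?f n x"
        unfolding f_eq using a_anti v_nonneg[of x]
        by (intro mult_right_mono) (auto simp: indicator_def intro: order_trans)
    qed
    have p: "AE x in lborel. 0 \<le> ?f n x" for n
      unfolding f_eq using v_nonneg by simp
    have l: "AE x in lborel. (\<lambda>n. ?f n x) \<longlonglongrightarrow> ?u x"
    proof (rule AE_I2)
      fix x
      show "(\<lambda>n. ?f n x) \<longlonglongrightarrow> ?u x"
      proof (cases "x0 < x")
        case True
        have "\<forall>\<^sub>F n in sequentially. a n < x"
          using order_tendstoD(2)[OF a_lim True] .
        then have "\<forall>\<^sub>F n in sequentially. ?f n x = ?u x"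
          unfolding f_eq by eventually_elim (auto simp: indicator_def)
        then show ?thesis
          by (rule tendsto_eventually)
      next
        case False
        then show ?thesis
          unfolding f_eq by (simp add: v_def)
      qed
    qed
    have "(\<lambda>n. W (a n)) \<longlonglongrightarrow> W x0"
      using W(1) a_lim x0 less_imp_le[OF a(1)] unfolding continuous_on_sequentially comp_def
      by (metis atLeast_iff order_trans)
    then have "(\<lambda>n. W b - W (a n)) \<longlonglongrightarrow> W b - W 0"
      using W_le_x0[OF x0] by (intro tendsto_intros) simp
    then have il: "(\<lambda>n. LINT x|lborel. ?f n x) \<longlonglongrightarrow> W b - W 0"
      using rW(2)[OF a] by (simp add: set_lebesgue_integral_def)
    have u: "?u \<in> borel_measurable lborel"
      by simp
    from integral_monotone_convergence_nonneg[OF i m p l il u] show ?thesis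
      by (simp add: set_integrable_def set_lebesgue_integral_def)
  qed
  have v0: "v x = 0" if "x < 0" for x
    using that x0 by (simp add: v_def)
  have "causal 0 v"
    unfolding causal_def
  proof (intro conjI allI impI)
    fix T
    show "set_integrable lborel {..T} v"
      by (rule set_integrable_subset[of _ "{..max T 0}"]) (use main[of "max T 0"] in auto)
  qed (use v0 in auto)
  moreover have "W x = W 0 * heaviside x + conv heaviside v x" for x
  proof (cases "0 \<le> x")
    case True
    then show ?thesis
      using main[of x] by (simp add: conv_heaviside)
  next
    case False
    then have "(\<lambda>y. indicator {..x} y *\<^sub>R v y) = (\<lambda>_. 0)"
      using v0 by (intro ext) (auto simp: indicator_def)
    then show ?thesis
      unfolding conv_heaviside set_lebesgue_integral_def using False W(2) by simp
  qed
  ultimately show ?thesis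
    unfolding has_density_def using v_nonneg by blast
qed

section \<open>Laplace transforms of densities and the resolvent identity\<close>

lemma exp_conv: "exp (- \<theta> * x) * conv f g x = conv (\<lambda>x. exp (- \<theta> * x) * f x) (\<lambda>x. exp (- \<theta> * x) * g x) x"
proof -
  have "exp (- \<theta> * x) * (f (x - y) * g y) = exp (- \<theta> * (x - y)) * f (x - y) * (exp (- \<theta> * y) * g y)" for y
    by (simp add: algebra_simps flip: exp_add)
  then have eq: "(\<lambda>y. exp (- \<theta> * x) * (f (x - y) * g y))
      = (\<lambda>y. exp (- \<theta> * (x - y)) * f (x - y) * (exp (- \<theta> * y) * g y))"
    by (rule ext)
  have "exp (- \<theta> * x) * conv f g x = (LINT y|lborel. exp (- \<theta> * x) * (f (x - y) * g y))"
    by (simp add: conv_def)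
  then show ?thesis
    unfolding eq by (simp only: conv_def)
qed

text \<open>An integration by parts, in which integrability of the weighted density is part of the
  claim. Truncations of \<open>v\<close> are convolved with the exponential, which keeps their
  integrals below a bound coming from \<open>W\<close>; monotone convergence concludes.\<close>

lemma laplace_density:
  assumes W: "has_density W c v" and v0: "\<And>x. 0 \<le> v x" and \<theta>: "0 < \<theta>"
    and int: "integrable lborel (\<lambda>x. exp (- \<theta> * x) * W x)"
  shows "integrable lborel (\<lambda>x. exp (- \<theta> * x) * v x)"
    and "(LINT x|lborel. exp (- \<theta> * x) * v x) = \<theta> * (LINT x|lborel. exp (- \<theta> * x) * W x) - c"
proof -
  have v: "causal 0 v" and Weq: "\<And>x. W x = c * heaviside x + conv heaviside v x"
    using W by (auto simp: has_density_def)
  have [measurable]: "v \<in> borel_measurable borel"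
    using causal_measurable[OF v] .
  let ?H = "\<lambda>x. exp (- \<theta> * x) * heaviside x" and ?v = "\<lambda>x. exp (- \<theta> * x) * v x"
  have H: "integrable lborel ?H" "(LINT x|lborel. ?H x) = 1 / \<theta>"
    using has_bochner_integral_exp_tail[OF \<theta>, of 0] by (simp_all add: has_bochner_integral_iff mult.commute)
  have eW: "exp (- \<theta> * x) * W x = c * ?H x + conv ?H ?v x" for x
    unfolding Weq exp_conv[symmetric] by (simp add: algebra_simps)
  have int_conv: "integrable lborel (conv ?H ?v)"
  proof -
    have "integrable lborel (\<lambda>x. exp (- \<theta> * x) * W x - c * ?H x)"
      using int H(1) by (intro Bochner_Integration.integrable_diff integrable_mult_right)
    moreover have "(\<lambda>x. exp (- \<theta> * x) * W x - c * ?H x) = conv ?H ?v"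
      unfolding eW by (rule ext) simp
    ultimately show ?thesis
      by (simp only:)
  qed
  let ?g = "\<lambda>n x. indicator {..real n} x * ?v x"
  have g: "integrable lborel (?g n)" for n
  proof (rule integrable_norm_bound[OF causal_truncation[OF v, of "real n"]])
    show "norm (?g n x) \<le> norm (indicator {..real n} x * v x)" for x
      using causal_zero[OF v, of x] \<theta> by (cases "x < 0") (auto simp: abs_mult intro!: mult_left_le_one_le mult_left_mono)
  qed measurable
  have g_mono: "AE x in lborel. mono (\<lambda>n. ?g n x)"
  proof (intro AE_I2 monoI)
    fix x and m n :: nat assume "m \<le> n"
    then show "?g m x \<le> ?g n x"
      using v0 by (intro mult_right_mono) (auto simp: indicator_def)
  qed
  have g_nonneg: "AE x in lborel. 0 \<le> ?g n x" for n
    using v0 by (intro AE_I2) simp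
  have g_lim: "AE x in lborel. (\<lambda>n. ?g n x) \<longlonglongrightarrow> ?v x"
  proof (intro AE_I2 tendsto_eventually)
    fix x
    show "\<forall>\<^sub>F n in sequentially. ?g n x = ?v x"
      using eventually_ge_at_top[of "nat \<lceil>x\<rceil>"]
    proof eventually_elim
      case (elim n)
      then have "x \<le> real n" by linarith
      then show ?case by simp
    qed
  qed
  have bound: "(LINT x|lborel. ?g n x) \<le> \<theta> * (LINT x|lborel. conv ?H ?v x)" for n
  proof -
    have "1 / \<theta> * (LINT x|lborel. ?g n x) = (LINT x|lborel. conv ?H (?g n) x)"
      using integral_conv(2)[OF H(1) g] H(2) by simp
    also have "\<dots> \<le> (LINT x|lborel. conv ?H ?v x)"
    proof (rule integral_mono[OF integral_conv(1)[OF H(1) g] int_conv])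
      fix x
      have i: "integrable lborel (\<lambda>y. ?H (x - y) * h y)"
        if "\<And>y. \<bar>h y\<bar> \<le> ?v y" "h \<in> borel_measurable borel" for h
      proof (rule Bochner_Integration.integrable_bound)
        have "integrable lborel (\<lambda>y. exp (- \<theta> * x) * (heaviside (x - y) * v y))"
          using conv_integrable[OF causal_heaviside locally_bounded_heaviside v] by simp
        also have "(\<lambda>y. exp (- \<theta> * x) * (heaviside (x - y) * v y)) = (\<lambda>y. ?H (x - y) * ?v y)"
          by (auto simp: algebra_simps simp flip: exp_add)
        finally show "integrable lborel (\<lambda>y. ?H (x - y) * ?v y)" .
        show "AE y in lborel. norm (?H (x - y) * h y) \<le> norm (?H (x - y) * ?v y)"
          unfolding real_norm_def abs_mult[of "?H _"]
          by (intro AE_I2 mult_left_mono order_trans[OF that(1) abs_ge_self]) simp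
      qed (use that(2) in measurable)
      show "conv ?H (?g n) x \<le> conv ?H ?v x"
        unfolding conv_def
      proof (rule integral_mono[OF i i])
        show "\<bar>?g n y\<bar> \<le> ?v y" "\<bar>?v y\<bar> \<le> ?v y" for y
          using v0[of y] by (auto simp: indicator_def abs_mult)
        show "?H (x - y) * ?g n y \<le> ?H (x - y) * ?v y" for y
          using v0[of y] by (intro mult_left_mono) (auto simp: indicator_def)
      qed measurable
    qed
    finally show ?thesis
      using \<theta> by (simp add: field_simps)
  qed
  have "incseq (\<lambda>n. LINT x|lborel. ?g n x)"
  proof (rule incseq_SucI)
    fix n
    show "(LINT x|lborel. ?g n x) \<le> (LINT x|lborel. ?g (Suc n) x)"
      using v0 by (intro integral_mono g mult_right_mono) (auto simp: indicator_def)
  qed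
  then obtain L where "(\<lambda>n. LINT x|lborel. ?g n x) \<longlonglongrightarrow> L"
    using incseq_convergent[of "\<lambda>n. LINT x|lborel. ?g n x"] bound by blast
  from integral_monotone_convergence_nonneg(1)[OF g g_mono g_nonneg g_lim this]
  show iv: "integrable lborel ?v" by simp
  have "(LINT x|lborel. exp (- \<theta> * x) * W x) = c * (1 / \<theta>) + 1 / \<theta> * (LINT x|lborel. ?v x)"
    unfolding eW using H int_conv integral_conv(2)[OF H(1) iv] by simp
  then show "(LINT x|lborel. ?v x) = \<theta> * (LINT x|lborel. exp (- \<theta> * x) * W x) - c"
    using \<theta> by (simp add: field_simps)
qed

text \<open>With \<open>A = \<psi> t - q\<close> and \<open>B = A - \<Delta> * t\<close>, the
  Stieltjes measure of \<open>W'\<close> has transform \<open>t / B\<close> by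
  \<open>laplace_density\<close>, and the claim becomes
  \<open>1 / B - 1 / A = \<Delta> * t / (A * B)\<close>.\<close>

lemma resolvent_identity:
  assumes W: "is_scale_function \<psi> q W" "has_density W c v"
    and W': "is_scale_function (\<lambda>\<theta>. \<psi> \<theta> - \<Delta> * \<theta>) q W'" "has_density W' c' v'" "\<And>x. 0 \<le> v' x"
    and big: "\<forall>\<^sub>F \<theta> in at_top. q < \<psi> \<theta>" "\<forall>\<^sub>F \<theta> in at_top. q < \<psi> \<theta> - \<Delta> * \<theta>"
  shows "W' x - W x = \<Delta> * (c' * W x + conv W v' x)"
proof -
  let ?psi' = "\<lambda>\<theta>. \<psi> \<theta> - \<Delta> * \<theta>"
  have v': "causal 0 v'" using W'(2) by (simp add: has_density_def)
  obtain \<theta>0 where \<theta>0: "\<And>\<theta>. \<theta> \<ge> \<theta>0 \<Longrightarrow> q < \<psi> \<theta> \<and> q < ?psi' \<theta>"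
    using eventually_conj[OF big] by (auto simp: eventually_at_top_linorder)
  define \<theta> where "\<theta> = max (max \<theta>0 1) (max (right_inverse \<psi> q) (right_inverse ?psi' q) + 1)"
  define h where "h x = W' x - W x - \<Delta> * (c' * W x + conv W v' x)" for x
  have L: "integrable lborel (\<lambda>x. exp (- t * x) * h x) \<and> (LINT x|lborel. exp (- t * x) * h x) = 0"
    if t: "t \<ge> \<theta>" for t
  proof -
    have t': "0 < t" "q < \<psi> t" "q < ?psi' t" "right_inverse \<psi> q < t" "right_inverse ?psi' q < t"
      using t \<theta>0[of t] by (auto simp: \<theta>_def)
    note 1 = scale_function_laplace[OF W(1) t'(4)] and 2 = scale_function_laplace[OF W'(1) t'(5)]
    note 3 = laplace_density[OF W'(2,3) t'(1) 2(1)]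
    have 4: "integrable lborel (\<lambda>x. exp (- t * x) * conv W v' x)"
      "(LINT x|lborel. exp (- t * x) * conv W v' x) = 1 / (\<psi> t - q) * (t * (1 / (?psi' t - q)) - c')"
      using integral_conv[OF 1(1) 3(1)] unfolding 1(2) 3(2) 2(2) exp_conv[symmetric] by blast+
    have eq: "exp (- t * x) * h x = exp (- t * x) * W' x - exp (- t * x) * W x
        - \<Delta> * (c' * (exp (- t * x) * W x) + exp (- t * x) * conv W v' x)" for x
      by (simp add: h_def algebra_simps)
    have "integrable lborel (\<lambda>x. exp (- t * x) * h x)"
      unfolding eq using 1(1) 2(1) 4(1) by auto
    moreover have "(LINT x|lborel. exp (- t * x) * h x) = 1 / (?psi' t - q) - 1 / (\<psi> t - q)
        - \<Delta> * (c' * (1 / (\<psi> t - q)) + 1 / (\<psi> t - q) * (t * (1 / (?psi' t - q)) - c'))"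
      unfolding eq using 1 2 4 by simp
    moreover have "1 / (?psi' t - q) - 1 / (\<psi> t - q)
        - \<Delta> * (c' * (1 / (\<psi> t - q)) + 1 / (\<psi> t - q) * (t * (1 / (?psi' t - q)) - c')) = 0"
    proof -
      have "1 / B - 1 / A - \<Delta> * (c' * (1 / A) + 1 / A * (t * (1 / B) - c')) = 0"
        if "A \<noteq> 0" "B \<noteq> 0" "B = A - \<Delta> * t" for A B
      proof -
        have "1 / B - 1 / A - \<Delta> * (c' * (1 / A) + 1 / A * (t * (1 / B) - c')) = (A - B - \<Delta> * t) / (A * B)"
          using that(1,2) by (simp add: field_simps)
        then show ?thesis using that(3) by simp
      qed
      from this[of "\<psi> t - q" "?psi' t - q"] show ?thesis
        using t' by simp
    qed
    ultimately show ?thesis by simp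
  qed
  have "h x = 0"
  proof (rule laplace_unique[where h = h and \<theta> = \<theta>])
    have c: "continuous_on {0..} W" "continuous_on {0..} W'"
      using W(1) W'(1) by (auto simp: is_scale_function_def)
    have "conv W v' = conv heaviside (\<lambda>y. c * v' y + conv v v' y)"
      using conv_has_density[OF W(2) v'] by (rule ext)
    then have "continuous_on {0..} (conv W v')"
      using continuous_on_subset[OF continuous_on_conv_heaviside[OF causal_has_density_deriv[OF W(2) v']]] by auto
    then show "continuous_on {0..} h"
      unfolding h_def by (intro continuous_intros c)
    show "h y = 0" if "y < 0" for y
      using that causal_zero[OF has_density_causal(1)[OF W(2)]] causal_zero[OF has_density_causal(1)[OF W'(2)]]
        causal_zero[OF causal_conv[OF has_density_causal(1)[OF W(2)] v']] by (simp add: h_def)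
    show "integrable lborel (\<lambda>x. exp (- \<theta> * x) * h x)"
      using L[of \<theta>] by simp
    show "(LINT x|lborel. exp (- (\<theta> + real m) * x) * h x) = 0" for m
      using L[of "\<theta> + real m"] by simp
  qed
  then show ?thesis
    by (simp add: h_def)
qed

text \<open>\<open>W\<close> dominates the constant \<open>W 0\<close> on the half line, so its
  transform is at least \<open>W 0 / \<theta>\<close>. The inequality stands in for the exact value
  of \<open>W 0\<close>, which is the reciprocal drift or 0 depending on the variation.\<close>

lemma scale_function_at_zero:
  assumes W: "is_scale_function \<psi> q W" and nonneg: "\<And>x. 0 \<le> W x"
    and mono: "\<And>x. 0 \<le> x \<Longrightarrow> W 0 \<le> W x"
    and \<theta>: "0 < \<theta>" "right_inverse \<psi> q < \<theta>"
  shows "W 0 \<le> \<theta> / (\<psi> \<theta> - q)"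
proof -
  note L = scale_function_laplace[OF W \<theta>(2)]
  have H: "has_bochner_integral lborel (\<lambda>x. W 0 * (indicator {0..} x * exp (- \<theta> * x))) (W 0 * (exp (- \<theta> * 0) / \<theta>))"
    by (rule has_bochner_integral_mult_right) (rule has_bochner_integral_exp_tail[OF \<theta>(1)])
  have "(LINT x|lborel. W 0 * (indicator {0..} x * exp (- \<theta> * x))) \<le> (LINT x|lborel. exp (- \<theta> * x) * W x)"
  proof (rule integral_mono[OF _ L(1)])
    show "integrable lborel (\<lambda>x. W 0 * (indicator {0..} x * exp (- \<theta> * x)))"
      using H by (simp add: has_bochner_integral_iff)
    fix x
    show "W 0 * (indicator {0..} x * exp (- \<theta> * x)) \<le> exp (- \<theta> * x) * W x"
      using mono[of x] nonneg[of x] by (cases "0 \<le> x") auto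
  qed
  then have "W 0 / \<theta> \<le> 1 / (\<psi> \<theta> - q)"
    using H L(2) by (simp add: has_bochner_integral_iff)
  then show ?thesis
    using \<theta> by (simp add: field_simps)
qed

section \<open>Laplace exponent and path variation\<close>

text \<open>Exponential Markov inequality: the probability that \<open>X t\<close> reaches
  \<open>c * t + \<epsilon>\<close> is at most \<open>exp (- (\<epsilon> * \<theta>))\<close> for
  every positive \<open>\<theta>\<close>. Stationarity carries the bound over to increments.\<close>

lemma levy_increment_le:
  assumes X: "levy_process M X" "has_laplace_exponent M X \<psi>"
    and le: "\<And>\<theta>. 0 \<le> \<theta> \<Longrightarrow> \<psi> \<theta> \<le> c * \<theta>" and st: "0 \<le> s" "0 \<le> t"
  shows "AE \<omega> in M. X (s + t) \<omega> - X s \<omega> \<le> c * t"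
proof -
  interpret prob_space M
    using X(1) by (simp add: levy_process_def)
  have meas: "X r \<in> borel_measurable M" if "0 \<le> r" for r
    using X(1) that by (simp add: levy_process_def)
  have [measurable]: "X t \<in> borel_measurable M" "X s \<in> borel_measurable M" "X (s + t) \<in> borel_measurable M"
    using meas st by auto
  have prob0: "prob {\<omega> \<in> space M. X t \<omega> \<ge> c * t + \<epsilon>} = 0" if \<epsilon>: "0 < \<epsilon>" for \<epsilon>
  proof -
    have bound: "prob {\<omega> \<in> space M. X t \<omega> \<ge> c * t + \<epsilon>} \<le> exp (- (\<epsilon> * \<theta>))" if \<theta>: "0 < \<theta>" for \<theta>
    proof -
      have int: "integrable M (\<lambda>\<omega>. exp (\<theta> * X t \<omega>))" "expectation (\<lambda>\<omega>. exp (\<theta> * X t \<omega>)) = exp (t * \<psi> \<theta>)"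
        using X(2) st \<theta> by (auto simp: has_laplace_exponent_def)
      have "{\<omega> \<in> space M. X t \<omega> \<ge> c * t + \<epsilon>} = {\<omega> \<in> space M. exp (\<theta> * X t \<omega>) \<ge> exp (\<theta> * (c * t + \<epsilon>))}"
        using \<theta> by auto
      then have "prob {\<omega> \<in> space M. X t \<omega> \<ge> c * t + \<epsilon>} \<le> exp (t * \<psi> \<theta>) / exp (\<theta> * (c * t + \<epsilon>))"
        using integral_Markov_inequality_measure[OF int(1), of "{}" "exp (\<theta> * (c * t + \<epsilon>))"] int(2) by simp
      also have "\<dots> = exp (t * \<psi> \<theta> - \<theta> * (c * t + \<epsilon>))"
        by (simp add: exp_diff)
      also have "\<dots> \<le> exp (- (\<epsilon> * \<theta>))"
        using mult_left_mono[OF le[of \<theta>] st(2)] \<theta> by (simp add: algebra_simps)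
      finally show ?thesis .
    qed
    have "((\<lambda>\<theta>. exp (- (\<epsilon> * \<theta>))) \<longlongrightarrow> 0) at_top"
      using \<epsilon> by real_asymp
    then have "prob {\<omega> \<in> space M. X t \<omega> \<ge> c * t + \<epsilon>} \<le> 0"
      by (rule tendsto_lowerbound) (use bound in \<open>auto intro!: eventually_mono[OF eventually_gt_at_top[of 0]]\<close>)
    then show ?thesis
      using measure_nonneg[of M] by (simp add: order_antisym)
  qed
  have "AE \<omega> in M. \<forall>n. X t \<omega> < c * t + 1 / real (Suc n)"
    unfolding AE_all_countable
  proof
    fix n
    have "AE \<omega> in M. \<not> X t \<omega> \<ge> c * t + 1 / real (Suc n)"
      by (rule AE_I[of _ _ "{\<omega> \<in> space M. X t \<omega> \<ge> c * t + 1 / real (Suc n)}"])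
        (use prob0[of "1 / real (Suc n)"] in \<open>auto simp: emeasure_eq_measure\<close>)
    then show "AE \<omega> in M. X t \<omega> < c * t + 1 / real (Suc n)"
      by eventually_elim simp
  qed
  then have "AE \<omega> in M. X t \<omega> \<le> c * t"
  proof eventually_elim
    case (elim \<omega>)
    have "(\<lambda>n. c * t + 1 / real (Suc n)) \<longlonglongrightarrow> c * t + 0"
      by (intro tendsto_intros LIMSEQ_Suc[OF lim_1_over_n])
    then have "X t \<omega> \<le> c * t + 0"
      by (rule LIMSEQ_le_const) (use elim in \<open>auto intro: less_imp_le\<close>)
    then show ?case by simp
  qed
  then have "AE x in distr M borel (X t). x \<le> c * t"
    by (subst AE_distr_iff) auto
  moreover have "distr M borel (X t) = distr M borel (\<lambda>\<omega>. X (s + t) \<omega> - X s \<omega>)"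
    using X(1) st by (simp add: levy_process_def)
  ultimately have "AE x in distr M borel (\<lambda>\<omega>. X (s + t) \<omega> - X s \<omega>). x \<le> c * t"
    by (simp only:)
  then show ?thesis
    by (subst (asm) AE_distr_iff) auto
qed

text \<open>Each increment bound has its own null set, so the bounds are first taken at rational
  times and then extended by right continuity. The path is then a linear function plus a
  nonincreasing one.\<close>

lemma bounded_variation_if_laplace_exponent_le:
  assumes X: "levy_process M X" "has_laplace_exponent M X \<psi>"
    and le: "\<And>\<theta>. 0 \<le> \<theta> \<Longrightarrow> \<psi> \<theta> \<le> c * \<theta>"
  shows "bounded_variation_paths M X"
proof -
  have "AE \<omega> in M. \<forall>s\<in>\<rat> \<inter> {0..}. \<forall>t\<in>\<rat> \<inter> {0..}. X (s + t) \<omega> - X s \<omega> \<le> c * t"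
    by (intro AE_ball_countable' countable_Int1 countable_rat levy_increment_le[OF X le]) auto
  moreover have "AE \<omega> in M. \<forall>t\<ge>0. continuous (at_right t) (\<lambda>s. X s \<omega>)"
    using X(1) by (auto simp: levy_process_def)
  ultimately show ?thesis
    unfolding bounded_variation_paths_def
  proof eventually_elim
    case (elim \<omega>)
    define g where "g t = X t \<omega> - c * t" for t
    have g_rat: "g t \<le> g s" if "s \<in> \<rat>" "t \<in> \<rat>" "0 \<le> s" "s \<le> t" for s t
      using elim(1)[rule_format, of s "t - s"] that by (auto simp: g_def algebra_simps Rats_diff)
    have g_lim: "(g \<longlongrightarrow> g t) (at_right t)" if "0 \<le> t" for t
      using elim(2) that unfolding g_def continuous_within by (auto intro!: tendsto_intros)
    have g_anti: "g t \<le> g s" if "0 \<le> s" "s \<le> t" for s t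
    proof (rule ccontr)
      assume "\<not> g t \<le> g s"
      then have st: "g s < g t" "s < t"
        using that by (cases "s = t"; simp)+
      then obtain m where m: "g s < m" "m < g t"
        using dense by blast
      have t: "0 \<le> s" "0 \<le> t"
        using that by linarith+
      obtain b where b: "t < b" "\<And>y. t < y \<Longrightarrow> y < b \<Longrightarrow> m < g y"
        using order_tendstoD(1)[OF g_lim[OF t(2)] m(2)] by (auto simp: eventually_at_right_field)
      obtain a where a: "s < a" "\<And>y. s < y \<Longrightarrow> y < a \<Longrightarrow> g y < m"
        using order_tendstoD(2)[OF g_lim[OF t(1)] m(1)] by (auto simp: eventually_at_right_field)
      obtain y where y: "y \<in> \<rat>" "t < y" "y < b"
        using Rats_dense_in_real[OF b(1)] by blast
      obtain x where x: "x \<in> \<rat>" "s < x" "x < min a t"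
        using Rats_dense_in_real[of s "min a t"] a(1) st by auto
      show False
        using g_rat[OF x(1) y(1)] a(2)[of x] b(2)[of y] x y that by auto
    qed
    show ?case
    proof (intro allI impI)
      fix T :: real assume "0 \<le> T"
      show "\<exists>C. \<forall>(n::nat) t. 0 \<le> t 0 \<and> mono t \<and> t n \<le> T \<longrightarrow>
          (\<Sum>i<n. \<bar>X (t (Suc i)) \<omega> - X (t i) \<omega>\<bar>) \<le> C"
      proof (intro exI allI impI)
        fix n :: nat and t :: "nat \<Rightarrow> real"
        assume t: "0 \<le> t 0 \<and> mono t \<and> t n \<le> T"
        have t0: "0 \<le> t i" "t i \<le> t (Suc i)" for i
          using t monoD[of t 0 i] monoD[of t i "Suc i"] by auto
        have "(\<Sum>i<n. \<bar>X (t (Suc i)) \<omega> - X (t i) \<omega>\<bar>)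
            \<le> (\<Sum>i<n. (\<bar>c\<bar> * t (Suc i) - g (t (Suc i))) - (\<bar>c\<bar> * t i - g (t i)))"
        proof (rule sum_mono)
          fix i
          have "\<bar>X (t (Suc i)) \<omega> - X (t i) \<omega>\<bar> = \<bar>c * (t (Suc i) - t i) + (g (t (Suc i)) - g (t i))\<bar>"
            by (simp add: g_def algebra_simps)
          also have "\<dots> \<le> \<bar>c * (t (Suc i) - t i)\<bar> + \<bar>g (t (Suc i)) - g (t i)\<bar>"
            by (rule abs_triangle_ineq)
          also have "\<dots> = \<bar>c\<bar> * (t (Suc i) - t i) + (g (t i) - g (t (Suc i)))"
            using g_anti[OF t0] t0[of i] by (simp add: abs_mult)
          finally show "\<bar>X (t (Suc i)) \<omega> - X (t i) \<omega>\<bar>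
              \<le> (\<bar>c\<bar> * t (Suc i) - g (t (Suc i))) - (\<bar>c\<bar> * t i - g (t i))"
            by (simp add: algebra_simps)
        qed
        also have "\<dots> = (\<bar>c\<bar> * t n - g (t n)) - (\<bar>c\<bar> * t 0 - g (t 0))"
          by (rule sum_lessThan_telescope)
        also have "\<dots> \<le> \<bar>c\<bar> * T - g T + g 0"
        proof -
          have "g T \<le> g (t n)" "g (t 0) \<le> g 0" "\<bar>c\<bar> * t n \<le> \<bar>c\<bar> * T" "0 \<le> \<bar>c\<bar> * t 0"
            using t t0[of n] t0[of 0] by (auto intro: g_anti mult_left_mono)
          then show ?thesis by linarith
        qed
        finally show "(\<Sum>i<n. \<bar>X (t (Suc i)) \<omega> - X (t i) \<omega>\<bar>) \<le> \<bar>c\<bar> * T - g T + g 0" .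
      qed
    qed
  qed
qed

context levy_exponent
begin

text \<open>All truncated drifts are at most 0, so the integrals of small jumps are bounded by
  \<open>- \<gamma>\<close> and converge monotonically. Integrability is recorded because
  \<open>drift\<close> would otherwise rest on the default value 0 of the integral.\<close>

lemma small_jumps_integrable_if_not_positive_drift:
  assumes npd: "\<not> positive_drift"
  shows "set_integrable \<nu> {0<..<1} (\<lambda>z. z)" "drift \<gamma> \<nu> \<le> 0"
proof -
  have le: "(LINT z:{cutoff n<..<1}|\<nu>. z) \<le> - \<gamma>" for n
  proof -
    have "truncated_drift \<gamma> \<nu> (cutoff n) \<le> 0"
      using npd cutoff(1,2) unfolding positive_drift_def by (meson not_less)
    then show ?thesis
      by (simp add: truncated_drift_def)
  qed
  let ?f = "\<lambda>n z. indicator {cutoff n<..<1} z *\<^sub>R z"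
  have f_eq: "?f n z = indicator {cutoff n<..} z * (z * indicator {0<..<1} z)" for n z
    using cutoff(1)[of n] by (auto simp: indicator_def)
  have i: "integrable \<nu> (?f n)" for n
    unfolding f_eq using integrable_tail[OF cutoff(1)[of n], of "\<lambda>z. z * indicator {0<..<1} z" 1]
    by (simp add: set_integrable_def indicator_def)
  have m: "AE z in \<nu>. mono (\<lambda>n. ?f n z)"
  proof (intro AE_I2 monoI)
    fix z and m n :: nat assume "m \<le> n"
    then have "cutoff n \<le> cutoff m"
      by (simp add: cutoff_def frac_le)
    then show "?f m z \<le> ?f n z"
      using cutoff(1)[of n] cutoff(1)[of m] by (auto simp: indicator_def)
  qed
  have p: "AE z in \<nu>. 0 \<le> ?f n z" for n
    using cutoff(1)[of n] by (intro AE_I2) (auto simp: indicator_def)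
  have l: "AE z in \<nu>. (\<lambda>n. ?f n z) \<longlonglongrightarrow> indicator {0<..<1} z *\<^sub>R z"
  proof (rule AE_I2)
    fix z
    show "(\<lambda>n. ?f n z) \<longlonglongrightarrow> indicator {0<..<1} z *\<^sub>R z"
    proof (cases "0 < z")
      case True
      have "\<forall>\<^sub>F n in sequentially. cutoff n < z"
        by (rule order_tendstoD(2)[OF cutoff(3) True])
      then show ?thesis
        by (intro tendsto_eventually) (auto elim!: eventually_mono simp: indicator_def True)
    next
      case False
      then have "(\<lambda>n. ?f n z) = (\<lambda>_. 0)"
        using cutoff(1) by (intro ext) (auto simp: indicator_def dest: less_trans)
      then show ?thesis
        using False by simp
    qed
  qed
  have "incseq (\<lambda>n. LINT z|\<nu>. ?f n z)"
  proof (rule incseq_SucI, rule integral_mono_AE[OF i i])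
    fix n
    show "AE z in \<nu>. ?f n z \<le> ?f (Suc n) z"
      using m by eventually_elim (simp add: mono_def)
  qed
  moreover have "(LINT z|\<nu>. ?f n z) \<le> - \<gamma>" for n
    using le[of n] by (simp add: set_lebesgue_integral_def)
  ultimately obtain L where L: "(\<lambda>n. LINT z|\<nu>. ?f n z) \<longlonglongrightarrow> L"
    using incseq_convergent[of "\<lambda>n. LINT z|\<nu>. ?f n z" "- \<gamma>"] by blast
  have u: "(\<lambda>z. indicator {0<..<1} z *\<^sub>R z) \<in> borel_measurable \<nu>"
    by measurable
  note conv = integral_monotone_convergence_nonneg[OF i m p l L u]
  show "set_integrable \<nu> {0<..<1} (\<lambda>z. z)"
    using conv(1) by (simp add: set_integrable_def)
  have "L \<le> - \<gamma>"
    by (rule LIMSEQ_le_const2[OF L]) (use le in \<open>auto simp: set_lebesgue_integral_def\<close>)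
  then show "drift \<gamma> \<nu> \<le> 0"
    using conv(2) by (simp add: drift_def set_lebesgue_integral_def)
qed

text \<open>Without the compensator a jump contributes \<open>exp (- \<theta> * z) - 1\<close>,
  which is at most 0.\<close>

lemma laplace_psi_le_drift:
  assumes \<sigma>: "\<sigma> = 0" and int: "set_integrable \<nu> {0<..<1} (\<lambda>z. z)" and \<theta>: "0 \<le> \<theta>"
  shows "laplace_psi \<gamma> \<sigma> \<nu> \<theta> \<le> drift \<gamma> \<nu> * \<theta>"
proof -
  have "(LINT z:{0<..}|\<nu>. jump_integrand \<theta> z) \<le> (LINT z|\<nu>. \<theta> * (indicator {0<..<1} z *\<^sub>R z))"
    unfolding set_lebesgue_integral_def
  proof (rule integral_mono)
    show "integrable \<nu> (\<lambda>z. indicator {0<..} z *\<^sub>R jump_integrand \<theta> z)"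
      using integrable_jump[OF \<theta>] by (simp only: set_integrable_def)
    show "integrable \<nu> (\<lambda>z. \<theta> * (indicator {0<..<1} z *\<^sub>R z))"
      using int unfolding set_integrable_def by (rule integrable_mult_right)
    fix z
    show "indicator {0<..} z *\<^sub>R jump_integrand \<theta> z \<le> \<theta> * (indicator {0<..<1} z *\<^sub>R z)"
      using \<theta> by (auto simp: indicator_def)
  qed
  also have "\<dots> = \<theta> * (LINT z:{0<..<1}|\<nu>. z)"
    by (simp add: set_lebesgue_integral_def)
  finally show ?thesis
    using \<sigma> by (simp add: laplace_psi_def drift_def algebra_simps)
qed

text \<open>Here \<open>\<gamma>\<close> belongs to the refracted exponent, while \<open>X\<close>
  has \<open>\<gamma> + \<Delta>\<close>. Without positive drift the exponent of \<open>X\<close>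
  lies below a linear function, so the paths have bounded variation; the assumption then makes
  \<open>drift \<gamma> \<nu>\<close> positive, although it is at most 0.\<close>

lemma positive_drift_if_bounded_variation:
  assumes X: "levy_process M X" "has_laplace_exponent M X (laplace_psi (\<gamma> + \<Delta>) \<sigma> \<nu>)"
    and bv: "bounded_variation_paths M X \<longrightarrow> \<Delta> < drift (\<gamma> + \<Delta>) \<nu>"
  shows "positive_drift"
proof (rule ccontr)
  assume npd: "\<not> positive_drift"
  note small = small_jumps_integrable_if_not_positive_drift[OF npd]
  have \<sigma>: "\<sigma> = 0"
    using npd by (simp add: positive_drift_def)
  have psi: "laplace_psi (\<gamma> + \<Delta>) \<sigma> \<nu> \<theta> \<le> drift (\<gamma> + \<Delta>) \<nu> * \<theta>" if "0 \<le> \<theta>" for \<theta>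
    using laplace_psi_le_drift[OF \<sigma> small(1) that]
    by (simp add: laplace_psi_def drift_def algebra_simps)
  have "bounded_variation_paths M X"
    by (rule bounded_variation_if_laplace_exponent_le[OF X psi])
  then show False
    using bv small(2) by (simp add: drift_def)
qed

lemma scale_function_has_density:
  assumes W: "is_scale_function (laplace_psi \<gamma> \<sigma> \<nu>) q W" and q: "0 \<le> q" and pd: "positive_drift"
  shows "\<exists>v. has_density W (W 0) v \<and> (\<forall>x. 0 \<le> v x)"
  by (rule log_concave_has_density)
    (use W scale_function_log_concave[OF W q pd] in \<open>auto simp: is_scale_function_def\<close>)

end

lemma refracted_psi_laplace_psi:
  "refracted_psi (laplace_psi \<gamma> \<sigma> \<nu>) \<delta> j = laplace_psi (\<gamma> - (\<Sum>i=1..j. \<delta> i)) \<sigma> \<nu>"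
  by (rule ext) (simp add: refracted_psi_def laplace_psi_def algebra_simps)

theorem proposition17:
  fixes M :: "'a measure" and X :: "real \<Rightarrow> 'a \<Rightarrow> real"
    and \<gamma> \<sigma> q d :: real and \<nu> :: "real measure"
    and k :: nat and \<delta> b :: "nat \<Rightarrow> real" and W :: "nat \<Rightarrow> real \<Rightarrow> real"
  assumes "spectrally_negative_levy M X"
    and "without_monotone_paths M X"
    and "levy_measure \<nu>"
    and "has_laplace_exponent M X (laplace_psi \<gamma> \<sigma> \<nu>)"
    and "\<forall>i\<in>{1..k}. 0 < \<delta> i"
    and "strict_mono_on {1..k} b"
    and "bounded_variation_paths M X \<longrightarrow> (\<Sum>i=1..k. \<delta> i) < drift \<gamma> \<nu>"
    and "0 \<le> q"
    and "\<forall>j\<le>k. is_scale_function (refracted_psi (laplace_psi \<gamma> \<sigma> \<nu>) \<delta> j) q (W j)"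
    and "1 \<le> k \<longrightarrow> d < b 1"
  shows "is_solution (W 0) (refraction_rate \<delta> b k) d (refracted_w W \<delta> b d k) \<and>
    (\<forall>u. is_solution (W 0) (refraction_rate \<delta> b k) d u \<longrightarrow> u = refracted_w W \<delta> b d k)"
proof -
  define \<Delta> where "\<Delta> j = (\<Sum>i=1..j. \<delta> i)" for j
  have X: "levy_process M X"
    using assms(1) by (simp add: spectrally_negative_levy_def)
  have lx: "levy_exponent \<nu>"
    using assms(3) by (rule levy_exponent.intro)
  have \<delta>: "0 \<le> \<delta> i" if "i \<in> {1..k}" for i
    using assms(5) that by (auto intro: less_imp_le)
  have \<Delta>_mono: "\<Delta> j \<le> \<Delta> k" if "j \<le> k" for j
    unfolding \<Delta>_def using that \<delta> by (intro sum_mono2) auto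
  let ?psi = "\<lambda>j. laplace_psi (\<gamma> - \<Delta> j) \<sigma> \<nu>"
  have psi: "?psi j \<theta> = ?psi 0 \<theta> - \<Delta> j * \<theta>" for j \<theta>
    by (simp add: laplace_psi_def \<Delta>_def algebra_simps)
  have W: "is_scale_function (?psi j) q (W j)" if "j \<le> k" for j
    using assms(9) that by (simp add: refracted_psi_laplace_psi \<Delta>_def)
  \<comment> \<open>The condition on the drift concerns the total refraction;
    \<open>\<Delta>_mono\<close> passes it on to each level \<open>j\<close>.\<close>
  have pd: "levy_exponent.positive_drift (\<gamma> - \<Delta> j) \<sigma> \<nu>" if "j \<le> k" for j
    using assms(4,7) \<Delta>_mono[OF that] unfolding \<Delta>_def[symmetric]
    by (intro levy_exponent.positive_drift_if_bounded_variation[OF lx X, of _ "\<Delta> j"]) auto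
  have big: "\<forall>\<^sub>F \<theta> in at_top. q < ?psi j \<theta>" if "j \<le> k" for j
    by (rule levy_exponent.laplace_psi_eventually_gt[OF lx pd[OF that]])
  have "\<forall>j\<in>{..k}. \<exists>v. has_density (W j) (W j 0) v \<and> (\<forall>x. 0 \<le> v x)"
    using levy_exponent.scale_function_has_density[OF lx W assms(8) pd] by auto
  then obtain v where v: "\<And>j. j \<le> k \<Longrightarrow> has_density (W j) (W j 0) (v j)" "\<And>j x. j \<le> k \<Longrightarrow> 0 \<le> v j x"
    by (metis atMost_iff)
  have resolvent: "W j x - W 0 x = (\<Sum>i=1..j. \<delta> i) * (W j 0 * W 0 x + conv (W 0) (v j) x)"
    if "1 \<le> j" "j \<le> k" for j x
  proof -
    have psi_j: "?psi j = (\<lambda>\<theta>. ?psi 0 \<theta> - \<Delta> j * \<theta>)"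
      by (rule ext) (rule psi)
    show ?thesis
      using resolvent_identity[OF W[OF le0] v(1)[OF le0] W[OF that(2), unfolded psi_j] v(1)[OF that(2)]
          v(2)[OF that(2)] big[OF le0] big[OF that(2), unfolded psi_j]]
      by (simp only: \<Delta>_def)
  qed
  have db: "d < b i" if i: "i \<in> {1..k}" for i
  proof -
    have "b 1 \<le> b i"
      using strict_mono_on_imp_mono_on[OF assms(6)] i by (auto intro: mono_onD)
    then show ?thesis
      using assms(10) i by auto
  qed
  obtain g where g: "causal d g"
    "AE x in lebesgue. (refracted_w W \<delta> b d k has_real_derivative g x) (at x)"
    "\<And>x. refracted_w W \<delta> b d k x = W 0 (x - d) + conv (W 0) (\<lambda>y. refraction_rate \<delta> b k y * g y) x"
    using refracted_w_representation[where W = W and c = "\<lambda>j. W j 0" and v = v and k = k and j = k,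
        OF v(1) resolvent \<delta> strict_mono_on_imp_mono_on[OF assms(6)] db] by blast
  have rate: "0 \<le> refraction_rate \<delta> b k x" "refraction_rate \<delta> b k x \<le> \<Delta> k" for x
    using refraction_rate_bounds[of k \<delta> b x] \<delta> by (auto simp: \<Delta>_def)
  then have rate_abs: "\<bar>refraction_rate \<delta> b k x\<bar> \<le> \<Delta> k" for x
    by simp
  have sol: "is_solution (W 0) (refraction_rate \<delta> b k) d (refracted_w W \<delta> b d k)"
    by (rule is_solution_of_representation[OF v(1)[OF le0] refraction_rate_measurable rate_abs g])
  have "\<forall>\<^sub>F \<theta> in at_top. q < ?psi 0 \<theta> \<and> q < ?psi k \<theta> \<and> 0 < \<theta> \<and> right_inverse (?psi 0) q < \<theta>"
    by (intro eventually_conj big eventually_gt_at_top) auto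
  then obtain \<theta> where \<theta>: "q < ?psi 0 \<theta>" "q < ?psi k \<theta>" "0 < \<theta>" "right_inverse (?psi 0) q < \<theta>"
    by (auto simp: eventually_at_top_linorder)
  note mono = levy_exponent.scale_function_log_concave(1,2)[OF lx W[OF le0] assms(8) pd[OF le0]]
  have W00: "0 \<le> W 0 0"
    by (rule mono(1))
  have "W 0 0 \<le> \<theta> / (?psi 0 \<theta> - q)"
    by (rule scale_function_at_zero[OF W[OF le0] mono(1) mono(2) \<theta>(3,4)]) auto
  then have W0\<theta>: "W 0 0 * (?psi 0 \<theta> - q) \<le> \<theta>"
    using \<theta>(1) by (simp add: pos_le_divide_eq)
  \<comment> \<open>\<open>q < ?psi k \<theta>\<close> reads
    \<open>\<Delta> k * \<theta> < ?psi 0 \<theta> - q\<close>; together with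
    \<open>W0\<theta>\<close> it compares \<open>W 0 0 * \<Delta> k * \<theta>\<close> with
    \<open>\<theta>\<close>.\<close>
  have less: "W 0 0 * \<Delta> k < 1"
  proof (cases "W 0 0 = 0")
    case False
    have "\<Delta> k * \<theta> < ?psi 0 \<theta> - q"
      using \<theta>(2) psi[of k \<theta>] by simp
    then have "W 0 0 * (\<Delta> k * \<theta>) < W 0 0 * (?psi 0 \<theta> - q)"
      using False W00 by (intro mult_strict_left_mono) auto
    with W0\<theta> have "W 0 0 * \<Delta> k * \<theta> < 1 * \<theta>"
      by (simp add: mult.assoc)
    then show ?thesis
      using mult_less_cancel_right_pos[OF \<theta>(3)] by blast
  qed simp
  have "\<exists>z. W 0 z \<noteq> 0"
  proof (rule ccontr)
    assume "\<nexists>z. W 0 z \<noteq> 0"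
    then have "(LINT x|lborel. exp (- \<theta> * x) * W 0 x) = 0"
      by simp
    then show False
      using scale_function_laplace(2)[OF W[OF le0] \<theta>(4)] \<theta>(1) by simp
  qed
  then obtain z where z: "W 0 z \<noteq> 0"
    by blast
  have "u = refracted_w W \<delta> b d k" if "is_solution (W 0) (refraction_rate \<delta> b k) d u" for u
    by (rule solution_unique[OF v(1)[OF le0] z refraction_rate_measurable rate W00 less that sol])
  with sol show ?thesis
    by blast
qed

end
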